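(* Let $A:\mathbb R^3\to\mathbb R^3$ and $V:\mathbb R^3\to\mathbb R$ be such that $(A,V)$ is admissible and satisfies the Pohozaev-type condition. Let $$c^*=2\,\frac{\hat\lambda_{1,A,V}}{\|\hat\psi_{1,A,V}\|_4^4},$$ where $\hat\lambda_{1,A,V}$ is the first eigenvalue of $\hat L_{A,V}=(i\nabla+A)^2+V$ and $\hat\psi_{1,A,V}$ is a first eigenfunction with $\|\hat\psi_{1,A,V}\|_2=1$. If $c\ge c^*$, then for every $r>0$ the infimum $m^r_c$ cannot be achieved by a solution of $$(i\nabla+A(x))^2u+(V(x)-\lambda)u=|u|^2u\ \text{ in }\mathbb R^3,\qquad \int_{\mathbb R^3}|u|^2=c .$$
   Context: Functions $u$ are complex valued and $\|\cdot\|_p$ is the $L^p(\mathbb R^3,\mathbb C)$ norm. The magnetic Laplacian is $(i\nabla+A)^2=-\Delta+2iA\cdot\nabla+i\,\mathrm{div}A+|A|^2$. $H^1_A=\{u\in L^2(\mathbb R^3,\mathbb C):\|(i\nabla+A)u\|_2<\infty\}$, $\Sigma_{A,V}=\{u\in H^1_A:\int_{\mathbb R^3}V|u|^2<\infty\}$, with $\|u\|^2_{\dot\Sigma_{A,V}}=\int_{\mathbb R^3}|(i\nabla+A)u|^2+V|u|^2$. $S_c=\{v\in\Sigma_{A,V}:\|v\|_2^2=c\}$, $B(r)=\{u\in\Sigma_{A,V}:\|u\|^2_{\dot\Sigma_{A,V}}\le r\}$, and $$\mathcal E(v)=\tfrac12\|v\|^2_{\dot\Sigma_{A,V}}-\tfrac14\int_{\mathbb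 R^3}|v|^4,\qquad m^r_c=\inf_{S_c\cap B(r)}\mathcal E .$$ Admissible: $A\in L^2_{loc}(\mathbb R^3,\mathbb R^3)\cap C^1(\mathbb R^3\setminus\{0\})$; $V\in L^1_{loc}(\mathbb R^3)\cap C^1(\mathbb R^3\setminus\{0\})$ with $\lim_{|x|\to\infty}V(x)=\infty$; and there is $\bar\alpha>0$ with $V(x)\ge\bar\alpha|A(x)|^2$ for all $x\ne0$. Pohozaev-type condition: (a) $\sup_{x\neq0}\frac{|x\cdot\nabla V(x)|+\sum_{j=1}^3|x|^2|\nabla A_j(x)|^2}{V(x)}<+\infty$; (b) there are $\varepsilon_0\in(0,\frac13)$, $\alpha_0>0$ with $\inf_{x\ne0}\tilde T_{A,V,\varepsilon_0}(x)/V(x)\ge\alpha_0$, where $$\tilde T_{A,V,\varepsilon_0}(x)=\tfrac12V+\tfrac16x\cdot\nabla V+\big(\tfrac12-\tfrac1{3\varepsilon_0}\big)|A|^2-\tfrac1{6\varepsilon_0}\sum_{j=1}^3|x\cdot\nabla A_j|^2+\tfrac13\sum_{j=1}^3A_j\,(x\cdot\nabla A_j).$$ First eigenvalue: $\hat\lambda_{1,A,V}=\min\{\|u\|^2_{\dot\Sigma_{A,V}}:u\in\Sigma_{A,V},\|u\|_2=1\}>0$, and a first eigenfunction is a minimizer. Solution: $u\in S_c$ for which there is $\lambda\in\mathbb R$ with $\mathrm{Re}\int\big[(i\nabla+A)u\cdot\overline{(i\nabla+A)v}+(V-\lambda)u\bar v-|u|^2u\bar v\big]=0$ for all $v\in\Sigma_{A,V}$.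 *)

theory Defs
  imports "HOL-Analysis.Analysis"
begin

type_synonym R3 = "real ^ 3"

text \<open>Elements of Lebesgue spaces are represented by Borel functions, which is no restriction
  since every Lebesgue measurable function has a Borel representative.\<close>

definition in_Lp :: "real \<Rightarrow> (R3 \<Rightarrow> 'b::real_normed_vector) \<Rightarrow> bool" where
  "in_Lp p f \<longleftrightarrow> f \<in> borel_measurable lborel \<and> integrable lborel (\<lambda>x. norm (f x) powr p)"

definition Lp_norm :: "real \<Rightarrow> (R3 \<Rightarrow> 'b::real_normed_vector) \<Rightarrow> real" where
  "Lp_norm p f = (LINT x|lborel. norm (f x) powr p) powr (1 / p)"

definition in_Lp_loc :: "real \<Rightarrow> (R3 \<Rightarrow> 'b::real_normed_vector) \<Rightarrow> bool" where
  "in_Lp_loc p f \<longleftrightarrow> f \<in> borel_measurable lborel \<and>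
     (\<forall>K. compact K \<longrightarrow> set_integrable lborel K (\<lambda>x. norm (f x) powr p))"

definition pderiv_at :: "3 \<Rightarrow> (R3 \<Rightarrow> 'b::real_normed_vector) \<Rightarrow> R3 \<Rightarrow> 'b" where
  "pderiv_at j f x = frechet_derivative f (at x) (axis j 1)"

definition grad :: "(R3 \<Rightarrow> real) \<Rightarrow> R3 \<Rightarrow> R3" where
  "grad f x = (\<chi> j. pderiv_at j f x)"

definition C1_on :: "R3 set \<Rightarrow> (R3 \<Rightarrow> 'b::real_normed_vector) \<Rightarrow> bool" where
  "C1_on S f \<longleftrightarrow> (\<forall>x\<in>S. f differentiable (at x)) \<and> (\<forall>j. continuous_on S (pderiv_at j f))"

primrec Ck :: "nat \<Rightarrow> (R3 \<Rightarrow> real) \<Rightarrow> bool" where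
  "Ck 0 f \<longleftrightarrow> continuous_on UNIV f"
| "Ck (Suc k) f \<longleftrightarrow> (\<forall>x. f differentiable (at x)) \<and> (\<forall>j. Ck k (pderiv_at j f))"

definition test_function :: "(R3 \<Rightarrow> real) \<Rightarrow> bool" where
  "test_function \<phi> \<longleftrightarrow> (\<forall>k. Ck k \<phi>) \<and> compact (closure {x. \<phi> x \<noteq> 0})"

text \<open>The equation \<open>g = (i\<nabla> + A) u\<close> in the sense of distributions. For \<open>A\<close> in
  \<open>L\<^sup>2\<^sub>l\<^sub>o\<^sub>c\<close> and \<open>u\<close>, \<open>g\<close> in \<open>L\<^sup>2\<close> all integrals converge, and \<open>g\<close> is unique up to null sets.
  Complex test functions give nothing more, by linearity.\<close>

definition has_mag_grad :: "(R3 \<Rightarrow> R3) \<Rightarrow> (R3 \<Rightarrow> complex) \<Rightarrow> (R3 \<Rightarrow> complex ^ 3) \<Rightarrow> bool" where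
  "has_mag_grad A u g \<longleftrightarrow> (\<forall>\<phi> j. test_function \<phi> \<longrightarrow>
     - \<i> * (LINT x|lborel. u x * of_real (pderiv_at j \<phi> x))
       + (LINT x|lborel. of_real (A x $ j) * u x * of_real (\<phi> x))
     = (LINT x|lborel. g x $ j * of_real (\<phi> x)))"

definition H1A :: "(R3 \<Rightarrow> R3) \<Rightarrow> (R3 \<Rightarrow> complex) set" where
  "H1A A = {u. in_Lp 2 u \<and> (\<exists>g. in_Lp 2 g \<and> has_mag_grad A u g)}"

definition mag_grad :: "(R3 \<Rightarrow> R3) \<Rightarrow> (R3 \<Rightarrow> complex) \<Rightarrow> R3 \<Rightarrow> complex ^ 3" where
  "mag_grad A u = (SOME g. in_Lp 2 g \<and> has_mag_grad A u g)"

text \<open>For \<open>V \<ge> 0\<close> almost everywhere, as in all uses below, integrability expresses that the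
  integral of \<open>V |u|\<^sup>2\<close> is finite.\<close>

definition Sigma_space :: "(R3 \<Rightarrow> R3) \<Rightarrow> (R3 \<Rightarrow> real) \<Rightarrow> (R3 \<Rightarrow> complex) set" where
  "Sigma_space A V = {u \<in> H1A A. integrable lborel (\<lambda>x. V x * (cmod (u x))\<^sup>2)}"

definition Sigma_sq :: "(R3 \<Rightarrow> R3) \<Rightarrow> (R3 \<Rightarrow> real) \<Rightarrow> (R3 \<Rightarrow> complex) \<Rightarrow> real" where
  "Sigma_sq A V u = (LINT x|lborel. (norm (mag_grad A u x))\<^sup>2 + V x * (cmod (u x))\<^sup>2)"

definition mass_sphere :: "(R3 \<Rightarrow> R3) \<Rightarrow> (R3 \<Rightarrow> real) \<Rightarrow> real \<Rightarrow> (R3 \<Rightarrow> complex) set" where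
  "mass_sphere A V c = {v \<in> Sigma_space A V. (Lp_norm 2 v)\<^sup>2 = c}"

definition Sigma_ball :: "(R3 \<Rightarrow> R3) \<Rightarrow> (R3 \<Rightarrow> real) \<Rightarrow> real \<Rightarrow> (R3 \<Rightarrow> complex) set" where
  "Sigma_ball A V r = {u \<in> Sigma_space A V. Sigma_sq A V u \<le> r}"

text \<open>The quartic integral is finite on the energy space, by the diamagnetic inequality and
  the Sobolev embedding.\<close>

definition energy :: "(R3 \<Rightarrow> R3) \<Rightarrow> (R3 \<Rightarrow> real) \<Rightarrow> (R3 \<Rightarrow> complex) \<Rightarrow> real" where
  "energy A V v = 1/2 * Sigma_sq A V v - 1/4 * (LINT x|lborel. (cmod (v x)) ^ 4)"

text \<open>Extended real valued, so that the infimum is meaningful without a boundedness proof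
  (it is \<open>\<infinity>\<close> over the empty set).\<close>

definition local_min_energy :: "(R3 \<Rightarrow> R3) \<Rightarrow> (R3 \<Rightarrow> real) \<Rightarrow> real \<Rightarrow> real \<Rightarrow> ereal" where
  "local_min_energy A V r c =
     (INF v \<in> mass_sphere A V c \<inter> Sigma_ball A V r. ereal (energy A V v))"

definition admissible :: "(R3 \<Rightarrow> R3) \<Rightarrow> (R3 \<Rightarrow> real) \<Rightarrow> bool" where
  "admissible A V \<longleftrightarrow>
     in_Lp_loc 2 A \<and> C1_on (- {0}) A \<and>
     in_Lp_loc 1 V \<and> C1_on (- {0}) V \<and>
     filterlim V at_top at_infinity \<and>
     (\<exists>\<alpha>>0. \<forall>x. x \<noteq> 0 \<longrightarrow> V x \<ge> \<alpha> * (norm (A x))\<^sup>2)"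

definition Ttilde :: "(R3 \<Rightarrow> R3) \<Rightarrow> (R3 \<Rightarrow> real) \<Rightarrow> real \<Rightarrow> R3 \<Rightarrow> real" where
  "Ttilde A V \<epsilon> x =
     1/2 * V x + 1/6 * (x \<bullet> grad V x)
     + (1/2 - 1 / (3 * \<epsilon>)) * (norm (A x))\<^sup>2
     - 1 / (6 * \<epsilon>) * (\<Sum>j\<in>UNIV. (x \<bullet> grad (\<lambda>y. A y $ j) x)\<^sup>2)
     + 1/3 * (\<Sum>j\<in>UNIV. A x $ j * (x \<bullet> grad (\<lambda>y. A y $ j) x))"

text \<open>The quotients presuppose \<open>V x \<noteq> 0\<close> for \<open>x \<noteq> 0\<close>. As division by zero yields zero, the
  second condition enforces this.\<close>

definition pohozaev_condition :: "(R3 \<Rightarrow> R3) \<Rightarrow> (R3 \<Rightarrow> real) \<Rightarrow> bool" where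
  "pohozaev_condition A V \<longleftrightarrow>
     (SUP x \<in> - {0}. ereal ((\<bar>x \<bullet> grad V x\<bar>
        + (\<Sum>j\<in>UNIV. (norm x)\<^sup>2 * (norm (grad (\<lambda>y. A y $ j) x))\<^sup>2)) / V x)) < \<infinity> \<and>
     (\<exists>\<epsilon>\<^sub>0 \<alpha>\<^sub>0. 0 < \<epsilon>\<^sub>0 \<and> \<epsilon>\<^sub>0 < 1/3 \<and> 0 < \<alpha>\<^sub>0 \<and>
        (INF x \<in> - {0}. ereal (Ttilde A V \<epsilon>\<^sub>0 x / V x)) \<ge> ereal \<alpha>\<^sub>0)"

definition first_eigenvalue :: "(R3 \<Rightarrow> R3) \<Rightarrow> (R3 \<Rightarrow> real) \<Rightarrow> real" where
  "first_eigenvalue A V = Inf {Sigma_sq A V u | u. u \<in> Sigma_space A V \<and> Lp_norm 2 u = 1}"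

text \<open>A minimizer, so that the infimum in \<open>first_eigenvalue\<close> is a minimum whenever a first
  eigenfunction exists.\<close>

definition first_eigenfunction :: "(R3 \<Rightarrow> R3) \<Rightarrow> (R3 \<Rightarrow> real) \<Rightarrow> (R3 \<Rightarrow> complex) \<Rightarrow> bool" where
  "first_eigenfunction A V \<psi> \<longleftrightarrow>
     \<psi> \<in> Sigma_space A V \<and> Lp_norm 2 \<psi> = 1 \<and>
     (\<forall>u \<in> Sigma_space A V. Lp_norm 2 u = 1 \<longrightarrow> Sigma_sq A V \<psi> \<le> Sigma_sq A V u)"

definition is_solution :: "(R3 \<Rightarrow> R3) \<Rightarrow> (R3 \<Rightarrow> real) \<Rightarrow> real \<Rightarrow> (R3 \<Rightarrow> complex) \<Rightarrow> bool" where
  "is_solution A V c u \<longleftrightarrow> u \<in> mass_sphere A V c \<and>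
     (\<exists>\<mu>::real. \<forall>v \<in> Sigma_space A V.
        Re (LINT x|lborel.
              (\<Sum>j\<in>UNIV. mag_grad A u x $ j * cnj (mag_grad A v x $ j))
              + of_real (V x - \<mu>) * u x * cnj (v x)
              - of_real ((cmod (u x))\<^sup>2) * u x * cnj (v x)) = 0)"

end

theory Submission imports Defs begin

text \<open>The multiple \<open>\<surd>c \<psi>\<close> of the eigenfunction has mass \<open>c\<close>, lies in the ball as soon as the constraint
  set is nonempty, and for \<open>c \<ge> c\<^sup>*\<close> has energy at most \<open>0\<close>; hence the infimum is at most \<open>0\<close>. A
  solution, on the other hand, has positive energy: differentiating the energy along the mass
  preserving dilations \<open>u\<^sub>t(x) = t\<^sup>3\<^sup>/\<^sup>2 u(t x)\<close> at \<open>t = 1\<close> gives the Pohozaev identity, which bounds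
  the quartic term, and then condition (b) and Young's inequality bound the energy from below by
  \<open>\<alpha>\<^sub>0 \<integral> V |u|\<^sup>2\<close>.

  For a weak solution only the inequality \<open>d/dt \<ge> 0\<close> is needed, and it follows without elliptic
  regularity by testing the equation with \<open>u\<^sub>t - u\<close>. The quartic terms require the embedding of
  \<open>H\<^sup>1\<close> into \<open>L\<^sup>4\<close>; it is obtained from the translation estimate
  \<open>\<parallel>u(\<cdot> + h) - u\<parallel>\<^sub>2 \<le> |h| \<parallel>\<nabla>u\<parallel>\<^sub>2\<close> by bootstrapping the measure of the level sets of \<open>|u|\<close>.\<close>


subsection \<open>Test functions\<close>

text \<open>The Pohozaev inequality bounds the quartic term from above, and the energy carries that
  term negatively, so dilations with \<open>t > 1\<close> suffice. Weighted by 1/3 it leaves a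
  pointwise quadratic form in the gradient, \<open>A u\<close> and \<open>(x . grad A) u\<close>.
  Young's inequality with \<open>\<epsilon>\<^sub>0\<close> on the two cross terms costs
  \<open>\<epsilon>\<^sub>0 / 2\<close> of the coefficient 1/6 of the squared gradient: the origin
  of \<open>\<epsilon>\<^sub>0 < 1/3\<close> and of the coefficients of \<open>Ttilde\<close>. The
  obstacle is that \<open>u\<close> has only one weak derivative, so \<open>u\<^sub>t\<close> need
  not be differentiable in \<open>t\<close> in the energy space. A change of variables moves
  \<open>t\<close> from \<open>u\<close> onto \<open>A\<close>, \<open>V\<close> and explicit
  factors, and condition (a) controls difference quotients of the potentials along rays. The error
  of the linearization is quadratic in \<open>w = u\<^sub>t - u\<close>: the energy norm of
  \<open>w\<close>, of unknown size, has the good sign, and only the local L2 norm, which is O(t -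
  1), has to be paid. The bound \<open>V \<ge> \<alpha> |A|^2\<close> puts \<open>A u\<close>, hence
  the plain gradient of \<open>u\<close>, into L2, so dilations and the embedding act on ordinary
  weak gradients.\<close>

lemma pderiv_at_eq:
  assumes "(f has_derivative f') (at x)"
  shows "pderiv_at j f x = f' (axis j 1)"
  using assms frechet_derivative_at unfolding pderiv_at_def by metis

lemma sum_axis_mult: "(\<Sum>i\<in>UNIV. axis j (1::real) $ i * f i) = f j"
  by (simp add: axis_def if_distrib[of "\<lambda>c. c * _"] cong: if_cong)

text \<open>\<open>pderiv_at\<close> rests on a chosen Frechet derivative; derivatives being unique,
  an explicit candidate may be substituted for it. Most closure properties below run through this
  rule.\<close>

lemma Ck_SucI:
  assumes "\<And>x. (f has_derivative f' x) (at x)" "\<And>j. Ck k (\<lambda>x. f' x (axis j 1))"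
  shows "Ck (Suc k) f"
proof -
  have "pderiv_at j f = (\<lambda>x. f' x (axis j 1))" for j
    using assms(1) pderiv_at_eq by blast
  then show ?thesis
    using assms by (auto simp: differentiable_def)
qed

lemma Ck_continuous_on: "Ck k f \<Longrightarrow> continuous_on S f"
proof (cases k)
  case 0
  then show "Ck k f \<Longrightarrow> ?thesis"
    by (simp add: continuous_on_subset[OF _ subset_UNIV])
next
  case (Suc n)
  show ?thesis if "Ck k f"
    by (rule differentiable_imp_continuous_on)
       (use that Suc in \<open>simp add: differentiable_on_def differentiable_at_withinI\<close>)
qed

lemma Ck_SucD_has_derivative:
  assumes "Ck (Suc k) f"
  shows "(f has_derivative (\<lambda>v. \<Sum>j\<in>UNIV. v $ j * pderiv_at j f x)) (at x)"
proof -
  let ?D = "frechet_derivative f (at x)"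
  have d: "(f has_derivative ?D) (at x)"
    using assms frechet_derivative_works by auto
  then interpret linear ?D by (rule has_derivative_linear)
  have eq: "?D v = (\<Sum>j\<in>UNIV. v $ j * pderiv_at j f x)" for v
  proof -
    have "?D v = ?D (\<Sum>j\<in>UNIV. v $ j *\<^sub>R axis j 1)"
      by (simp add: basis_expansion flip: scalar_mult_eq_scaleR)
    then show ?thesis
      by (simp add: sum scale pderiv_at_def)
  qed
  show ?thesis
    using d unfolding eq[abs_def] .
qed

lemma Ck_const: "Ck k (\<lambda>x. c)"
proof (induction k arbitrary: c)
  case (Suc k)
  have "((\<lambda>x :: R3. c) has_derivative (\<lambda>_. 0)) (at x)" for x
    by (rule has_derivative_const)
  then show ?case
    by (rule Ck_SucI) (rule Suc)
qed simp

lemma Ck_add: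
  assumes "Ck k f" "Ck k g"
  shows "Ck k (\<lambda>x. f x + g x)"
  using assms
proof (induction k arbitrary: f g)
  case (Suc k)
  show ?case
  proof (rule Ck_SucI)
    show "((\<lambda>x. f x + g x) has_derivative
        (\<lambda>v. (\<Sum>j\<in>UNIV. v $ j * pderiv_at j f x) + (\<Sum>j\<in>UNIV. v $ j * pderiv_at j g x))) (at x)" for x
      by (intro has_derivative_add Ck_SucD_has_derivative[OF Suc.prems(1)] Ck_SucD_has_derivative[OF Suc.prems(2)])
    show "Ck k (\<lambda>x. (\<Sum>i\<in>UNIV. axis j 1 $ i * pderiv_at i f x) + (\<Sum>i\<in>UNIV. axis j 1 $ i * pderiv_at i g x))" for j
      using Suc by (simp add: sum_axis_mult)
  qed
qed (simp add: continuous_on_add)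

lemma Ck_SucD: "Ck (Suc k) f \<Longrightarrow> Ck k f"
proof (induction k arbitrary: f)
  case 0
  then show ?case using Ck_continuous_on[of "Suc 0" f UNIV] by simp
next
  case (Suc k)
  then show ?case by simp
qed

lemma Ck_mult:
  assumes "Ck k f" "Ck k g"
  shows "Ck k (\<lambda>x. f x * g x)"
  using assms
proof (induction k arbitrary: f g)
  case (Suc k)
  show ?case
  proof (rule Ck_SucI)
    show "((\<lambda>x. f x * g x) has_derivative
        (\<lambda>v. f x * (\<Sum>j\<in>UNIV. v $ j * pderiv_at j g x) + (\<Sum>j\<in>UNIV. v $ j * pderiv_at j f x) * g x)) (at x)" for x
      by (intro has_derivative_mult Ck_SucD_has_derivative[OF Suc.prems(1)] Ck_SucD_has_derivative[OF Suc.prems(2)])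
    have "Ck k (\<lambda>x. f x * pderiv_at j g x + pderiv_at j f x * g x)" for j
      using Suc.prems Suc.prems[THEN Ck_SucD] by (intro Ck_add Suc.IH) auto
    then show "Ck k (\<lambda>x. f x * (\<Sum>i\<in>UNIV. axis j 1 $ i * pderiv_at i g x)
        + (\<Sum>i\<in>UNIV. axis j 1 $ i * pderiv_at i f x) * g x)" for j
      by (simp add: sum_axis_mult)
  qed
qed (simp add: continuous_on_mult)

lemma Ck_prod: "finite I \<Longrightarrow> (\<And>i. i \<in> I \<Longrightarrow> Ck k (f i)) \<Longrightarrow> Ck k (\<lambda>x. \<Prod>i\<in>I. f i x)"
proof (induction I rule: finite_induct)
  case empty
  show ?case by (simp only: prod.empty Ck_const)
next
  case (insert i I)
  have "Ck k (\<lambda>x. f i x * (\<Prod>i\<in>I. f i x))"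
    by (rule Ck_mult) (use insert in blast)+
  then show ?case
    using insert.hyps by simp
qed

lemma Ck_nth_affine: "Ck k (\<lambda>x. a * x $ i + b)"
proof (cases k)
  case 0
  then show ?thesis
    by (simp add: continuous_on_add continuous_on_mult continuous_on_component continuous_on_const continuous_on_id)
next
  case (Suc n)
  have "((\<lambda>x :: R3. a * x $ i + b) has_derivative (\<lambda>v. a * v $ i)) (at x)" for x
    by (intro has_derivative_add[OF _ has_derivative_const, simplified] has_derivative_mult_right
        bounded_linear_imp_has_derivative bounded_linear_vec_nth)
  moreover have "Ck n (\<lambda>x. a * axis j 1 $ i)" for j :: 3
    by (rule Ck_const)
  ultimately show ?thesis
    unfolding Suc by (rule Ck_SucI)
qed

lemma Ck_affine:
  fixes f :: "R3 \<Rightarrow> real"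
  assumes "Ck k f"
  shows "Ck k (\<lambda>x. f (a *\<^sub>R x + b :: R3))"
  using assms
proof (induction k arbitrary: f)
  case 0
  then show ?case
    using continuous_on_compose2[of UNIV f UNIV "\<lambda>x. a *\<^sub>R x + b", OF _ continuous_on_add[OF
          continuous_on_scaleR[OF continuous_on_const continuous_on_id] continuous_on_const]]
    by simp
next
  case (Suc k)
  show ?case
  proof (rule Ck_SucI)
    show "((\<lambda>x. f (a *\<^sub>R x + b)) has_derivative
        (\<lambda>v. \<Sum>j\<in>UNIV. (a *\<^sub>R v) $ j * pderiv_at j f (a *\<^sub>R x + b))) (at x)" for x
    proof -
      have "((\<lambda>x. a *\<^sub>R x + b) has_derivative (\<lambda>v. a *\<^sub>R v)) (at x)"
        by (auto intro!: derivative_eq_intros)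
      then show ?thesis
        by (rule has_derivative_compose[OF _ Ck_SucD_has_derivative[OF Suc.prems]])
    qed
    have "Ck k (\<lambda>x. a * pderiv_at j f (a *\<^sub>R x + b))" for j
      using Suc by (intro Ck_mult Ck_const) auto
    then show "Ck k (\<lambda>x. \<Sum>i\<in>UNIV. (a *\<^sub>R axis j 1) $ i * pderiv_at i f (a *\<^sub>R x + b))" for j
      by (simp add: sum_axis_mult mult.assoc flip: sum_distrib_left)
  qed
qed

text \<open>Carrying the whole sequence \<open>D\<close> of derivatives of the outer function keeps
  the induction inside one family: the chain rule turns \<open>D m\<close> into
  \<open>D (Suc m)\<close> times a partial derivative of \<open>g\<close>, and \<open>m\<close> is
  generalized.\<close>

lemma Ck_compose_real:
  assumes "\<And>m x. (D m has_real_derivative D (Suc m) x) (at x)" "\<And>n. Ck n g"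
  shows "Ck k (\<lambda>x. D m (g x))"
proof (induction k arbitrary: m)
  case 0
  have "continuous_on UNIV (D m)"
    using assms(1) by (auto simp: continuous_on_eq_continuous_at intro: DERIV_isCont)
  then show ?case
    using continuous_on_compose2[of UNIV "D m" UNIV g] Ck_continuous_on[OF assms(2)] by simp
next
  case (Suc k)
  show ?case
  proof (rule Ck_SucI)
    show "((\<lambda>x. D m (g x)) has_derivative
        (\<lambda>v. D (Suc m) (g x) * (\<Sum>j\<in>UNIV. v $ j * pderiv_at j g x))) (at x)" for x
      by (rule has_derivative_compose[OF Ck_SucD_has_derivative[OF assms(2)]
            assms(1)[THEN has_field_derivative_imp_has_derivative]])
    have "Ck k (\<lambda>x. D (Suc m) (g x) * pderiv_at j g x)" for j
      using assms(2)[of "Suc k"] by (intro Ck_mult Suc) auto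
    then show "Ck k (\<lambda>x. D (Suc m) (g x) * (\<Sum>i\<in>UNIV. axis j 1 $ i * pderiv_at i g x))" for j
      by (simp add: sum_axis_mult)
  qed
qed

section \<open>The flat function \<open>exp (- 1 / x)\<close> and smooth bumps on boxes\<close>

definition flat :: "real poly \<Rightarrow> real \<Rightarrow> real" where
  "flat p x = (if x > 0 then poly p (1 / x) * exp (- 1 / x) else 0)"

text \<open>In the variable \<open>y = 1 / x\<close> this is the decay of a polynomial times
  \<open>exp (- y)\<close> at infinity.\<close>

lemma flat_tendsto_0: "(flat p \<longlongrightarrow> 0) (at_right 0)"
proof -
  have "((\<lambda>y. y ^ i * exp (- y)) \<longlongrightarrow> 0) (at_top :: real filter)" for i
    using tendsto_power_div_exp_0[of i] by (simp add: exp_minus field_simps)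
  then have "((\<lambda>y. \<Sum>i\<le>degree p. coeff p i * (y ^ i * exp (- y))) \<longlongrightarrow> (\<Sum>i\<le>degree p. coeff p i * 0)) (at_top :: real filter)"
    by (intro tendsto_intros)
  then have "((\<lambda>y. poly p y * exp (- y)) \<longlongrightarrow> 0) (at_top :: real filter)"
    by (simp add: poly_altdef sum_distrib_right mult.assoc)
  from filterlim_compose[OF this filterlim_inverse_at_top_right]
  show ?thesis
    by (rule Lim_transform_eventually)
       (auto simp: flat_def eventually_at_filter inverse_eq_divide)
qed

text \<open>For \<open>x > 0\<close>, differentiating the exponential contributes \<open>p\<close>
  and differentiating the polynomial contributes \<open>- pderiv p\<close>, both with the factor
  \<open>1 / x^2\<close>, which is \<open>[:0,0,1:]\<close> as a polynomial in \<open>1 / x\<close>.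
  The polynomial in \<open>flat\<close> is there to make the family closed under
  differentiation.\<close>

lemma flat_has_derivative:
  "(flat p has_real_derivative flat ([:0,0,1:] * (p - pderiv p)) x) (at x)"
proof (cases x "0 :: real" rule: linorder_cases)
  case less
  have "((\<lambda>_. 0) has_real_derivative 0) (at x)" by simp
  then show ?thesis
    by (rule has_field_derivative_transform_within_open[of _ _ _ "{..<0}", THEN DERIV_cong])
       (use less in \<open>auto simp: flat_def\<close>)
next
  case greater
  have "((\<lambda>x. poly p (1 / x) * exp (- 1 / x)) has_real_derivative
      flat ([:0,0,1:] * (p - pderiv p)) x) (at x)"
    using greater
    by (auto intro!: derivative_eq_intros poly_DERIV[THEN DERIV_chain2] simp: flat_def field_simps power2_eq_square)
  then show ?thesis
    by (rule has_field_derivative_transform_within_open[of _ _ _ "{0<..}"])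
       (use greater in \<open>auto simp: flat_def\<close>)
next
  case equal
  \<comment> \<open>Dividing by \<open>h\<close> multiplies the polynomial in \<open>1 / h\<close>
    by its variable, so the difference quotient at 0 is again a \<open>flat\<close>
    function.\<close>
  have r: "((\<lambda>h. flat p h / h) \<longlongrightarrow> 0) (at_right 0)"
    using flat_tendsto_0[of "[:0,1:] * p"]
    by (rule Lim_transform_eventually) (auto simp: flat_def eventually_at_filter)
  have l: "((\<lambda>h. flat p h / h) \<longlongrightarrow> 0) (at_left 0)"
    by (rule Lim_transform_eventually[OF tendsto_const]) (auto simp: flat_def eventually_at_filter)
  have "((\<lambda>h. flat p h / h) \<longlongrightarrow> 0) (at 0)"
    using r l by (simp add: filterlim_at_split)
  then show ?thesis
    using equal by (simp add: DERIV_def) (simp add: flat_def)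
qed

lemma Ck_flat:
  assumes "\<And>n. Ck n g"
  shows "Ck k (\<lambda>x. flat p (g x))"
proof -
  define D where "D m = flat (((\<lambda>p. [:0,0,1:] * (p - pderiv p)) ^^ m) p)" for m
  have "Ck k (\<lambda>x. D 0 (g x))"
    by (rule Ck_compose_real) (use assms in \<open>auto simp: D_def intro!: flat_has_derivative[THEN DERIV_cong]\<close>)
  then show ?thesis by (simp add: D_def)
qed

text \<open>As \<open>n\<close> grows this increases to the indicator function of the open box.\<close>

definition box_bump :: "nat \<Rightarrow> R3 \<Rightarrow> R3 \<Rightarrow> R3 \<Rightarrow> real" where
  "box_bump n a b x = (\<Prod>i\<in>UNIV. flat 1 (real n * (x $ i - a $ i)) * flat 1 (real n * (b $ i - x $ i)))"

lemma flat_1_bounds: "0 \<le> flat 1 x" "flat 1 x \<le> 1"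
  by (auto simp: flat_def)

lemma test_function_iff: "test_function \<phi> \<longleftrightarrow> (\<forall>k. Ck k \<phi>) \<and> bounded {x. \<phi> x \<noteq> 0}"
  by (simp add: test_function_def)

lemma box_bump_eq_0: "x \<notin> box a b \<Longrightarrow> box_bump n a b x = 0"
proof -
  assume "x \<notin> box a b"
  then obtain i where "\<not> (a $ i < x $ i \<and> x $ i < b $ i)"
    by (auto simp: mem_box_cart)
  then have "flat 1 (real n * (x $ i - a $ i)) * flat 1 (real n * (b $ i - x $ i)) = 0"
    by (auto simp: flat_def zero_less_mult_iff)
  then show ?thesis
    unfolding box_bump_def by (meson UNIV_I finite prod_zero)
qed

lemma test_functionI: "(\<And>k. Ck k \<phi>) \<Longrightarrow> bounded {x. \<phi> x \<noteq> 0} \<Longrightarrow> test_function \<phi>"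
  unfolding test_function_iff by (intro conjI allI)

lemma Ck_box_bump: "Ck k (box_bump n a b)"
proof -
  have eq: "(\<lambda>x :: R3. real n * (x $ i - a $ i)) = (\<lambda>x. real n * x $ i + - real n * a $ i)"
    "(\<lambda>x :: R3. real n * (b $ i - x $ i)) = (\<lambda>x. - real n * x $ i + real n * b $ i)" for i
    by (simp_all add: algebra_simps fun_eq_iff)
  have "Ck m (\<lambda>x. real n * (x $ i - a $ i))" "Ck m (\<lambda>x. real n * (b $ i - x $ i))" for i m
    unfolding eq by (rule Ck_nth_affine)+
  then have *: "Ck k (\<lambda>x. flat 1 (real n * (x $ i - a $ i)) * flat 1 (real n * (b $ i - x $ i)))" for i
    by (rule Ck_mult[OF Ck_flat[where g = "\<lambda>x. real n * (x $ i - a $ i)"]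
          Ck_flat[where g = "\<lambda>x. real n * (b $ i - x $ i)"]])
  show ?thesis
    unfolding box_bump_def[abs_def] by (rule Ck_prod[OF finite *])
qed

lemma test_function_box_bump: "test_function (box_bump n a b)"
proof -
  have "{x. box_bump n a b x \<noteq> 0} \<subseteq> box a b"
    using box_bump_eq_0 by blast
  then have "bounded {x. box_bump n a b x \<noteq> 0}"
    using bounded_box bounded_subset by blast
  with Ck_box_bump show ?thesis
    by (rule test_functionI)
qed

lemma box_bump_bounds: "0 \<le> box_bump n a b x" "box_bump n a b x \<le> 1"
proof -
  have "0 \<le> flat 1 s * flat 1 t \<and> flat 1 s * flat 1 t \<le> 1" for s t
    using mult_le_one[OF flat_1_bounds(2) flat_1_bounds] flat_1_bounds by simp
  then show "0 \<le> box_bump n a b x" "box_bump n a b x \<le> 1"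
    unfolding box_bump_def by (blast intro: prod_nonneg prod_le_1)+
qed

lemma box_bump_tendsto: "(\<lambda>n. box_bump n a b x) \<longlonglongrightarrow> indicator (box a b) x"
proof (cases "x \<in> box a b")
  case True
  have *: "(\<lambda>n. flat 1 (real n * d)) \<longlonglongrightarrow> 1" if "d > 0" for d
  proof -
    have "(\<lambda>n. exp (- (1 / d) * (1 / real n))) \<longlonglongrightarrow> exp (- (1 / d) * 0)"
      by (intro tendsto_intros lim_1_over_n)
    then have "(\<lambda>n. exp (- (1 / d) * (1 / real n))) \<longlonglongrightarrow> 1"
      by simp
    then show ?thesis
      by (rule Lim_transform_eventually)
         (use that in \<open>auto simp: flat_def field_simps intro!: eventually_sequentiallyI[of 1]\<close>)
  qed
  have "(\<lambda>n. box_bump n a b x) \<longlonglongrightarrow> (\<Prod>i\<in>(UNIV :: 3 set). 1 * 1)"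
    unfolding box_bump_def using True by (intro tendsto_intros *) (auto simp: mem_box_cart)
  then show ?thesis
    using True by simp
next
  case False
  then show ?thesis by (simp add: box_bump_eq_0)
qed

section \<open>Closure properties, supports and bounds of test functions\<close>

lemma test_function_Ck: "test_function \<phi> \<Longrightarrow> Ck k \<phi>"
  unfolding test_function_def by blast

lemma test_function_continuous_on: "test_function \<phi> \<Longrightarrow> continuous_on S \<phi>"
  using test_function_Ck Ck_continuous_on by blast

lemma test_function_pderiv:
  assumes "test_function \<phi>"
  shows "test_function (pderiv_at j \<phi>)"
proof -
  have 0: "pderiv_at j \<phi> x = 0" if "x \<notin> closure {x. \<phi> x \<noteq> 0}" for x
  proof -
    have "(\<phi> has_derivative (\<lambda>_. 0)) (at x)"
      by (rule has_derivative_transform_within_open[of "\<lambda>_. 0" _ _ UNIV "- closure {x. \<phi> x \<noteq> 0}"])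
         (use that closure_subset[of "{x. \<phi> x \<noteq> 0}"] in auto)
    then show ?thesis by (rule pderiv_at_eq)
  qed
  then have "{x. pderiv_at j \<phi> x \<noteq> 0} \<subseteq> closure {x. \<phi> x \<noteq> 0}"
    by blast
  moreover have "bounded (closure {x. \<phi> x \<noteq> 0})"
    using assms unfolding test_function_iff by (intro bounded_closure) blast
  ultimately have b: "bounded {x. pderiv_at j \<phi> x \<noteq> 0}"
    using bounded_subset by blast
  have "Ck k (pderiv_at j \<phi>)" for k
    using test_function_Ck[OF assms, of "Suc k"] by simp
  then show ?thesis
    using b by (rule test_functionI)
qed

lemma test_function_mult_left:
  assumes "\<And>k. Ck k f" "test_function \<phi>"
  shows "test_function (\<lambda>x. f x * \<phi> x)"
proof -
  have "{x. f x * \<phi> x \<noteq> 0} \<subseteq> {x. \<phi> x \<noteq> 0}"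
    by auto
  then have b: "bounded {x. f x * \<phi> x \<noteq> 0}"
    using assms(2) bounded_subset unfolding test_function_iff by blast
  have c: "Ck k (\<lambda>x. f x * \<phi> x)" for k
    by (rule Ck_mult[OF assms(1) test_function_Ck[OF assms(2)]])
  show ?thesis
    using c b by (rule test_functionI)
qed

lemma test_function_bounded_support:
  assumes "test_function \<phi>"
  obtains R where "R > 0" "\<And>x. norm x > R \<Longrightarrow> \<phi> x = 0"
proof -
  from assms have "bounded {x. \<phi> x \<noteq> 0}"
    unfolding test_function_iff by blast
  then obtain R where R: "R > 0" "\<And>x. \<phi> x \<noteq> 0 \<Longrightarrow> norm x \<le> R"
    unfolding bounded_pos by blast
  show ?thesis
    by (rule that[OF R(1)]) (use R(2) in fastforce)
qed

lemma test_functionI_norm: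
  assumes "\<And>k. Ck k \<phi>" "\<And>x. norm x > R \<Longrightarrow> \<phi> x = 0"
  shows "test_function \<phi>"
proof -
  have "{x. \<phi> x \<noteq> 0} \<subseteq> cball 0 R"
    using assms(2) by (auto simp: not_less[symmetric])
  then have "bounded {x. \<phi> x \<noteq> 0}"
    using bounded_cball bounded_subset by blast
  with assms(1) show ?thesis
    by (rule test_functionI)
qed

lemma test_function_affine:
  fixes b :: R3
  assumes "test_function \<phi>" "a \<noteq> 0"
  shows "test_function (\<lambda>x. \<phi> (a *\<^sub>R x + b))"
proof -
  obtain R where R: "R > 0" "\<And>x. norm x > R \<Longrightarrow> \<phi> x = 0"
    using test_function_bounded_support[OF assms(1)] by blast
  show ?thesis
  proof (rule test_functionI_norm)
    show "Ck k (\<lambda>x. \<phi> (a *\<^sub>R x + b))" for k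
      by (rule Ck_affine[OF test_function_Ck[OF assms(1)]])
    fix x :: R3 assume "norm x > (R + norm b) / \<bar>a\<bar>"
    then have "\<bar>a\<bar> * norm x > R + norm b"
      using assms(2) by (simp add: field_simps)
    moreover have "norm (a *\<^sub>R x) \<le> norm (a *\<^sub>R x + b) + norm b"
      using norm_triangle_ineq4[of "a *\<^sub>R x + b" b] by simp
    ultimately have "norm (a *\<^sub>R x + b) > R"
      by simp
    then show "\<phi> (a *\<^sub>R x + b) = 0" by (rule R)
  qed
qed

lemma test_function_measurable:
  assumes "test_function \<phi>" shows "\<phi> \<in> borel_measurable borel"
  using borel_measurable_continuous_onI[OF test_function_continuous_on[OF assms]] .

lemma test_function_bounded:
  assumes "test_function \<phi>"
  obtains B where "B > 0" "\<And>x. \<bar>\<phi> x\<bar> \<le> B"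
proof -
  have K: "compact (closure {x. \<phi> x \<noteq> 0})"
    using assms unfolding test_function_def by (rule conjunct2)
  have "bounded (\<phi> ` closure {x. \<phi> x \<noteq> 0})"
    by (rule compact_imp_bounded[OF compact_continuous_image[OF test_function_continuous_on[OF assms] K]])
  then obtain B where B: "B > 0" "\<forall>y \<in> \<phi> ` closure {x. \<phi> x \<noteq> 0}. norm y \<le> B"
    unfolding bounded_pos by (elim exE conjE)
  show ?thesis
  proof (rule that[OF B(1)])
    fix x
    show "\<bar>\<phi> x\<bar> \<le> B"
    proof (cases "\<phi> x = 0")
      case False
      then have "x \<in> closure {x. \<phi> x \<noteq> 0}"
        using closure_subset[of "{x. \<phi> x \<noteq> 0}"] by (simp add: subset_iff)
      then show ?thesis
        using B(2) by simp
    next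
      case True
      then show ?thesis using B(1) by simp
    qed
  qed
qed

subsection \<open>Affine changes of variables\<close>

lemma nn_integral_lborel_affine:
  fixes f :: "R3 \<Rightarrow> ennreal"
  assumes [measurable]: "f \<in> borel_measurable borel" and "c \<noteq> 0"
  shows "(\<integral>\<^sup>+x. f (c *\<^sub>R x + b) \<partial>lborel) = ennreal (1 / \<bar>c\<bar> ^ 3) * (\<integral>\<^sup>+x. f x \<partial>lborel)"
proof -
  have "(\<integral>\<^sup>+x. f x \<partial>lborel) = ennreal (\<bar>c\<bar> ^ 3) * (\<integral>\<^sup>+x. f (b + c *\<^sub>R x) \<partial>lborel)"
    by (subst lborel_affine[OF \<open>c \<noteq> 0\<close>, of b])
       (simp add: nn_integral_density nn_integral_distr nn_integral_cmult)
  moreover have "ennreal (1 / \<bar>c\<bar> ^ 3) * ennreal (\<bar>c\<bar> ^ 3) = 1"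
    using \<open>c \<noteq> 0\<close> by (simp flip: ennreal_mult')
  ultimately show ?thesis
    by (simp add: add.commute flip: mult.assoc)
qed

lemma
  fixes f :: "R3 \<Rightarrow> 'a :: {banach, second_countable_topology}"
  assumes [measurable]: "f \<in> borel_measurable borel" and "c \<noteq> 0"
  shows integrable_lborel_affine_iff:
      "integrable lborel (\<lambda>x. f (c *\<^sub>R x + b)) \<longleftrightarrow> integrable lborel f"
    and integral_lborel_affine:
      "(LINT x|lborel. f (c *\<^sub>R x + b)) = (1 / \<bar>c\<bar> ^ 3) *\<^sub>R (LINT x|lborel. f x)"
proof -
  have scale: "integrable lborel (\<lambda>x. k *\<^sub>R g x) \<longleftrightarrow> integrable lborel g" if "k \<noteq> 0"
    for k and g :: "R3 \<Rightarrow> 'a"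
    using that integrable_scaleR_right[of "inverse k" lborel "\<lambda>x. k *\<^sub>R g x"] by auto
  have "integrable lborel f \<longleftrightarrow> integrable lborel (\<lambda>x. f (b + c *\<^sub>R x))"
    using \<open>c \<noteq> 0\<close>
    by (subst lborel_affine[OF \<open>c \<noteq> 0\<close>, of b])
       (simp add: integrable_density integrable_distr_eq scale)
  then show "integrable lborel (\<lambda>x. f (c *\<^sub>R x + b)) \<longleftrightarrow> integrable lborel f"
    by (simp add: add.commute)
  have "(LINT x|lborel. f x) = \<bar>c\<bar> ^ 3 *\<^sub>R (LINT x|lborel. f (b + c *\<^sub>R x))"
    by (subst lborel_affine[OF \<open>c \<noteq> 0\<close>, of b])
       (simp add: integral_density integral_distr)
  then show "(LINT x|lborel. f (c *\<^sub>R x + b)) = (1 / \<bar>c\<bar> ^ 3) *\<^sub>R (LINT x|lborel. f x)"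
    using \<open>c \<noteq> 0\<close> by (simp add: add.commute)
qed

subsection \<open>The fundamental lemma of the calculus of variations\<close>

text \<open>The positive and the negative part of \<open>f\<close> are densities of two measures
  that agree on open boxes. Boxes form an intersection-stable generator of the Borel sets and
  exhaust the space with finite measure, so the measures, and then their densities,
  coincide.\<close>

lemma AE_eq_0_if_box_integrals_0:
  fixes f :: "R3 \<Rightarrow> real"
  assumes [measurable]: "f \<in> borel_measurable borel"
    and int: "\<And>a b. integrable lborel (\<lambda>x. indicator (box a b) x * f x)"
    and zero: "\<And>a b. (LINT x|lborel. indicator (box a b) x * f x) = 0"
  shows "AE x in lborel. f x = 0"
proof -
  have box: "emeasure (density lborel (\<lambda>x. ennreal (g x))) (box a b) = ennreal (LINT x|lborel. indicator (box a b) x * g x)"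
    if [measurable]: "g \<in> borel_measurable borel" and "\<And>x. 0 \<le> g x" "\<And>x. g x \<le> \<bar>f x\<bar>" for g a b
  proof -
    have "integrable lborel (\<lambda>x. indicator (box a b) x * g x)"
      by (rule Bochner_Integration.integrable_bound[OF int[of a b]])
         (use that in \<open>auto simp: abs_mult split: split_indicator\<close>)
    then show ?thesis
      using that(2)
      by (subst nn_integral_eq_integral[symmetric])
         (auto simp: emeasure_density ennreal_mult'' mult.commute ennreal_indicator)
  qed
  define p where "p x = max 0 (f x)" for x
  define m where "m x = max 0 (- f x)" for x
  have [measurable]: "p \<in> borel_measurable borel" "m \<in> borel_measurable borel"
    unfolding p_def m_def by measurable
  have pm: "0 \<le> p x" "p x \<le> \<bar>f x\<bar>" "0 \<le> m x" "m x \<le> \<bar>f x\<bar>" "f x = p x - m x" for x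
    by (auto simp: p_def m_def)
  have int': "integrable lborel (\<lambda>x. indicator (box a b) x * p x)" "integrable lborel (\<lambda>x. indicator (box a b) x * m x)" for a b
    using pm by (auto intro!: Bochner_Integration.integrable_bound[OF int[of a b]] simp: abs_mult split: split_indicator)
  have eq: "(LINT x|lborel. indicator (box a b) x * p x) = (LINT x|lborel. indicator (box a b) x * m x)" for a b
    using zero[of a b] Bochner_Integration.integral_diff[OF int'[of a b]]
    by (simp add: pm(5) right_diff_distrib)
  have "density lborel (\<lambda>x. ennreal (p x)) = density lborel (\<lambda>x. ennreal (m x))"
  proof (rule measure_eqI_generator_eq)
    let ?E = "range (\<lambda>(a, b). box a b :: R3 set)"
    show "Int_stable ?E"
      by (auto simp: Int_stable_def box_Int_box)
    show "?E \<subseteq> Pow UNIV" "sets (density lborel (\<lambda>x. ennreal (p x))) = sigma_sets UNIV ?E"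
      "sets (density lborel (\<lambda>x. ennreal (m x))) = sigma_sets UNIV ?E"
      by (simp_all add: borel_eq_box)
    let ?A = "\<lambda>n::nat. box (- (real n *\<^sub>R One)) (real n *\<^sub>R One) :: R3 set"
    show "range ?A \<subseteq> ?E" "(\<Union>i. ?A i) = UNIV"
      unfolding UN_box_eq_UNIV by auto
    show "emeasure (density lborel (\<lambda>x. ennreal (p x))) (?A i) \<noteq> \<infinity>" for i
      by (simp add: box pm(1,2))
    show "emeasure (density lborel (\<lambda>x. ennreal (p x))) X = emeasure (density lborel (\<lambda>x. ennreal (m x))) X" if "X \<in> ?E" for X
      using that pm(1-4) by (auto simp: box eq)
  qed
  then have "AE x in lborel. ennreal (p x) = ennreal (m x)"
    by (intro sigma_finite_measure.density_unique[OF sigma_finite_lborel]) auto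
  then show ?thesis
    by eventually_elim (use pm in simp)
qed

text \<open>The functions \<open>box_bump n a b\<close> are bounded by 1, vanish off the box and
  converge to its indicator, so dominated convergence turns test integrals into box
  integrals.\<close>

lemma fundamental_lemma_real:
  fixes f :: "R3 \<Rightarrow> real"
  assumes [measurable]: "f \<in> borel_measurable borel"
    and int: "\<And>a b. integrable lborel (\<lambda>x. indicator (box a b) x * f x)"
    and zero: "\<And>\<phi>. test_function \<phi> \<Longrightarrow> (LINT x|lborel. f x * \<phi> x) = 0"
  shows "AE x in lborel. f x = 0"
proof (rule AE_eq_0_if_box_integrals_0)
  fix a b :: R3
  have [measurable]: "box_bump n a b \<in> borel_measurable borel" for n
    by (rule test_function_measurable[OF test_function_box_bump])
  have "(\<lambda>n. LINT x|lborel. f x * box_bump n a b x) \<longlonglongrightarrow> (LINT x|lborel. f x * indicator (box a b) x)"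
  proof (rule integral_dominated_convergence)
    show "integrable lborel (\<lambda>x. \<bar>indicator (box a b) x * f x\<bar>)"
      using int by (rule integrable_abs)
    show "AE x in lborel. (\<lambda>n. f x * box_bump n a b x) \<longlonglongrightarrow> f x * indicator (box a b) x"
      by (intro AE_I2 tendsto_intros box_bump_tendsto)
    have "norm (f x * box_bump n a b x) \<le> \<bar>indicator (box a b) x * f x\<bar>" for n x
    proof (cases "x \<in> box a b")
      case True
      then show ?thesis
        using mult_left_mono[OF box_bump_bounds(2)[of n a b x], of "\<bar>f x\<bar>"] box_bump_bounds(1)[of n a b x]
        by (simp add: abs_mult)
    qed (simp add: box_bump_eq_0)
    then show "AE x in lborel. norm (f x * box_bump n a b x) \<le> \<bar>indicator (box a b) x * f x\<bar>" for n
      by simp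
  qed measurable
  then show "(LINT x|lborel. indicator (box a b) x * f x) = 0"
    using zero[OF test_function_box_bump] by (simp add: LIMSEQ_const_iff mult.commute)
qed (use int in auto)

lemma fundamental_lemma:
  fixes f :: "R3 \<Rightarrow> complex"
  assumes [measurable]: "f \<in> borel_measurable borel"
    and int: "\<And>a b. integrable lborel (\<lambda>x. indicator (box a b) x *\<^sub>R f x)"
    and zero: "\<And>\<phi>. test_function \<phi> \<Longrightarrow> (LINT x|lborel. f x * of_real (\<phi> x)) = 0"
  shows "AE x in lborel. f x = 0"
proof -
  \<comment> \<open>Taking real parts inside the integral requires integrability of the products;
    they are dominated because \<open>\<phi>\<close> is bounded and supported in a box.\<close>
  have intp: "integrable lborel (\<lambda>x. f x * of_real (\<phi> x))" if phi: "test_function \<phi>" for \<phi>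
  proof -
    obtain R where R: "R > 0" "\<And>x. norm x > R \<Longrightarrow> \<phi> x = 0"
      using test_function_bounded_support[OF phi] by blast
    obtain B where B: "B > 0" "\<And>x. \<bar>\<phi> x\<bar> \<le> B"
      using test_function_bounded[OF phi] by blast
    note [measurable] = test_function_measurable[OF phi]
    obtain a where a: "cball 0 R \<subseteq> box (- a) (a :: R3)"
      using bounded_subset_box_symmetric bounded_cball by blast
    show ?thesis
    proof (rule Bochner_Integration.integrable_bound)
      show "integrable lborel (\<lambda>x. B *\<^sub>R (indicator (box (- a) a) x *\<^sub>R f x))"
        using int by (rule integrable_scaleR_right)
      have "cmod (f x * of_real (\<phi> x)) \<le> cmod (B *\<^sub>R (indicator (box (- a) a) x *\<^sub>R f x))" for x
      proof (cases "x \<in> box (- a) a")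
        case True
        then show ?thesis
          using B mult_right_mono[OF B(2)[of x], of "cmod (f x)"] by (simp add: norm_mult mult.commute)
      next
        case False
        then have "\<phi> x = 0"
          using a R(2)[of x] by (cases "norm x > R") (auto simp: subset_iff)
        then show ?thesis by simp
      qed
      then show "AE x in lborel. cmod (f x * of_real (\<phi> x)) \<le> cmod (B *\<^sub>R (indicator (box (- a) a) x *\<^sub>R f x))"
        by simp
    qed measurable
  qed
  have "AE x in lborel. Re (f x) = 0"
  proof (rule fundamental_lemma_real)
    show "integrable lborel (\<lambda>x. indicator (box a b) x * Re (f x))" for a b
      using integrable_Re[OF int[of a b]] by simp
    show "(LINT x|lborel. Re (f x) * \<phi> x) = 0" if "test_function \<phi>" for \<phi>
      using integral_Re[OF intp[OF that]] zero[OF that] by simp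
  qed measurable
  moreover have "AE x in lborel. Im (f x) = 0"
  proof (rule fundamental_lemma_real)
    show "integrable lborel (\<lambda>x. indicator (box a b) x * Im (f x))" for a b
      using integrable_Im[OF int[of a b]] by simp
    show "(LINT x|lborel. Im (f x) * \<phi> x) = 0" if "test_function \<phi>" for \<phi>
      using integral_Im[OF intp[OF that]] zero[OF that] by simp
  qed measurable
  ultimately show ?thesis
    by eventually_elim (simp add: complex_eq_iff)
qed

subsection \<open>Weak gradients\<close>

lemma in_Lp_measurable: "in_Lp q f \<Longrightarrow> f \<in> borel_measurable borel"
  by (simp add: in_Lp_def)

lemma in_Lp_2_iff: "in_Lp 2 f \<longleftrightarrow> f \<in> borel_measurable borel \<and> integrable lborel (\<lambda>x. (norm (f x))\<^sup>2)"
  by (simp add: in_Lp_def powr_numeral)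

text \<open>The ordinary distributional gradient. The potential is kept out of it because
  translations and dilations of \<open>u\<close> transform \<open>p\<close> alone, whereas in the
  magnetic gradient they would also move \<open>A\<close>.\<close>

definition has_weak_grad :: "(R3 \<Rightarrow> complex) \<Rightarrow> (R3 \<Rightarrow> complex ^ 3) \<Rightarrow> bool" where
  "has_weak_grad u p \<longleftrightarrow> (\<forall>\<phi> j. test_function \<phi> \<longrightarrow>
     (LINT x|lborel. u x * of_real (pderiv_at j \<phi> x)) = - (LINT x|lborel. p x $ j * of_real (\<phi> x)))"

lemma has_weak_gradD:
  "has_weak_grad u p \<Longrightarrow> test_function \<phi> \<Longrightarrow>
     (LINT x|lborel. u x * of_real (pderiv_at j \<phi> x)) = - (LINT x|lborel. p x $ j * of_real (\<phi> x))"
  by (simp add: has_weak_grad_def)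

lemma integrable_mult_of_squares:
  fixes f :: "'a \<Rightarrow> complex" and g :: "'a \<Rightarrow> real"
  assumes [measurable]: "f \<in> borel_measurable M" "g \<in> borel_measurable M"
    and "integrable M (\<lambda>x. (norm (f x))\<^sup>2)" "integrable M (\<lambda>x. (g x)\<^sup>2)"
  shows "integrable M (\<lambda>x. f x * of_real (g x))"
proof (rule Bochner_Integration.integrable_bound)
  show "integrable M (\<lambda>x. (norm (f x))\<^sup>2 + (g x)\<^sup>2)"
    using assms by simp
  have "norm (f x * of_real (g x)) \<le> (norm (f x))\<^sup>2 + (g x)\<^sup>2" for x
  proof -
    have "2 * (norm (f x) * \<bar>g x\<bar>) \<le> (norm (f x))\<^sup>2 + \<bar>g x\<bar>\<^sup>2"
      using sum_squares_bound[of "norm (f x)" "\<bar>g x\<bar>"] by simp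
    moreover have "0 \<le> norm (f x) * \<bar>g x\<bar>" by simp
    ultimately show ?thesis
      by (simp only: norm_mult norm_of_real power2_abs)
  qed
  then show "AE x in M. norm (f x * of_real (g x)) \<le> norm ((norm (f x))\<^sup>2 + (g x)\<^sup>2)"
    by (simp add: abs_of_nonneg)
qed measurable

lemma test_function_integrable_square:
  assumes "test_function \<phi>"
  shows "integrable lborel (\<lambda>x. (\<phi> x)\<^sup>2)"
proof -
  note [measurable] = test_function_measurable[OF assms]
  obtain R where R: "R > 0" "\<And>x. norm x > R \<Longrightarrow> \<phi> x = 0"
    using test_function_bounded_support[OF assms] by blast
  obtain B where B: "B > 0" "\<And>x. \<bar>\<phi> x\<bar> \<le> B"
    using test_function_bounded[OF assms] by blast
  show ?thesis
  proof (rule Bochner_Integration.integrable_bound)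
    show "integrable lborel (\<lambda>x. B\<^sup>2 * indicator (cball (0::R3) R) x :: real)"
      by (intro integrable_mult_right integrable_real_indicator) (use emeasure_lborel_cball_finite[of 0 R] in auto)
    have "norm ((\<phi> x)\<^sup>2) \<le> norm (B\<^sup>2 * indicator (cball 0 R) x)" for x
      using B R(2)[of x] power_mono[OF B(2)[of x], of 2] by (auto split: split_indicator)
    then show "AE x in lborel. norm ((\<phi> x)\<^sup>2) \<le> norm (B\<^sup>2 * indicator (cball 0 R) x)"
      by simp
  qed measurable
qed

text \<open>For fixed \<open>s\<close> the change of variables costs
  \<open>1 / (a s) ^ 3 \<le> 1 / k ^ 3\<close>, and \<open>s\<close> runs over an interval of length
  1. Such bounds supply the integrability on the product space that Fubini asks for.\<close>

lemma nn_integral_affine_family_le: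
  fixes f :: "R3 \<Rightarrow> ennreal" and a :: "real \<Rightarrow> real" and b :: "real \<Rightarrow> R3"
  assumes [measurable]: "f \<in> borel_measurable borel" "a \<in> borel_measurable borel" "b \<in> borel_measurable borel"
    and "k > 0" "\<And>s. 0 \<le> s \<Longrightarrow> s \<le> 1 \<Longrightarrow> k \<le> a s"
  shows "(\<integral>\<^sup>+s. (\<integral>\<^sup>+x. indicator {0..1} s * f (a s *\<^sub>R x + b s) \<partial>lborel) \<partial>lborel)
    \<le> ennreal (1 / k ^ 3) * (\<integral>\<^sup>+x. f x \<partial>lborel)"
proof -
  have "(\<integral>\<^sup>+x. indicator {0..1} s * f (a s *\<^sub>R x + b s) \<partial>lborel)
      \<le> indicator {0..1} s * (ennreal (1 / k ^ 3) * (\<integral>\<^sup>+x. f x \<partial>lborel))" for s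
  proof (cases "s \<in> {0..1}")
    case True
    then have "k \<le> a s" using assms by simp
    then have "(\<integral>\<^sup>+x. f (a s *\<^sub>R x + b s) \<partial>lborel) = ennreal (1 / (a s) ^ 3) * (\<integral>\<^sup>+x. f x \<partial>lborel)"
      using \<open>k > 0\<close> by (subst nn_integral_lborel_affine) auto
    also have "\<dots> \<le> ennreal (1 / k ^ 3) * (\<integral>\<^sup>+x. f x \<partial>lborel)"
      using \<open>k > 0\<close> \<open>k \<le> a s\<close>
      by (intro mult_right_mono ennreal_leI frac_le power_mono) auto
    finally show ?thesis using True by simp
  qed simp
  then have "(\<integral>\<^sup>+s. (\<integral>\<^sup>+x. indicator {0..1} s * f (a s *\<^sub>R x + b s) \<partial>lborel) \<partial>lborel)
    \<le> (\<integral>\<^sup>+s. indicator {0..1::real} s * (ennreal (1 / k ^ 3) * (\<integral>\<^sup>+x. f x \<partial>lborel)) \<partial>lborel)"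
    by (intro nn_integral_mono)
  then show ?thesis
    by (simp add: nn_integral_multc)
qed

lemma integrable_affine_family:
  fixes f :: "R3 \<Rightarrow> 'b :: {banach, second_countable_topology}" and a :: "real \<Rightarrow> real" and b :: "real \<Rightarrow> R3"
  assumes [measurable]: "f \<in> borel_measurable borel" "a \<in> borel_measurable borel" "b \<in> borel_measurable borel"
    and int: "integrable lborel (\<lambda>x. (norm (f x))\<^sup>2)"
    and "k > 0" "\<And>s. 0 \<le> s \<Longrightarrow> s \<le> 1 \<Longrightarrow> k \<le> a s"
  shows "integrable (lborel \<Otimes>\<^sub>M lborel) (\<lambda>(s, x). (norm (indicator {0..1} s *\<^sub>R f (a s *\<^sub>R x + b s)))\<^sup>2)"
proof (rule integrableI_bounded)
  have "(\<integral>\<^sup>+z. ennreal (norm (case z of (s, x) \<Rightarrow> (norm (indicator {0..1} s *\<^sub>R f (a s *\<^sub>R x + b s)))\<^sup>2)) \<partial>(lborel \<Otimes>\<^sub>M lborel))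
    = (\<integral>\<^sup>+s. (\<integral>\<^sup>+x. indicator {0..1} s * ennreal ((norm (f (a s *\<^sub>R x + b s)))\<^sup>2) \<partial>lborel) \<partial>lborel)"
    by (subst lborel.nn_integral_fst[symmetric])
       (auto intro!: nn_integral_cong split: split_indicator)
  also have "\<dots> \<le> ennreal (1 / k ^ 3) * (\<integral>\<^sup>+x. ennreal ((norm (f x))\<^sup>2) \<partial>lborel)"
    by (rule nn_integral_affine_family_le) (use assms in auto)
  also have "\<dots> < \<infinity>"
    using int by (simp add: integrable_iff_bounded ennreal_mult_less_top)
  finally show "(\<integral>\<^sup>+z. ennreal (norm (case z of (s, x) \<Rightarrow> (norm (indicator {0..1} s *\<^sub>R f (a s *\<^sub>R x + b s)))\<^sup>2)) \<partial>(lborel \<Otimes>\<^sub>M lborel)) < \<infinity>" .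
qed measurable

lemma integrable_indicator_01_square:
  fixes g :: "R3 \<Rightarrow> 'b :: {banach, second_countable_topology}"
  assumes [measurable]: "g \<in> borel_measurable borel" and "integrable lborel (\<lambda>x. (norm (g x))\<^sup>2)"
  shows "integrable (lborel \<Otimes>\<^sub>M lborel) (\<lambda>(s :: real, x). (norm (indicator {0..1} s *\<^sub>R g x))\<^sup>2)"
  using integrable_affine_family[of g "\<lambda>_. 1" "\<lambda>_. 0" 1] assms by simp

lemma Ck_pderiv_affine:
  assumes "Ck (Suc 0) f"
  shows "pderiv_at j (\<lambda>x. f (a *\<^sub>R x + b)) x = a * pderiv_at j f (a *\<^sub>R x + b :: R3)"
proof -
  have "((\<lambda>x. a *\<^sub>R x + b) has_derivative (\<lambda>v. a *\<^sub>R v)) (at x)"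
    by (auto intro!: derivative_eq_intros)
  then have "((\<lambda>x. f (a *\<^sub>R x + b)) has_derivative
      (\<lambda>v. \<Sum>j\<in>UNIV. (a *\<^sub>R v) $ j * pderiv_at j f (a *\<^sub>R x + b))) (at x)"
    by (rule has_derivative_compose[OF _ Ck_SucD_has_derivative[OF assms]])
  from pderiv_at_eq[OF this] show ?thesis
    by (simp add: sum_axis_mult mult.assoc flip: sum_distrib_left)
qed

lemma pderiv_at_nth_affine_mult:
  assumes "Ck (Suc 0) f"
  shows "pderiv_at j (\<lambda>x. (a * x $ j + b) * f x) x = a * f x + (a * x $ j + b) * pderiv_at j f x"
proof -
  have "((\<lambda>x :: R3. a * x $ j + b) has_derivative (\<lambda>v. a * v $ j)) (at x)"
    by (intro has_derivative_add[OF _ has_derivative_const, simplified] has_derivative_mult_right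
        bounded_linear_imp_has_derivative bounded_linear_vec_nth)
  from pderiv_at_eq[OF has_derivative_mult[OF this Ck_SucD_has_derivative[OF assms]]]
  show ?thesis
    by (simp add: sum_axis_mult)
qed

lemma borel_measurable_nth [measurable (raw)]:
  fixes f :: "'a \<Rightarrow> 'b :: real_normed_vector ^ 'n"
  assumes "f \<in> borel_measurable M"
  shows "(\<lambda>x. f x $ j) \<in> borel_measurable M"
  by (rule measurable_compose[OF assms borel_measurable_continuous_onI])
     (intro continuous_intros)

lemma in_Lp_2_nth:
  fixes p :: "R3 \<Rightarrow> 'b :: {banach, second_countable_topology} ^ 3"
  assumes "in_Lp 2 p"
  shows "integrable lborel (\<lambda>x. (norm (p x $ j))\<^sup>2)"
proof (rule Bochner_Integration.integrable_bound)
  have [measurable]: "p \<in> borel_measurable borel" using assms by (rule in_Lp_measurable)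
  show "integrable lborel (\<lambda>x. (norm (p x))\<^sup>2)"
    using assms by (simp add: in_Lp_2_iff)
  show "AE x in lborel. norm ((norm (p x $ j))\<^sup>2) \<le> norm ((norm (p x))\<^sup>2)"
    by (auto intro!: power_mono Finite_Cartesian_Product.norm_nth_le)
  show "(\<lambda>x. (norm (p x $ j))\<^sup>2) \<in> borel_measurable lborel"
    by measurable
qed

lemma test_function_sum:
  assumes "finite I" "\<And>i. i \<in> I \<Longrightarrow> test_function (f i)"
  shows "test_function (\<lambda>x. \<Sum>i\<in>I. f i x)"
  using assms
proof (induction I rule: finite_induct)
  case empty
  show ?case
    by (rule test_functionI) (simp_all add: Ck_const)
next
  case (insert i I)
  have 1: "test_function (f i)" "test_function (\<lambda>x. \<Sum>i\<in>I. f i x)"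
    using insert by simp_all
  have "Ck k (\<lambda>x. f i x + (\<Sum>i\<in>I. f i x))" for k
    using 1 by (intro Ck_add test_function_Ck)
  moreover have "bounded ({x. f i x \<noteq> 0} \<union> {x. (\<Sum>i\<in>I. f i x) \<noteq> 0})"
    using 1 unfolding test_function_iff by (simp add: bounded_Un)
  then have "bounded {x. f i x + (\<Sum>i\<in>I. f i x) \<noteq> 0}"
    by (rule bounded_subset) auto
  ultimately have "test_function (\<lambda>x. f i x + (\<Sum>i\<in>I. f i x))"
    by (rule test_functionI)
  then show ?case
    using insert.hyps by simp
qed

lemma test_function_integrable_affine_square:
  assumes "test_function \<phi>" "a \<noteq> 0"
  shows "integrable lborel (\<lambda>x. (\<phi> (a *\<^sub>R x + b))\<^sup>2)"
  by (rule test_function_integrable_square[OF test_function_affine[OF assms]])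

text \<open>This is a continuity equation: \<open>T s\<close> inverts
  \<open>x \<mapsto> x + s (\<beta> x + h)\<close>, the cubic factor is the inverse Jacobian, and
  \<open>T\<close> moves with velocity \<open>- (\<beta> T + h) / (1 + s \<beta>)\<close>.
  Differentiating the cubic factor produces \<open>3 \<beta> \<phi>\<close>, where
  \<open>3 \<beta>\<close> is the divergence of the field, so the two terms combine into the
  divergence of the field times \<open>\<phi>\<close>.\<close>

lemma has_real_derivative_scaled_test_function:
  fixes y h :: R3
  assumes \<phi>: "test_function \<phi>" and pos: "1 + s * \<beta> > 0"
  defines "T \<equiv> \<lambda>s. (1 / (1 + s * \<beta>)) *\<^sub>R y + (- (s / (1 + s * \<beta>))) *\<^sub>R h"
  shows "((\<lambda>s. 1 / (1 + s * \<beta>) ^ 3 * \<phi> (T s)) has_real_derivative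
     - (1 / (1 + s * \<beta>) ^ 4) * (\<Sum>j\<in>UNIV. pderiv_at j (\<lambda>x. (\<beta> * x $ j + h $ j) * \<phi> x) (T s))) (at s)"
proof -
  let ?D = "1 + s * \<beta>"
  have sc: "((\<lambda>s. 1 / (1 + s * \<beta>)) has_real_derivative - \<beta> / ?D\<^sup>2) (at s)"
    using pos by (auto intro!: derivative_eq_intros simp: power2_eq_square)
  have sd: "((\<lambda>s. - (s / (1 + s * \<beta>))) has_real_derivative - 1 / ?D\<^sup>2) (at s)"
    using pos by (auto intro!: derivative_eq_intros simp: power2_eq_square field_simps)
  have T: "(T has_vector_derivative ((- \<beta> / ?D\<^sup>2) *\<^sub>R y + (- 1 / ?D\<^sup>2) *\<^sub>R h)) (at s)"
    unfolding T_def
    by (rule derivative_eq_intros sc[unfolded has_real_derivative_iff_has_vector_derivative]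
         sd[unfolded has_real_derivative_iff_has_vector_derivative] sc sd refl)+ simp
  have X: "(- \<beta> / ?D\<^sup>2) *\<^sub>R y + (- 1 / ?D\<^sup>2) *\<^sub>R h = (- 1 / ?D) *\<^sub>R (\<beta> *\<^sub>R T s + h)"
  proof -
    have c: "1 - \<beta> * (s / ?D) = 1 / ?D"
      using pos by (simp add: field_simps)
    have "(- 1 / ?D) *\<^sub>R (\<beta> *\<^sub>R T s + h) = (- (1 / ?D) * \<beta> * (1 / ?D)) *\<^sub>R y + (- (1 / ?D) * (1 - \<beta> * (s / ?D))) *\<^sub>R h"
      by (simp add: T_def scaleR_add_right scaleR_diff_left scaleR_diff_right right_diff_distrib scaleR_minus_left)
    then show ?thesis
      unfolding c by (simp add: power2_eq_square)
  qed
  have "((\<lambda>s. \<phi> (T s)) has_vector_derivative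
      (\<Sum>j\<in>UNIV. ((- 1 / ?D) *\<^sub>R (\<beta> *\<^sub>R T s + h)) $ j * pderiv_at j \<phi> (T s))) (at s)"
    using vector_derivative_diff_chain_within[OF T[unfolded X], of \<phi>
        "\<lambda>v. \<Sum>j\<in>UNIV. v $ j * pderiv_at j \<phi> (T s)"]
      Ck_SucD_has_derivative[OF test_function_Ck[OF \<phi>], of "T s"]
    by (simp add: o_def has_derivative_at_withinI)
  then have "((\<lambda>s. \<phi> (T s)) has_real_derivative
      (\<Sum>j\<in>UNIV. ((- 1 / ?D) *\<^sub>R (\<beta> *\<^sub>R T s + h)) $ j * pderiv_at j \<phi> (T s))) (at s)"
    by (simp add: has_real_derivative_iff_has_vector_derivative)
  moreover have "(\<Sum>j\<in>UNIV. ((- 1 / ?D) *\<^sub>R (\<beta> *\<^sub>R T s + h)) $ j * pderiv_at j \<phi> (T s))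
      = - (1 / ?D) * (\<Sum>j\<in>UNIV. (\<beta> * T s $ j + h $ j) * pderiv_at j \<phi> (T s))"
    by (simp add: sum_distrib_left algebra_simps sum_negf)
  ultimately have d\<phi>: "((\<lambda>s. \<phi> (T s)) has_real_derivative
      - (1 / ?D) * (\<Sum>j\<in>UNIV. (\<beta> * T s $ j + h $ j) * pderiv_at j \<phi> (T s))) (at s)"
    by simp
  have d3: "((\<lambda>s. 1 / (1 + s * \<beta>) ^ 3) has_real_derivative - 3 * \<beta> / ?D ^ 4) (at s)"
    using DERIV_power[OF sc, of 3]
    by (rule back_subst) (simp add: power_one_over power2_eq_square power4_eq_xxxx mult.assoc)
  have Q: "(\<Sum>j\<in>UNIV. pderiv_at j (\<lambda>x. (\<beta> * x $ j + h $ j) * \<phi> x) (T s))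
      = 3 * \<beta> * \<phi> (T s) + (\<Sum>j\<in>UNIV. (\<beta> * T s $ j + h $ j) * pderiv_at j \<phi> (T s))"
    by (simp add: pderiv_at_nth_affine_mult[OF test_function_Ck[OF \<phi>]] sum.distrib)
  have alg: "- 3 * \<beta> / d ^ 4 * a + - (1 / d) * S * (1 / d ^ 3) = - (1 / d ^ 4) * (3 * \<beta> * a + S)" for d a S
    by (simp add: power3_eq_cube power4_eq_xxxx add_divide_distrib distrib_left mult.assoc)
  show ?thesis
    unfolding Q by (rule DERIV_cong[OF DERIV_mult[OF d3 d\<phi>] alg])
qed

text \<open>The maps \<open>x \<mapsto> x + s (\<beta> x + h)\<close> are translations for \<open>\<beta> = 0\<close> and dilations for \<open>h = 0\<close>. The
  formula is proved by duality: transported to the test function it is the fundamental theorem of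
  calculus for \<open>s \<mapsto> (1 + s \<beta>)\<^sup>-\<^sup>3 \<phi>((y - s h) / (1 + s \<beta>))\<close>, whose derivative is a divergence.\<close>

lemma weak_grad_ftc:
  fixes u :: "R3 \<Rightarrow> complex" and p :: "R3 \<Rightarrow> complex ^ 3"
  assumes u: "in_Lp 2 u" and p: "in_Lp 2 p" and grad: "has_weak_grad u p" and \<beta>: "\<beta> \<ge> 0"
  shows "AE x in lborel. u (x + (\<beta> *\<^sub>R x + h)) - u x =
    (LINT s|lborel. indicator {0..1} s *\<^sub>R
       (\<Sum>j\<in>UNIV. p (x + s *\<^sub>R (\<beta> *\<^sub>R x + h)) $ j * of_real ((\<beta> *\<^sub>R x + h) $ j)))"
proof -
  have [measurable]: "u \<in> borel_measurable borel" "p \<in> borel_measurable borel"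
    using u p by (auto intro: in_Lp_measurable)
  define X where "X x = \<beta> *\<^sub>R x + h" for x :: R3
  define G where "G s x = indicator {0..1} s *\<^sub>R
       (\<Sum>j\<in>UNIV. p (x + s *\<^sub>R X x) $ j * of_real (X x $ j))" for s :: real and x
  have [measurable]: "X \<in> borel_measurable borel"
    unfolding X_def by measurable
  have flow: "x + s *\<^sub>R X x = (1 + s * \<beta>) *\<^sub>R x + s *\<^sub>R h" for s x
    by (simp add: X_def algebra_simps)
  have D: "1 \<le> 1 + s * \<beta>" if "0 \<le> s" for s
    using \<beta> that by simp
  \<comment> \<open>Preparation for Fubini: \<open>p\<close> along the flow and the field times
    \<open>\<zeta>\<close>, both cut off to \<open>s\<close> in [0,1], are square integrable on the
    product space. Below, \<open>\<zeta>\<close> is a box indicator and then a test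
    function.\<close>
  have intG: "integrable (lborel \<Otimes>\<^sub>M lborel) (\<lambda>(s, x). G s x * of_real (\<zeta> x))"
    if [measurable]: "\<zeta> \<in> borel_measurable borel" and int: "\<And>j. integrable lborel (\<lambda>x. (X x $ j * \<zeta> x)\<^sup>2)" for \<zeta>
  proof -
    have "integrable (lborel \<Otimes>\<^sub>M lborel) (\<lambda>z. (case z of (s, x) \<Rightarrow> indicator {0..1} s *\<^sub>R p ((1 + s * \<beta>) *\<^sub>R x + s *\<^sub>R h) $ j)
        * of_real (case z of (s, x) \<Rightarrow> indicator {0..1} (s::real) *\<^sub>R (X x $ j * \<zeta> x)))" for j
    proof (rule integrable_mult_of_squares)
      show "integrable (lborel \<Otimes>\<^sub>M lborel) (\<lambda>z. (norm (case z of (s, x) \<Rightarrow> indicator {0..1} s *\<^sub>R p ((1 + s * \<beta>) *\<^sub>R x + s *\<^sub>R h) $ j))\<^sup>2)"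
        using integrable_affine_family[of "\<lambda>x. p x $ j" "\<lambda>s. 1 + s * \<beta>" "\<lambda>s. s *\<^sub>R h" 1] D in_Lp_2_nth[OF p]
        by (simp add: case_prod_unfold)
      show "integrable (lborel \<Otimes>\<^sub>M lborel) (\<lambda>z. (case z of (s, x) \<Rightarrow> indicator {0..1} (s::real) *\<^sub>R (X x $ j * \<zeta> x))\<^sup>2)"
        using integrable_indicator_01_square[of "\<lambda>x. X x $ j * \<zeta> x"] int
        by (simp add: case_prod_unfold)
    qed measurable
    then have "integrable (lborel \<Otimes>\<^sub>M lborel) (\<lambda>z. \<Sum>j\<in>UNIV. (case z of (s, x) \<Rightarrow> indicator {0..1} s *\<^sub>R p ((1 + s * \<beta>) *\<^sub>R x + s *\<^sub>R h) $ j)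
        * of_real (case z of (s, x) \<Rightarrow> indicator {0..1} (s::real) *\<^sub>R (X x $ j * \<zeta> x)))"
      by (intro Bochner_Integration.integrable_sum)
    moreover have "(\<lambda>z. \<Sum>j\<in>UNIV. (case z of (s, x) \<Rightarrow> indicator {0..1} s *\<^sub>R p ((1 + s * \<beta>) *\<^sub>R x + s *\<^sub>R h) $ j)
        * of_real (case z of (s, x) \<Rightarrow> indicator {0..1} (s::real) *\<^sub>R (X x $ j * \<zeta> x)))
      = (\<lambda>(s, x). G s x * of_real (\<zeta> x))"
      by (auto simp: fun_eq_iff G_def flow sum_distrib_right mult.assoc split: split_indicator)
    ultimately show ?thesis
      by simp
  qed
  have X_Ck: "Ck k (\<lambda>x. X x $ j)" for k j
    using Ck_nth_affine[of k \<beta> j "h $ j"] by (simp add: X_def)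
  have X_test: "test_function (\<lambda>x. X x $ j * \<phi> x)" if "test_function \<phi>" for \<phi> j
    by (rule test_function_mult_left[OF X_Ck that])
  define F where "F x = (LINT s|lborel. G s x)" for x
  have [measurable]: "F \<in> borel_measurable borel"
    unfolding F_def G_def by measurable
  have "AE x in lborel. u (x + X x) - u x - F x = 0"
  proof (rule fundamental_lemma)
    show "integrable lborel (\<lambda>x. indicator (box a b) x *\<^sub>R (u (x + X x) - u x - F x))" for a b
    proof -
      have sq: "integrable lborel (\<lambda>x. (indicator (box a b) x :: real)\<^sup>2)"
      proof -
        have "(\<lambda>x. (indicator (box a b) x :: real)\<^sup>2) = indicator (box a b)"
          by (auto simp: fun_eq_iff split: split_indicator)
        then show ?thesis
          using emeasure_lborel_box_finite[of a b] by simp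
      qed
      have L2: "integrable lborel (\<lambda>x. indicator (box a b) x *\<^sub>R f x)"
        if [measurable]: "f \<in> borel_measurable borel" and "integrable lborel (\<lambda>x. (norm (f x))\<^sup>2)" for f :: "R3 \<Rightarrow> complex"
        using integrable_mult_of_squares[of f lborel "indicator (box a b)"] that sq
        by (simp add: scaleR_conv_of_real mult.commute)
      have uX: "x + X x = (1 + \<beta>) *\<^sub>R x + h" for x
        using flow[of x 1] by simp
      have "integrable lborel (\<lambda>x. (norm (u (x + X x)))\<^sup>2)"
        unfolding uX using u \<beta>
        by (subst integrable_lborel_affine_iff[where f = "\<lambda>x. (norm (u x))\<^sup>2"]) (auto simp: in_Lp_2_iff)
      then have 1: "integrable lborel (\<lambda>x. indicator (box a b) x *\<^sub>R u (x + X x))"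
        by (intro L2) measurable
      have 2: "integrable lborel (\<lambda>x. indicator (box a b) x *\<^sub>R u x)"
        using u by (intro L2) (auto simp: in_Lp_2_iff)
      obtain R where R: "\<And>x. x \<in> box a b \<Longrightarrow> norm x \<le> R"
        using bounded_box[of a b] unfolding bounded_iff by blast
      have "\<bar>X x $ j * indicator (box a b) x\<bar> \<le> (\<beta> * R + norm h) * indicator (box a b) x" for x j
      proof (cases "x \<in> box a b")
        case True
        have "\<bar>X x $ j\<bar> \<le> norm (X x)" by (rule component_le_norm_cart)
        also have "\<dots> \<le> \<beta> * norm x + norm h"
          unfolding X_def using norm_triangle_ineq[of "\<beta> *\<^sub>R x" h] \<beta> by simp
        also have "\<dots> \<le> \<beta> * R + norm h"
          using R[OF True] \<beta> by (simp add: mult_left_mono)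
        finally show ?thesis using True by simp
      qed simp
      then have bd: "(X x $ j * indicator (box a b) x)\<^sup>2 \<le> (\<beta> * R + norm h)\<^sup>2 * (indicator (box a b) x)\<^sup>2" for x j
        using power_mono[of "\<bar>X x $ j * indicator (box a b) x\<bar>" "(\<beta> * R + norm h) * indicator (box a b) x" 2]
        by (simp add: power_mult_distrib)
      have "integrable lborel (\<lambda>x. (X x $ j * indicator (box a b) x)\<^sup>2)" for j
        by (rule Bochner_Integration.integrable_bound[OF integrable_mult_right[OF sq, of "(\<beta> * R + norm h)\<^sup>2"]])
           (use bd[of _ j] in \<open>auto simp del: power_mult_distrib\<close>)
      then have "integrable lborel (\<lambda>x. LINT s|lborel. G s x * of_real (indicator (box a b) x))"
        by (intro lborel_pair.integrable_snd intG) auto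
      then have 3: "integrable lborel (\<lambda>x. indicator (box a b) x *\<^sub>R F x)"
        by (simp add: F_def scaleR_conv_of_real mult.commute)
      show ?thesis
        using Bochner_Integration.integrable_diff[OF Bochner_Integration.integrable_diff[OF 1 2] 3]
        by (simp add: scaleR_diff_right)
    qed
    show "(LINT x|lborel. (u (x + X x) - u x - F x) * of_real (\<phi> x)) = 0" if \<phi>: "test_function \<phi>" for \<phi>
    proof -
      note [measurable] = test_function_measurable[OF \<phi>] test_function_measurable[OF X_test[OF \<phi>]]
        test_function_measurable[OF test_function_pderiv[OF X_test[OF \<phi>]]]
      define T where "T s y = (1 / (1 + s * \<beta>)) *\<^sub>R y + (- (s / (1 + s * \<beta>))) *\<^sub>R h" for s and y :: R3
      have T_meas: "T s \<in> borel_measurable borel" for s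
        unfolding T_def[abs_def] by measurable
      have T_flow: "T s ((1 + s * \<beta>) *\<^sub>R x + s *\<^sub>R h) = x" if "0 \<le> s" for s x
        using D[OF that] by (simp add: T_def scaleR_add_right)
      define Q where "Q y = (\<Sum>j\<in>UNIV. pderiv_at j (\<lambda>x. X x $ j * \<phi> x) y)" for y
      have uL2: "integrable lborel (\<lambda>x. (norm (u x))\<^sup>2)" and pL2: "integrable lborel (\<lambda>x. (norm (p x $ j))\<^sup>2)" for j
        using u in_Lp_2_nth[OF p] by (auto simp: in_Lp_2_iff)
      have Q_meas [measurable]: "Q \<in> borel_measurable borel"
        unfolding Q_def by measurable
      have pd_int: "integrable lborel (\<lambda>y. u y * of_real (pderiv_at j (\<lambda>x. X x $ j * \<phi> x) (T s y)))" if "0 \<le> s" for s j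
        unfolding T_def using D[OF that] uL2
          test_function_integrable_affine_square[OF test_function_pderiv[OF X_test[OF \<phi>]], of "1 / (1 + s * \<beta>)" _ _ "(- (s / (1 + s * \<beta>))) *\<^sub>R h"]
        by (intro integrable_mult_of_squares) auto
      \<comment> \<open>For each \<open>s\<close> the flow is undone by \<open>T s\<close>, so that
        \<open>p\<close> stands at \<open>y\<close> and can be traded for a derivative of the
        transported test function. The Jacobian and the inner derivative of \<open>T s\<close>
        together give the fourth power.\<close>
      have slice: "(LINT x|lborel. G s x * of_real (\<phi> x))
          = indicator {0..1} s *\<^sub>R (- (1 / (1 + s * \<beta>) ^ 4) *\<^sub>R (LINT y|lborel. u y * of_real (Q (T s y))))" for s
      proof (cases "s \<in> {0..1}")
        case True
        then have s: "0 \<le> s" and Ds: "1 + s * \<beta> > 0" using D[of s] by auto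
        have comp: "(LINT x|lborel. p (x + s *\<^sub>R X x) $ j * of_real (X x $ j * \<phi> x))
            = - (1 / (1 + s * \<beta>) ^ 4) *\<^sub>R (LINT y|lborel. u y * of_real (pderiv_at j (\<lambda>x. X x $ j * \<phi> x) (T s y)))" for j
        proof -
          have test: "test_function (\<lambda>y. X (T s y) $ j * \<phi> (T s y))"
            unfolding T_def using Ds by (intro test_function_affine[OF X_test[OF \<phi>]]) simp
          have pd: "pderiv_at j (\<lambda>y. X (T s y) $ j * \<phi> (T s y)) y
              = (1 / (1 + s * \<beta>)) * pderiv_at j (\<lambda>x. X x $ j * \<phi> x) (T s y)" for y
            unfolding T_def by (rule Ck_pderiv_affine[OF test_function_Ck[OF X_test[OF \<phi>]]])
          note [measurable] = test_function_measurable[OF test] T_meas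
          have "(LINT x|lborel. p (x + s *\<^sub>R X x) $ j * of_real (X x $ j * \<phi> x))
            = (LINT x|lborel. (\<lambda>y. p y $ j * of_real (X (T s y) $ j * \<phi> (T s y))) ((1 + s * \<beta>) *\<^sub>R x + s *\<^sub>R h))"
            by (simp add: flow T_flow s)
          also have "\<dots> = (1 / (1 + s * \<beta>) ^ 3) *\<^sub>R (LINT y|lborel. p y $ j * of_real (X (T s y) $ j * \<phi> (T s y)))"
            using Ds by (subst integral_lborel_affine) auto
          also have "(LINT y|lborel. p y $ j * of_real (X (T s y) $ j * \<phi> (T s y)))
              = - (LINT y|lborel. u y * of_real ((1 / (1 + s * \<beta>)) * pderiv_at j (\<lambda>x. X x $ j * \<phi> x) (T s y)))"
            using has_weak_gradD[OF grad test, of j] unfolding pd by simp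
          also have "\<dots> = - (1 / (1 + s * \<beta>)) *\<^sub>R (LINT y|lborel. u y * of_real (pderiv_at j (\<lambda>x. X x $ j * \<phi> x) (T s y)))"
            by (simp add: scaleR_conv_of_real mult.left_commute flip: integral_mult_right_zero)
          finally show ?thesis
            by (simp add: power4_eq_xxxx power3_eq_cube)
        qed
        have int: "integrable lborel (\<lambda>x. p (x + s *\<^sub>R X x) $ j * of_real (X x $ j * \<phi> x))" for j
        proof (rule integrable_mult_of_squares)
          show "integrable lborel (\<lambda>x. (norm (p (x + s *\<^sub>R X x) $ j))\<^sup>2)"
            unfolding flow using Ds pL2
            by (subst integrable_lborel_affine_iff[where f = "\<lambda>x. (norm (p x $ j))\<^sup>2"]) auto
        qed (auto intro: test_function_integrable_square[OF X_test[OF \<phi>]])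
        have "(LINT x|lborel. G s x * of_real (\<phi> x))
          = (LINT x|lborel. (\<Sum>j\<in>UNIV. p (x + s *\<^sub>R X x) $ j * of_real (X x $ j * \<phi> x)))"
          using True by (simp add: G_def sum_distrib_right mult.assoc)
        also have "\<dots> = (\<Sum>j\<in>UNIV. (LINT x|lborel. p (x + s *\<^sub>R X x) $ j * of_real (X x $ j * \<phi> x)))"
          by (rule Bochner_Integration.integral_sum[OF int])
        also have "\<dots> = - (1 / (1 + s * \<beta>) ^ 4) *\<^sub>R (\<Sum>j\<in>UNIV. (LINT y|lborel. u y * of_real (pderiv_at j (\<lambda>x. X x $ j * \<phi> x) (T s y))))"
          unfolding comp by (simp only: scaleR_sum_right)
        also have "\<dots> = - (1 / (1 + s * \<beta>) ^ 4) *\<^sub>R (LINT y|lborel. (\<Sum>j\<in>UNIV. u y * of_real (pderiv_at j (\<lambda>x. X x $ j * \<phi> x) (T s y))))"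
          by (subst Bochner_Integration.integral_sum[OF pd_int[OF s]]) simp
        also have "(\<lambda>y. \<Sum>j\<in>UNIV. u y * of_real (pderiv_at j (\<lambda>x. X x $ j * \<phi> x) (T s y))) = (\<lambda>y. u y * of_real (Q (T s y)))"
          by (simp add: Q_def sum_distrib_left)
        finally show ?thesis
          using True by simp
      qed (simp add: G_def)
      define r where "r s y = - (1 / (1 + s * \<beta>) ^ 4) * Q (T s y)" for s y
      have testQ: "test_function Q"
        unfolding Q_def by (intro test_function_sum test_function_pderiv X_test \<phi> finite)
      then have contQ: "continuous_on UNIV Q"
        by (rule test_function_continuous_on)
      \<comment> \<open>\<open>r s y\<close> is the derivative from the continuity equation, so its
        integral over \<open>s\<close> reduces to the end points, and \<open>T 0\<close> is the
        identity.\<close>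
      have ftc: "(LINT s|lborel. indicator {0..1} s *\<^sub>R r s y) = 1 / (1 + \<beta>) ^ 3 * \<phi> (T 1 y) - \<phi> y" for y
      proof -
        have "(LINT s|lborel. indicator {0..1} s *\<^sub>R r s y) = 1 / (1 + 1 * \<beta>) ^ 3 * \<phi> (T 1 y) - 1 / (1 + 0 * \<beta>) ^ 3 * \<phi> (T 0 y)"
        proof (rule integral_FTC_atLeastAtMost)
          show "((\<lambda>s. 1 / (1 + s * \<beta>) ^ 3 * \<phi> (T s y)) has_vector_derivative r s y) (at s within {0..1})"
            if "0 \<le> s" "s \<le> 1" for s
          proof -
            have "1 + s * \<beta> > 0" using D[OF that(1)] by simp
            from has_real_derivative_scaled_test_function[OF \<phi> this, of y h]
            show ?thesis
              unfolding r_def Q_def T_def X_def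
              by (simp add: has_real_derivative_iff_has_vector_derivative has_vector_derivative_at_within)
          qed
          show "continuous_on {0..1} (\<lambda>s. r s y)"
            unfolding r_def T_def using \<beta>
            by (intro continuous_intros continuous_on_compose2[OF contQ])
               (auto intro!: continuous_intros simp: add_nonneg_eq_0_iff)
        qed simp
        then show ?thesis by (simp add: T_def)
      qed
      \<comment> \<open>Fubini for the way back, with \<open>u\<close> at rest and \<open>Q\<close>
        transported; the prefactor in \<open>r\<close> is at most 1, so \<open>|r|\<close> is
        bounded by the transported \<open>|Q|\<close>.\<close>
      have intr: "integrable (lborel \<Otimes>\<^sub>M lborel) (\<lambda>(s, y). u y * of_real (indicator {0..1} s *\<^sub>R r s y))"
      proof (rule Bochner_Integration.integrable_bound)
        show "integrable (lborel \<Otimes>\<^sub>M lborel) (\<lambda>z. (case z of (s, y) \<Rightarrow> indicator {0..1} (s::real) *\<^sub>R u y)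
          * of_real (case z of (s, y) \<Rightarrow> indicator {0..1} s *\<^sub>R Q (T s y)))"
        proof (rule integrable_mult_of_squares)
          show "integrable (lborel \<Otimes>\<^sub>M lborel) (\<lambda>z. (norm (case z of (s, y) \<Rightarrow> indicator {0..1} (s::real) *\<^sub>R u y))\<^sup>2)"
            using integrable_indicator_01_square[of u] uL2 by (simp add: case_prod_unfold)
          have "1 / (1 + \<beta>) \<le> 1 / (1 + s * \<beta>)" if "0 \<le> s" "s \<le> 1" for s
            using mult_right_mono[OF that(2) \<beta>] D[OF that(1)]
            by (intro frac_le) linarith+
          then show "integrable (lborel \<Otimes>\<^sub>M lborel) (\<lambda>z. (case z of (s, y) \<Rightarrow> indicator {0..1} s *\<^sub>R Q (T s y))\<^sup>2)"
            using integrable_affine_family[of Q "\<lambda>s. 1 / (1 + s * \<beta>)" "\<lambda>s. (- (s / (1 + s * \<beta>))) *\<^sub>R h" "1 / (1 + \<beta>)"]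
              test_function_integrable_square[OF testQ] \<beta>
            by (simp add: case_prod_unfold T_def)
        qed (simp_all add: T_def)
        show "(\<lambda>(s, y). u y * of_real (indicator {0..1} s *\<^sub>R r s y)) \<in> borel_measurable (lborel \<Otimes>\<^sub>M lborel)"
          unfolding r_def T_def by measurable
        have "\<bar>r s y\<bar> \<le> \<bar>Q (T s y)\<bar>" if "0 \<le> s" for s y
        proof -
          have "1 / (1 + s * \<beta>) ^ 4 \<le> 1"
            using D[OF that] by (simp add: divide_le_eq_1)
          then show ?thesis
            using D[OF that] mult_right_mono[of "1 / (1 + s * \<beta>) ^ 4" 1 "\<bar>Q (T s y)\<bar>"]
            by (simp add: r_def abs_mult)
        qed
        then show "AE z in lborel \<Otimes>\<^sub>M lborel. norm (case z of (s, y) \<Rightarrow> u y * of_real (indicator {0..1} s *\<^sub>R r s y))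
          \<le> norm ((case z of (s, y) \<Rightarrow> indicator {0..1} (s::real) *\<^sub>R u y)
          * complex_of_real (case z of (s, y) \<Rightarrow> indicator {0..1} s *\<^sub>R Q (T s y)))"
          by (intro AE_I2) (auto simp: norm_mult mult_left_mono split: split_indicator)
      qed
      have uX: "x + X x = (1 + \<beta>) *\<^sub>R x + h" for x
        using flow[of x 1] by simp
      have T1: "test_function (\<lambda>y. \<phi> (T 1 y))"
        unfolding T_def using \<beta> by (intro test_function_affine \<phi>) simp
      note [measurable] = test_function_measurable[OF T1]
      have 1: "(LINT x|lborel. u (x + X x) * of_real (\<phi> x)) = (LINT y|lborel. u y * of_real (1 / (1 + \<beta>) ^ 3 * \<phi> (T 1 y)))"
      proof -
        have "(LINT x|lborel. u (x + X x) * of_real (\<phi> x))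
          = (LINT x|lborel. (\<lambda>y. u y * of_real (\<phi> (T 1 y))) ((1 + \<beta>) *\<^sub>R x + h))"
          using T_flow[of 1] by (simp add: uX)
        also have "\<dots> = (1 / (1 + \<beta>) ^ 3) *\<^sub>R (LINT y|lborel. u y * of_real (\<phi> (T 1 y)))"
          using \<beta> by (subst integral_lborel_affine) auto
        also have "\<dots> = (LINT y|lborel. u y * of_real (1 / (1 + \<beta>) ^ 3 * \<phi> (T 1 y)))"
          by (simp add: scaleR_conv_of_real mult.left_commute flip: integral_mult_right_zero)
        finally show ?thesis .
      qed
      have iu: "integrable lborel (\<lambda>x. u x * of_real (\<phi> x))"
        using uL2 test_function_integrable_square[OF \<phi>] by (intro integrable_mult_of_squares) auto
      have iuX: "integrable lborel (\<lambda>x. u (x + X x) * of_real (\<phi> x))"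
      proof (rule integrable_mult_of_squares)
        show "integrable lborel (\<lambda>x. (norm (u (x + X x)))\<^sup>2)"
          unfolding uX using uL2 \<beta>
          by (subst integrable_lborel_affine_iff[where f = "\<lambda>x. (norm (u x))\<^sup>2"]) auto
      qed (use test_function_integrable_square[OF \<phi>] in auto)
      have iT: "integrable lborel (\<lambda>y. u y * of_real (1 / (1 + \<beta>) ^ 3 * \<phi> (T 1 y)))"
        using uL2 test_function_integrable_square[OF test_function_mult_left[OF Ck_const T1], of "1 / (1 + \<beta>) ^ 3"]
        by (intro integrable_mult_of_squares) auto
      have iG: "integrable (lborel \<Otimes>\<^sub>M lborel) (\<lambda>(s, x). G s x * of_real (\<phi> x))"
        by (rule intG) (auto intro: test_function_integrable_square[OF X_test[OF \<phi>]])
      have iF: "integrable lborel (\<lambda>x. F x * of_real (\<phi> x))"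
        using lborel_pair.integrable_snd[OF iG] by (simp add: F_def)
      \<comment> \<open>Fubini, the slice identity, and Fubini back; the fundamental theorem of
        calculus then acts on the smooth side.\<close>
      have "(LINT x|lborel. F x * of_real (\<phi> x)) = (LINT x|lborel. LINT s|lborel. G s x * of_real (\<phi> x))"
        by (simp add: F_def)
      also have "\<dots> = (LINT s|lborel. LINT x|lborel. G s x * of_real (\<phi> x))"
        by (rule lborel_pair.Fubini_integral[OF iG])
      also have "\<dots> = (LINT s|lborel. LINT y|lborel. u y * of_real (indicator {0..1} s *\<^sub>R r s y))"
      proof (rule Bochner_Integration.integral_cong[OF refl])
        fix s :: real
        have "(LINT y|lborel. u y * of_real (indicator {0..1} s *\<^sub>R r s y))
          = (LINT y|lborel. of_real (indicator {0..1} s * (- (1 / (1 + s * \<beta>) ^ 4))) * (u y * of_real (Q (T s y))))"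
          by (simp add: r_def algebra_simps)
        then show "(LINT x|lborel. G s x * of_real (\<phi> x)) = (LINT y|lborel. u y * of_real (indicator {0..1} s *\<^sub>R r s y))"
          unfolding slice by (simp only: integral_mult_right_zero) (simp add: scaleR_conv_of_real)
      qed
      also have "\<dots> = (LINT y|lborel. LINT s|lborel. u y * of_real (indicator {0..1} s *\<^sub>R r s y))"
        by (rule lborel_pair.Fubini_integral[OF intr, symmetric])
      also have "\<dots> = (LINT y|lborel. u y * of_real (1 / (1 + \<beta>) ^ 3 * \<phi> (T 1 y) - \<phi> y))"
        by (simp only: integral_mult_right_zero integral_complex_of_real ftc)
      also have "\<dots> = (LINT x|lborel. u (x + X x) * of_real (\<phi> x)) - (LINT x|lborel. u x * of_real (\<phi> x))"
        unfolding 1 Bochner_Integration.integral_diff[OF iT iu, symmetric]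
        by (simp add: right_diff_distrib)
      finally show ?thesis
        using iu iuX iF by (simp add: left_diff_distrib)
    qed
  qed measurable
  then show ?thesis
    by (simp add: F_def G_def X_def)
qed

subsection \<open>The Sobolev embedding into \<open>L\<^sup>4\<close>\<close>

text \<open>If \<open>f\<close> is not integrable, its Bochner integral is 0 by convention and the
  bound is trivial.\<close>

lemma norm_integral_le_nn_integral:
  fixes f :: "'a \<Rightarrow> 'b :: {banach, second_countable_topology}"
  shows "ennreal (norm (integral\<^sup>L M f)) \<le> (\<integral>\<^sup>+x. ennreal (norm (f x)) \<partial>M)"
  by (cases "integrable M f") (auto simp: integral_norm_bound_ennreal not_integrable_integral_eq)

lemma norm_sum_nth_mult_le:
  fixes v :: "complex ^ 3" and w :: R3
  shows "norm (\<Sum>j\<in>UNIV. v $ j * of_real (w $ j)) \<le> norm v * norm w"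
proof -
  have "norm (\<Sum>j\<in>UNIV. v $ j * of_real (w $ j)) \<le> (\<Sum>j\<in>UNIV. \<bar>norm (v $ j)\<bar> * \<bar>norm (w $ j)\<bar>)"
    by (rule order_trans[OF norm_sum]) (simp add: norm_mult)
  also have "\<dots> \<le> norm v * norm w"
    unfolding norm_vec_def by (rule L2_set_mult_ineq)
  finally show ?thesis .
qed

text \<open>Cauchy-Schwarz in \<open>s\<close> over an interval of length 1 and Fubini leave the
  integral of \<open>|p|^2\<close> along the flow at each time \<open>s\<close>; it is at most the
  integral at time 0, because \<open>\<beta> \<ge> 0\<close> makes the flow expanding.
  \<open>S\<close> is the whole space for translations and a ball for dilations, whose displacement
  is unbounded.\<close>

lemma weak_grad_displacement:
  fixes u :: "R3 \<Rightarrow> complex" and p :: "R3 \<Rightarrow> complex ^ 3"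
  assumes u: "in_Lp 2 u" and p: "in_Lp 2 p" and grad: "has_weak_grad u p" and \<beta>: "\<beta> \<ge> 0"
    and [measurable]: "S \<in> sets borel" and R: "\<And>x. x \<in> S \<Longrightarrow> norm (\<beta> *\<^sub>R x + h) \<le> R"
  shows "(\<integral>\<^sup>+x. indicator S x * ennreal ((norm (u (x + (\<beta> *\<^sub>R x + h)) - u x))\<^sup>2) \<partial>lborel)
    \<le> ennreal (R\<^sup>2) * (\<integral>\<^sup>+x. ennreal ((norm (p x))\<^sup>2) \<partial>lborel)"
proof -
  have [measurable]: "u \<in> borel_measurable borel" "p \<in> borel_measurable borel"
    using u p by (auto intro: in_Lp_measurable)
  define X where "X x = \<beta> *\<^sub>R x + h" for x :: R3
  have [measurable]: "X \<in> borel_measurable borel"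
    unfolding X_def by measurable
  have flow: "x + s *\<^sub>R X x = (1 + s * \<beta>) *\<^sub>R x + s *\<^sub>R h" for s x
    by (simp add: X_def algebra_simps)
  have "AE x in lborel. indicator S x * ennreal ((norm (u (x + X x) - u x))\<^sup>2)
    \<le> ennreal (R\<^sup>2) * (\<integral>\<^sup>+s. indicator {0..1} s * ennreal ((norm (p (x + s *\<^sub>R X x)))\<^sup>2) \<partial>lborel)"
    using weak_grad_ftc[OF u p grad \<beta>, of h]
  proof eventually_elim
    case (elim x)
    show ?case
    proof (cases "x \<in> S")
      case True
      have "ennreal (norm (u (x + X x) - u x))
        \<le> (\<integral>\<^sup>+s. ennreal (norm (indicator {0..1} s *\<^sub>R (\<Sum>j\<in>UNIV. p (x + s *\<^sub>R X x) $ j * of_real (X x $ j)))) \<partial>lborel)"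
        unfolding elim[folded X_def] by (rule norm_integral_le_nn_integral)
      \<comment> \<open>The indicator is idempotent and is written twice, so that Cauchy-Schwarz
        over the whole line leaves the cutoff on both factors.\<close>
      also have "\<dots> \<le> (\<integral>\<^sup>+s. (indicator {0..1} s * ennreal (norm (p (x + s *\<^sub>R X x)))) * (indicator {0..1} s * ennreal R) \<partial>lborel)"
      proof (rule nn_integral_mono)
        fix s :: real
        have "norm (\<Sum>j\<in>UNIV. p (x + s *\<^sub>R X x) $ j * of_real (X x $ j)) \<le> norm (p (x + s *\<^sub>R X x)) * R"
          by (rule order_trans[OF norm_sum_nth_mult_le mult_left_mono[OF R[OF True, folded X_def] norm_ge_zero]])
        then have "ennreal (norm (\<Sum>j\<in>UNIV. p (x + s *\<^sub>R X x) $ j * of_real (X x $ j))) \<le> ennreal (norm (p (x + s *\<^sub>R X x))) * ennreal R"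
          by (subst ennreal_mult'[symmetric]) (auto intro: ennreal_leI)
        then show "ennreal (norm (indicator {0..1} s *\<^sub>R (\<Sum>j\<in>UNIV. p (x + s *\<^sub>R X x) $ j * of_real (X x $ j))))
          \<le> (indicator {0..1} s * ennreal (norm (p (x + s *\<^sub>R X x)))) * (indicator {0..1} s * ennreal R)"
          by (auto split: split_indicator)
      qed
      finally have "(ennreal (norm (u (x + X x) - u x)))\<^sup>2
        \<le> (\<integral>\<^sup>+s. (indicator {0..1} s * ennreal (norm (p (x + s *\<^sub>R X x)))) * (indicator {0..1} s * ennreal R) \<partial>lborel)\<^sup>2"
        by (rule power_mono) simp
      also have "\<dots> \<le> (\<integral>\<^sup>+s. (indicator {0..1} s * ennreal (norm (p (x + s *\<^sub>R X x))))\<^sup>2 \<partial>lborel)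
          * (\<integral>\<^sup>+s. (indicator {0..1::real} s * ennreal R)\<^sup>2 \<partial>lborel)"
        by (rule Cauchy_Schwarz_nn_integral) measurable
      also have "(\<integral>\<^sup>+s. (indicator {0..1::real} s * ennreal R)\<^sup>2 \<partial>lborel) = (\<integral>\<^sup>+s. ennreal R ^ 2 * indicator {0..1::real} s \<partial>lborel)"
        by (intro nn_integral_cong) (auto split: split_indicator)
      also have "\<dots> = ennreal (R\<^sup>2)"
        using R[OF True] by (simp add: nn_integral_cmult ennreal_power order_trans[OF norm_ge_zero])
      also have "(\<integral>\<^sup>+s. (indicator {0..1} s * ennreal (norm (p (x + s *\<^sub>R X x))))\<^sup>2 \<partial>lborel)
        = (\<integral>\<^sup>+s. indicator {0..1} s * ennreal ((norm (p (x + s *\<^sub>R X x)))\<^sup>2) \<partial>lborel)"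
        by (intro nn_integral_cong) (auto simp: ennreal_power split: split_indicator)
      finally show ?thesis
        using True by (simp add: ennreal_power mult.commute)
    qed simp
  qed
  then have "(\<integral>\<^sup>+x. indicator S x * ennreal ((norm (u (x + X x) - u x))\<^sup>2) \<partial>lborel)
    \<le> (\<integral>\<^sup>+x. ennreal (R\<^sup>2) * (\<integral>\<^sup>+s. indicator {0..1} s * ennreal ((norm (p (x + s *\<^sub>R X x)))\<^sup>2) \<partial>lborel) \<partial>lborel)"
    by (rule nn_integral_mono_AE)
  also have "\<dots> = ennreal (R\<^sup>2) * (\<integral>\<^sup>+x. (\<integral>\<^sup>+s. indicator {0..1} s * ennreal ((norm (p (x + s *\<^sub>R X x)))\<^sup>2) \<partial>lborel) \<partial>lborel)"
    by (rule nn_integral_cmult) measurable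
  also have "(\<integral>\<^sup>+x. (\<integral>\<^sup>+s. indicator {0..1} s * ennreal ((norm (p (x + s *\<^sub>R X x)))\<^sup>2) \<partial>lborel) \<partial>lborel)
    = (\<integral>\<^sup>+s. (\<integral>\<^sup>+x. indicator {0..1} s * ennreal ((norm (p (x + s *\<^sub>R X x)))\<^sup>2) \<partial>lborel) \<partial>lborel)"
    by (rule lborel_pair.Fubini'[symmetric]) measurable
  also have "\<dots> \<le> ennreal (1 / 1 ^ 3) * (\<integral>\<^sup>+x. ennreal ((norm (p x))\<^sup>2) \<partial>lborel)"
    unfolding flow by (rule nn_integral_affine_family_le) (use \<beta> in auto)
  finally show ?thesis
    by (simp add: X_def mult_left_mono)
qed

text \<open>If \<open>f x > 2 s\<close>, then on at least half of the cube \<open>x + [0, \<delta>]\<^sup>3\<close> the function is at most \<open>s\<close>, so there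
  \<open>|f(x + h) - f x| \<ge> s\<close>; integrate the translation estimate over the cube.\<close>

lemma emeasure_level_set_step:
  fixes f :: "R3 \<Rightarrow> real"
  assumes [measurable]: "f \<in> borel_measurable borel"
    and transl: "\<And>h. (\<integral>\<^sup>+x. ennreal ((f (x + h) - f x)\<^sup>2) \<partial>lborel) \<le> ennreal ((norm h)\<^sup>2)"
    and s: "s > 0" and \<delta>: "\<delta> > 0"
    and small: "emeasure lborel {x. f x > s} \<le> ennreal (\<delta> ^ 3 / 2)"
  shows "emeasure lborel {x. f x > 2 * s} \<le> ennreal (6 * \<delta>\<^sup>2 / s\<^sup>2)"
proof -
  define Q where "Q = cbox 0 (\<delta> *\<^sub>R One :: R3)"
  have [measurable]: "Q \<in> sets borel" by (simp add: Q_def)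
  have Q_vol: "emeasure lborel Q = ennreal (\<delta> ^ 3)"
    unfolding Q_def using \<delta> by (subst emeasure_lborel_cbox) (auto simp: prod_constant)
  have Q_norm: "(norm h)\<^sup>2 \<le> 3 * \<delta>\<^sup>2" if "h \<in> Q" for h
  proof -
    have "0 \<le> h \<bullet> b \<and> h \<bullet> b \<le> \<delta>" if "b \<in> Basis" for b
      using \<open>h \<in> Q\<close> that by (auto simp: Q_def mem_box)
    then have "(\<Sum>b\<in>Basis. (h \<bullet> b)\<^sup>2) \<le> (\<Sum>b\<in>(Basis :: R3 set). \<delta>\<^sup>2)"
      by (intro sum_mono power_mono) auto
    then show ?thesis
      unfolding power2_norm_eq_inner euclidean_inner[of h h] by (simp add: power2_eq_square)
  qed
  have "(\<integral>\<^sup>+h. (\<integral>\<^sup>+x. indicator Q h * ennreal ((f (x + h) - f x)\<^sup>2) \<partial>lborel) \<partial>lborel)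
    \<le> (\<integral>\<^sup>+h. ennreal (3 * \<delta>\<^sup>2) * indicator Q h \<partial>lborel)"
  proof (rule nn_integral_mono)
    fix h
    show "(\<integral>\<^sup>+x. indicator Q h * ennreal ((f (x + h) - f x)\<^sup>2) \<partial>lborel) \<le> ennreal (3 * \<delta>\<^sup>2) * indicator Q h"
      using transl[of h] Q_norm[of h] by (auto simp: split: split_indicator intro: order_trans ennreal_leI)
  qed
  also have "\<dots> = ennreal (3 * \<delta>\<^sup>2 * \<delta> ^ 3)"
    using \<delta> by (simp add: nn_integral_cmult Q_vol ennreal_mult')
  finally have upper: "(\<integral>\<^sup>+h. (\<integral>\<^sup>+x. indicator Q h * ennreal ((f (x + h) - f x)\<^sup>2) \<partial>lborel) \<partial>lborel)
    \<le> ennreal (3 * \<delta>\<^sup>2 * \<delta> ^ 3)" .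
  have lower: "ennreal (s\<^sup>2 * (\<delta> ^ 3 / 2)) * indicator {x. f x > 2 * s} x
    \<le> (\<integral>\<^sup>+h. indicator Q h * ennreal ((f (x + h) - f x)\<^sup>2) \<partial>lborel)" for x
  proof (cases "f x > 2 * s")
    case True
    define E where "E = {h \<in> Q. f (x + h) \<le> s}"
    have [measurable]: "E \<in> sets borel" unfolding E_def by measurable
    have "emeasure lborel {h. f (x + h) > s} = (\<integral>\<^sup>+h. indicator {y. f y > s} (1 *\<^sub>R h + x) \<partial>lborel)"
    proof -
      have "emeasure lborel {h. f (x + h) > s} = (\<integral>\<^sup>+h. indicator {h. f (x + h) > s} h \<partial>lborel)"
        by (rule nn_integral_indicator[symmetric]) measurable
      also have "\<dots> = (\<integral>\<^sup>+h. indicator {y. f y > s} (1 *\<^sub>R h + x) \<partial>lborel)"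
        by (intro nn_integral_cong) (auto simp: add.commute split: split_indicator)
      finally show ?thesis .
    qed
    also have "\<dots> = emeasure lborel {y. f y > s}"
      by (subst nn_integral_lborel_affine) auto
    finally have tr: "emeasure lborel {h. f (x + h) > s} \<le> ennreal (\<delta> ^ 3 / 2)"
      using small by simp
    have "ennreal (\<delta> ^ 3) \<le> emeasure lborel (E \<union> {h. f (x + h) > s})"
      unfolding Q_vol[symmetric] by (rule emeasure_mono) (auto simp: E_def)
    also have "\<dots> \<le> emeasure lborel E + emeasure lborel {h. f (x + h) > s}"
      by (rule emeasure_subadditive) measurable
    also have "\<dots> \<le> emeasure lborel E + ennreal (\<delta> ^ 3 / 2)"
      using tr by (rule add_left_mono)
    finally have "ennreal (\<delta> ^ 3 / 2) \<le> emeasure lborel E"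
      using \<delta> by (cases "emeasure lborel E") (auto simp flip: ennreal_plus)
    then have "ennreal (s\<^sup>2) * ennreal (\<delta> ^ 3 / 2) \<le> (\<integral>\<^sup>+h. ennreal (s\<^sup>2) * indicator E h \<partial>lborel)"
      by (simp add: nn_integral_cmult mult_left_mono)
    also have "\<dots> \<le> (\<integral>\<^sup>+h. indicator Q h * ennreal ((f (x + h) - f x)\<^sup>2) \<partial>lborel)"
    proof (rule nn_integral_mono)
      fix h
      have "s\<^sup>2 \<le> (f x - f (x + h))\<^sup>2" if "f (x + h) \<le> s"
        using that True s by (intro power_mono) auto
      then show "ennreal (s\<^sup>2) * indicator E h \<le> indicator Q h * ennreal ((f (x + h) - f x)\<^sup>2)"
        by (auto simp: E_def power2_commute intro: ennreal_leI split: split_indicator)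
    qed
    finally have "ennreal (s\<^sup>2) * ennreal (\<delta> ^ 3 / 2) \<le> (\<integral>\<^sup>+h. indicator Q h * ennreal ((f (x + h) - f x)\<^sup>2) \<partial>lborel)" .
    moreover have "ennreal (s\<^sup>2 * (\<delta> ^ 3 / 2)) = ennreal (s\<^sup>2) * ennreal (\<delta> ^ 3 / 2)"
      using \<delta> by (intro ennreal_mult'') simp
    ultimately show ?thesis
      using True by (simp del: times_divide_eq_right)
  qed simp
  have "ennreal (s\<^sup>2 * (\<delta> ^ 3 / 2)) * emeasure lborel {x. f x > 2 * s}
    = (\<integral>\<^sup>+x. ennreal (s\<^sup>2 * (\<delta> ^ 3 / 2)) * indicator {x. f x > 2 * s} x \<partial>lborel)"
    by (subst nn_integral_cmult) auto
  also have "\<dots> \<le> (\<integral>\<^sup>+x. (\<integral>\<^sup>+h. indicator Q h * ennreal ((f (x + h) - f x)\<^sup>2) \<partial>lborel) \<partial>lborel)"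
    by (intro nn_integral_mono lower)
  also have "\<dots> = (\<integral>\<^sup>+h. (\<integral>\<^sup>+x. indicator Q h * ennreal ((f (x + h) - f x)\<^sup>2) \<partial>lborel) \<partial>lborel)"
    by (rule lborel_pair.Fubini'[symmetric]) measurable
  also note upper
  finally have le: "ennreal (s\<^sup>2 * (\<delta> ^ 3 / 2)) * emeasure lborel {x. f x > 2 * s} \<le> ennreal (3 * \<delta>\<^sup>2 * \<delta> ^ 3)" .
  \<comment> \<open>Dividing the upper bound \<open>3 \<delta>^2 \<delta>^3\<close> by
    \<open>s^2 \<delta>^3 / 2\<close> produces the constant 6; an infinite measure would make the
    left side infinite.\<close>
  show ?thesis
  proof (cases "emeasure lborel {x. f x > 2 * s}")
    case (real m)
    then have "s\<^sup>2 * (\<delta> ^ 3 / 2) * m \<le> 3 * \<delta>\<^sup>2 * \<delta> ^ 3"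
      using le s \<delta> by (simp flip: ennreal_mult)
    then have "\<delta> ^ 3 * (s\<^sup>2 * m) \<le> \<delta> ^ 3 * (6 * \<delta>\<^sup>2)"
      by (simp add: algebra_simps)
    then have "s\<^sup>2 * m \<le> 6 * \<delta>\<^sup>2"
      using \<delta> by simp
    then show ?thesis
      using s real by (simp add: pos_le_divide_eq mult.commute)
  next
    case top
    then show ?thesis
      using le s \<delta> by (simp add: ennreal_mult_top top_unique)
  qed
qed

text \<open>\<open>\<delta>\<close> is chosen so that the assumed decay at level
  \<open>s / 2\<close> is exactly the smallness \<open>\<delta> ^ 3 / 2\<close> demanded by the
  step; the bound by \<open>\<delta>^2\<close> over the squared level then has the new exponent. The
  map \<open>q \<mapsto> 2 q / 3 + 2\<close> has the fixed point 6, the critical Sobolev exponent in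
  dimension three, and increases every \<open>q\<close> below it.\<close>

lemma emeasure_level_set_bootstrap:
  fixes f :: "R3 \<Rightarrow> real"
  assumes f: "f \<in> borel_measurable borel"
    and transl: "\<And>h. (\<integral>\<^sup>+x. ennreal ((f (x + h) - f x)\<^sup>2) \<partial>lborel) \<le> ennreal ((norm h)\<^sup>2)"
    and K: "K > 0" and bound: "\<And>s. s > 0 \<Longrightarrow> emeasure lborel {x. f x > s} \<le> ennreal (K * s powr - q)"
    and s: "s > 0"
  shows "emeasure lborel {x. f x > s} \<le> ennreal (6 * (2 * K) powr (2/3) * 2 powr (2 * q / 3 + 2) * s powr - (2 * q / 3 + 2))"
proof -
  define t where "t = s / 2"
  have t: "t > 0" "2 * t = s" using s by (auto simp: t_def)
  define \<delta> where "\<delta> = (2 * K * t powr - q) powr (1/3)"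
  have pos: "2 * K * t powr - q > 0" using K t by simp
  have \<delta>: "\<delta> > 0" using K t(1) by (simp add: \<delta>_def)
  have "\<delta> ^ 3 = \<delta> powr 3"
    using \<delta> by (simp add: powr_numeral)
  also have "\<dots> = 2 * K * t powr - q"
    using K t(1) by (simp add: \<delta>_def powr_powr)
  finally have "\<delta> ^ 3 = 2 * K * t powr - q" .
  then have "emeasure lborel {x. f x > 2 * t} \<le> ennreal (6 * \<delta>\<^sup>2 / t\<^sup>2)"
    using bound[OF t(1)] by (intro emeasure_level_set_step f transl t(1) \<delta>) simp
  also have "6 * \<delta>\<^sup>2 / t\<^sup>2 = 6 * (2 * K) powr (2/3) * t powr - (2 * q / 3 + 2)"
  proof -
    have "\<delta>\<^sup>2 = \<delta> powr 2"
      using \<delta> by (simp add: powr_numeral)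
    also have "\<dots> = (2 * K * t powr - q) powr (2/3)"
      by (simp add: \<delta>_def powr_powr)
    also have "\<dots> = (2 * K) powr (2/3) * t powr - (2 * q / 3)"
      using K t by (simp add: powr_mult powr_powr mult.commute)
    moreover have "t\<^sup>2 = t powr 2" using t by (simp add: powr_numeral)
    moreover have "- (2 * q / 3 + 2) = - (2 * q / 3) - 2" by simp
    ultimately show ?thesis
      by (simp only: powr_diff times_divide_eq_right mult.assoc)
  qed
  also have "t powr - (2 * q / 3 + 2) = 2 powr (2 * q / 3 + 2) * s powr - (2 * q / 3 + 2)"
    using s by (simp add: t_def powr_divide powr_minus field_simps)
  finally show ?thesis
    by (simp only: t(2) mult.assoc)
qed

text \<open>Dyadic layers: where \<open>2 ^ k < f \<le> 2 ^ (k + 1)\<close> the fourth power is at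
  most \<open>16 * 16 ^ k\<close>, and where \<open>f \<le> 1\<close> it is paid by the square. The
  layers sum to a geometric series of ratio \<open>2 powr (4 - r)\<close>, which converges for
  \<open>r > 4\<close>.\<close>

lemma nn_integral_power4_le:
  fixes f :: "R3 \<Rightarrow> real"
  assumes [measurable]: "f \<in> borel_measurable borel" and nonneg: "\<And>x. 0 \<le> f x"
    and L2: "(\<integral>\<^sup>+x. ennreal ((f x)\<^sup>2) \<partial>lborel) \<le> 1"
    and C: "C \<ge> 0" "r > 4" and bound: "\<And>s. s > 0 \<Longrightarrow> emeasure lborel {x. f x > s} \<le> ennreal (C * s powr - r)"
  shows "(\<integral>\<^sup>+x. ennreal ((f x) ^ 4) \<partial>lborel) \<le> ennreal (1 + 16 * C * (1 / (1 - 2 powr (4 - r))))"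
proof -
  have pt: "ennreal ((f x) ^ 4) \<le> ennreal ((f x)\<^sup>2) + (\<Sum>k. ennreal (16 * 16 ^ k) * indicator {x. f x > 2 ^ k} x)" for x
  proof (cases "f x \<le> 1")
    case True
    then have "(f x) ^ 4 \<le> (f x)\<^sup>2"
      using nonneg power_decreasing[of 2 4 "f x"] by simp
    then show ?thesis
      by (intro add_increasing2 ennreal_leI) simp_all
  next
    case False
    define k where "k = (LEAST n. f x \<le> 2 ^ n)"
    have "\<exists>n. f x \<le> 2 ^ n"
      using real_arch_pow[of 2 "f x"] by (auto intro: less_imp_le)
    then have le: "f x \<le> 2 ^ k"
      unfolding k_def by (rule LeastI_ex)
    \<comment> \<open>\<open>k = 0\<close> would mean \<open>f x \<le> 1\<close>; the predecessor of
      the least exponent still fails, which places \<open>f x\<close> in layer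
      \<open>m\<close>.\<close>
    with False obtain m where m: "k = Suc m"
      by (cases k) auto
    have gt: "f x > 2 ^ m"
      using not_less_Least[of m "\<lambda>n. f x \<le> 2 ^ n"] m by (auto simp: k_def[symmetric])
    have "(f x) ^ 4 \<le> (2 ^ k) ^ 4"
      using le nonneg by (intro power_mono)
    also have "\<dots> = (2 ^ 4) ^ k"
      by (simp only: power_mult[symmetric] mult.commute)
    also have "\<dots> = 16 * 16 ^ m"
      by (simp add: m)
    finally have "ennreal ((f x) ^ 4) \<le> ennreal (16 * 16 ^ m) * indicator {x. f x > 2 ^ m} x"
      using gt by (simp add: ennreal_leI)
    also have "\<dots> \<le> (\<Sum>k. ennreal (16 * 16 ^ k) * indicator {x. f x > 2 ^ k} x)"
    proof -
      have "g m \<le> suminf g" for g :: "nat \<Rightarrow> ennreal"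
        using sum_le_suminf[of g "{m}"] by simp
      then show ?thesis .
    qed
    finally show ?thesis
      by (intro add_increasing) simp_all
  qed
  have q: "0 \<le> 2 powr (4 - r)" "2 powr (4 - r) < (1::real)"
    using C(2) by (auto simp: powr_less_one)
  have sum: "(\<lambda>k. 16 * C * (2 powr (4 - r)) ^ k) sums (16 * C * (1 / (1 - 2 powr (4 - r))))"
    using q by (intro sums_mult geometric_sums) simp
  have geom: "16 * 16 ^ k * (C * (2 ^ k) powr - r) = 16 * C * (2 powr (4 - r)) ^ k" for k
  proof -
    have "(16::real) ^ k = 2 powr (4 * real k)"
      by (simp add: powr_realpow flip: powr_powr)
    moreover have "(2 ^ k :: real) powr - r = 2 powr (- r * real k)"
      by (simp add: powr_powr mult.commute flip: powr_realpow)
    moreover have "(2 powr (4 - r)) ^ k = (2::real) powr (4 * real k) * 2 powr (- r * real k)"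
      by (simp add: powr_powr left_diff_distrib flip: powr_realpow powr_add)
    ultimately show ?thesis
      by simp
  qed
  have "(\<integral>\<^sup>+x. ennreal ((f x) ^ 4) \<partial>lborel)
    \<le> (\<integral>\<^sup>+x. ennreal ((f x)\<^sup>2) + (\<Sum>k. ennreal (16 * 16 ^ k) * indicator {x. f x > 2 ^ k} x) \<partial>lborel)"
    by (intro nn_integral_mono pt)
  also have "\<dots> = (\<integral>\<^sup>+x. ennreal ((f x)\<^sup>2) \<partial>lborel) + (\<Sum>k. (\<integral>\<^sup>+x. ennreal (16 * 16 ^ k) * indicator {x. f x > 2 ^ k} x \<partial>lborel))"
    by (subst nn_integral_add) (auto simp: nn_integral_suminf)
  also have "\<dots> \<le> 1 + (\<Sum>k. ennreal (16 * C * (2 powr (4 - r)) ^ k))"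
  proof (intro add_mono L2 suminf_le)
    fix k :: nat
    have "(\<integral>\<^sup>+x. ennreal (16 * 16 ^ k) * indicator {x. f x > 2 ^ k} x \<partial>lborel) = ennreal (16 * 16 ^ k) * emeasure lborel {x. f x > 2 ^ k}"
      by (subst nn_integral_cmult) auto
    also have "\<dots> \<le> ennreal (16 * 16 ^ k) * ennreal (C * (2 ^ k) powr - r)"
      by (intro mult_left_mono bound) auto
    also have "\<dots> = ennreal (16 * C * (2 powr (4 - r)) ^ k)"
      unfolding geom[symmetric] by (simp add: ennreal_mult')
    finally show "(\<integral>\<^sup>+x. ennreal (16 * 16 ^ k) * indicator {x. f x > 2 ^ k} x \<partial>lborel) \<le> ennreal (16 * C * (2 powr (4 - r)) ^ k)" .
  qed auto
  also have "(\<Sum>k. ennreal (16 * C * (2 powr (4 - r)) ^ k)) = ennreal (16 * C * (1 / (1 - 2 powr (4 - r))))"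
    using sums_unique[OF sum] sums_summable[OF sum] C(1) by (subst suminf_ennreal2) auto
  also have "1 + ennreal (16 * C * (1 / (1 - 2 powr (4 - r)))) = ennreal (1 + 16 * C * (1 / (1 - 2 powr (4 - r))))"
    using C q by (subst ennreal_plus) auto
  finally show ?thesis .
qed

text \<open>Starting from Chebyshev's decay exponent \<open>2\<close>, the map \<open>q \<mapsto> 2 q / 3 + 2\<close> exceeds \<open>4\<close> after two steps.\<close>

lemma L4_bound_normalized:
  obtains C where "C > 0"
    "\<And>f :: R3 \<Rightarrow> real. f \<in> borel_measurable borel \<Longrightarrow> (\<And>x. 0 \<le> f x) \<Longrightarrow>
     (\<integral>\<^sup>+x. ennreal ((f x)\<^sup>2) \<partial>lborel) \<le> 1 \<Longrightarrow>
     (\<And>h. (\<integral>\<^sup>+x. ennreal ((f (x + h) - f x)\<^sup>2) \<partial>lborel) \<le> ennreal ((norm h)\<^sup>2)) \<Longrightarrow>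
     (\<integral>\<^sup>+x. ennreal ((f x) ^ 4) \<partial>lborel) \<le> ennreal C"
proof -
  define K where "K K\<^sub>0 q = 6 * (2 * K\<^sub>0) powr (2/3) * 2 powr (2 * q / 3 + 2)" for K\<^sub>0 q :: real
  define C where "C = K (K 1 2) (2 * 2 / 3 + 2)"
  \<comment> \<open>The decay exponents run through 2, 10/3 and 38/9.\<close>
  define r where "r = 2 * (2 * 2 / 3 + 2) / 3 + (2 :: real)"
  have K_pos: "K K\<^sub>0 q > 0" if "K\<^sub>0 > 0" for K\<^sub>0 q
    using that by (simp add: K_def)
  have C: "C \<ge> 0" unfolding C_def using K_pos[OF K_pos[of 1]] by (simp add: less_imp_le)
  have r: "r > 4" by (simp add: r_def)
  have "(\<integral>\<^sup>+x. ennreal ((f x) ^ 4) \<partial>lborel) \<le> ennreal (1 + 16 * C * (1 / (1 - 2 powr (4 - r))))"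
    if [measurable]: "f \<in> borel_measurable borel" and nonneg: "\<And>x. 0 \<le> f x"
      and L2: "(\<integral>\<^sup>+x. ennreal ((f x)\<^sup>2) \<partial>lborel) \<le> 1"
      and transl: "\<And>h. (\<integral>\<^sup>+x. ennreal ((f (x + h) - f x)\<^sup>2) \<partial>lborel) \<le> ennreal ((norm h)\<^sup>2)"
    for f :: "R3 \<Rightarrow> real"
  proof (rule nn_integral_power4_le[OF _ nonneg L2 C r])
    have "emeasure lborel {x. f x > s} \<le> ennreal (1 * s powr - 2)" if s: "s > 0" for s
    proof -
      have "ennreal (s\<^sup>2) * emeasure lborel {x. f x > s} = (\<integral>\<^sup>+x. ennreal (s\<^sup>2) * indicator {x. f x > s} x \<partial>lborel)"
        by (subst nn_integral_cmult) auto
      also have "\<dots> \<le> (\<integral>\<^sup>+x. ennreal ((f x)\<^sup>2) \<partial>lborel)"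
        using s by (intro nn_integral_mono) (auto intro!: ennreal_leI power_mono split: split_indicator)
      finally have le: "ennreal (s\<^sup>2) * emeasure lborel {x. f x > s} \<le> ennreal 1"
        using L2 by simp
      show ?thesis
      proof (cases "emeasure lborel {x. f x > s}")
        case (real m)
        then have "s\<^sup>2 * m \<le> 1"
          using le by (simp flip: ennreal_mult)
        then have "m \<le> s powr - 2"
          using s by (simp add: powr_minus powr_numeral field_simps)
        then show ?thesis
          using real by (simp add: ennreal_leI)
      next
        case top
        then show ?thesis
          using le s by (simp add: ennreal_mult_top top_unique)
      qed
    qed
    from emeasure_level_set_bootstrap[OF that(1) transl _ this]
    have "emeasure lborel {x. f x > s} \<le> ennreal (K 1 2 * s powr - (2 * 2 / 3 + 2))" if "s > 0" for s
      using that by (simp add: K_def)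
    from emeasure_level_set_bootstrap[OF that(1) transl K_pos this]
    show "emeasure lborel {x. f x > s} \<le> ennreal (C * s powr - r)" if "s > 0" for s
      using that unfolding C_def r_def K_def by simp
  qed measurable
  moreover have "1 + 16 * C * (1 / (1 - 2 powr (4 - r))) > 0"
    using C r by (intro add_pos_nonneg mult_nonneg_nonneg) (auto simp: powr_less_one less_imp_le)
  ultimately show ?thesis
    by (rule that[rotated])
qed

text \<open>Dividing \<open>|u|\<close> by \<open>sqrt N\<close>, with \<open>N\<close> the squared
  H1 norm, makes the normalized bound applicable: the reverse triangle inequality passes the
  translation estimate from \<open>u\<close> to \<open>|u|\<close>, and homogeneity of degree four
  returns the factor \<open>N^2\<close>.\<close>

lemma sobolev_L4:
  obtains C where "C > 0"
    "\<And>u p. in_Lp 2 u \<Longrightarrow> in_Lp 2 p \<Longrightarrow> has_weak_grad u p \<Longrightarrow> integrable lborel (\<lambda>x. cmod (u x) ^ 4)"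
    "\<And>u p. in_Lp 2 u \<Longrightarrow> in_Lp 2 p \<Longrightarrow> has_weak_grad u p \<Longrightarrow>
       (LINT x|lborel. cmod (u x) ^ 4) \<le> C * ((LINT x|lborel. (cmod (u x))\<^sup>2) + (LINT x|lborel. (norm (p x))\<^sup>2))\<^sup>2"
proof -
  obtain C where C: "C > 0" "\<And>f :: R3 \<Rightarrow> real. f \<in> borel_measurable borel \<Longrightarrow> (\<And>x. 0 \<le> f x) \<Longrightarrow>
     (\<integral>\<^sup>+x. ennreal ((f x)\<^sup>2) \<partial>lborel) \<le> 1 \<Longrightarrow>
     (\<And>h. (\<integral>\<^sup>+x. ennreal ((f (x + h) - f x)\<^sup>2) \<partial>lborel) \<le> ennreal ((norm h)\<^sup>2)) \<Longrightarrow>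
     (\<integral>\<^sup>+x. ennreal ((f x) ^ 4) \<partial>lborel) \<le> ennreal C"
    using L4_bound_normalized by blast
  have main: "(\<integral>\<^sup>+x. ennreal (cmod (u x) ^ 4) \<partial>lborel)
      \<le> ennreal (C * ((LINT x|lborel. (cmod (u x))\<^sup>2) + (LINT x|lborel. (norm (p x))\<^sup>2))\<^sup>2)"
    if u: "in_Lp 2 u" and p: "in_Lp 2 p" and grad: "has_weak_grad u p" for u p
  proof -
    have [measurable]: "u \<in> borel_measurable borel"
      using u by (rule in_Lp_measurable)
    have iu: "integrable lborel (\<lambda>x. (cmod (u x))\<^sup>2)" and ip: "integrable lborel (\<lambda>x. (norm (p x))\<^sup>2)"
      using u p by (auto simp: in_Lp_2_iff)
    define N where "N = (LINT x|lborel. (cmod (u x))\<^sup>2) + (LINT x|lborel. (norm (p x))\<^sup>2)"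
    have N0: "0 \<le> N" unfolding N_def by (intro add_nonneg_nonneg integral_nonneg_AE) auto
    show ?thesis
    proof (cases "N = 0")
      case True
      then have "(LINT x|lborel. (cmod (u x))\<^sup>2) = 0"
        unfolding N_def by (smt (verit) integral_nonneg_AE AE_I2 zero_le_power2)
      then have "AE x in lborel. (cmod (u x))\<^sup>2 = 0"
        using iu by (subst (asm) integral_nonneg_eq_0_iff_AE) auto
      then have "AE x in lborel. ennreal (cmod (u x) ^ 4) = 0"
        by eventually_elim simp
      then have "(\<integral>\<^sup>+x. ennreal (cmod (u x) ^ 4) \<partial>lborel) = 0"
        by (subst nn_integral_0_iff_AE) auto
      then show ?thesis by simp
    next
      case False
      with N0 have N: "N > 0" by simp
      define f where "f x = cmod (u x) / sqrt N" for x
      have [measurable]: "f \<in> borel_measurable borel" unfolding f_def by measurable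
      have f2: "(f x)\<^sup>2 = (cmod (u x))\<^sup>2 / N" for x
        using N by (simp add: f_def power_divide)
      have "(\<integral>\<^sup>+x. ennreal ((f x) ^ 4) \<partial>lborel) \<le> ennreal C"
      proof (rule C(2))
        show "0 \<le> f x" for x using N by (simp add: f_def)
        have "(\<integral>\<^sup>+x. ennreal ((f x)\<^sup>2) \<partial>lborel) = ennreal ((LINT x|lborel. (cmod (u x))\<^sup>2) / N)"
          unfolding f2 using iu N by (subst nn_integral_eq_integral) auto
        also have "\<dots> \<le> ennreal 1"
          using N by (intro ennreal_leI) (simp add: N_def divide_le_eq_1)
        finally show "(\<integral>\<^sup>+x. ennreal ((f x)\<^sup>2) \<partial>lborel) \<le> 1" by simp
        fix h
        have pt: "ennreal ((f (x + h) - f x)\<^sup>2) \<le> ennreal (1 / N) * (indicator UNIV x * ennreal ((norm (u (x + (0 *\<^sub>R x + h)) - u x))\<^sup>2))" for x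
        proof -
          have sN: "\<bar>sqrt N\<bar> = sqrt N"
            using N by simp
          have "\<bar>f (x + h) - f x\<bar> \<le> cmod (u (x + h) - u x) / sqrt N"
            unfolding f_def diff_divide_distrib[symmetric] abs_divide sN
            using norm_triangle_ineq3[of "u (x + h)" "u x"] N by (intro divide_right_mono) simp_all
          then have "(f (x + h) - f x)\<^sup>2 \<le> (cmod (u (x + h) - u x) / sqrt N)\<^sup>2"
            using power_mono[of "\<bar>f (x + h) - f x\<bar>" _ 2] by simp
          also have "\<dots> = 1 / N * (cmod (u (x + h) - u x))\<^sup>2"
            using N by (simp add: power_divide)
          finally show ?thesis
            using N by (simp add: ennreal_leI flip: ennreal_mult')
        qed
        have "(\<integral>\<^sup>+x. ennreal ((f (x + h) - f x)\<^sup>2) \<partial>lborel)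
          \<le> (\<integral>\<^sup>+x. ennreal (1 / N) * (indicator UNIV x * ennreal ((norm (u (x + (0 *\<^sub>R x + h)) - u x))\<^sup>2)) \<partial>lborel)"
          by (intro nn_integral_mono pt)
        also have "\<dots> = ennreal (1 / N) * (\<integral>\<^sup>+x. indicator UNIV x * ennreal ((norm (u (x + (0 *\<^sub>R x + h)) - u x))\<^sup>2) \<partial>lborel)"
          by (rule nn_integral_cmult) measurable
        also have "\<dots> \<le> ennreal (1 / N) * (ennreal ((norm h)\<^sup>2) * (\<integral>\<^sup>+x. ennreal ((norm (p x))\<^sup>2) \<partial>lborel))"
          by (intro mult_left_mono weak_grad_displacement[OF u p grad]) auto
        also have "\<dots> = ennreal ((norm h)\<^sup>2 * ((LINT x|lborel. (norm (p x))\<^sup>2) / N))"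
          using N ip by (simp add: nn_integral_eq_integral integral_nonneg_AE flip: ennreal_mult')
        also have "\<dots> \<le> ennreal ((norm h)\<^sup>2)"
        proof (intro ennreal_leI mult_left_le)
          have "0 \<le> (LINT x|lborel. (cmod (u x))\<^sup>2)" by (intro integral_nonneg_AE) auto
          then show "(LINT x|lborel. (norm (p x))\<^sup>2) / N \<le> 1"
            using N by (simp add: N_def divide_le_eq_1)
        qed simp
        finally show "(\<integral>\<^sup>+x. ennreal ((f (x + h) - f x)\<^sup>2) \<partial>lborel) \<le> ennreal ((norm h)\<^sup>2)" .
      qed measurable
      then have "ennreal (N\<^sup>2) * (\<integral>\<^sup>+x. ennreal ((f x) ^ 4) \<partial>lborel) \<le> ennreal (N\<^sup>2) * ennreal C"
        by (intro mult_left_mono) auto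
      also have "ennreal (N\<^sup>2) * (\<integral>\<^sup>+x. ennreal ((f x) ^ 4) \<partial>lborel) = (\<integral>\<^sup>+x. ennreal (cmod (u x) ^ 4) \<partial>lborel)"
      proof (subst nn_integral_cmult[symmetric], measurable, intro nn_integral_cong)
        fix x
        have "N\<^sup>2 * (f x) ^ 4 = (N * (f x)\<^sup>2)\<^sup>2"
          by (simp add: power_mult_distrib flip: power_mult)
        also have "\<dots> = cmod (u x) ^ 4"
          using N by (simp add: f2 flip: power_mult)
        finally show "ennreal (N\<^sup>2) * ennreal (f x ^ 4) = ennreal (cmod (u x) ^ 4)"
          by (simp flip: ennreal_mult')
      qed
      also have "ennreal (N\<^sup>2) * ennreal C = ennreal (C * N\<^sup>2)"
        using C(1) by (simp add: mult.commute flip: ennreal_mult')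
      finally show ?thesis by (simp add: N_def)
    qed
  qed
  have int: "integrable lborel (\<lambda>x. cmod (u x) ^ 4)" if "in_Lp 2 u" "in_Lp 2 p" "has_weak_grad u p" for u p
  proof (rule integrableI_nonneg)
    show "(\<lambda>x. cmod (u x) ^ 4) \<in> borel_measurable lborel"
      using in_Lp_measurable[OF that(1)] by simp
    show "(\<integral>\<^sup>+x. ennreal (cmod (u x) ^ 4) \<partial>lborel) < \<infinity>"
      using main[OF that] by (rule order.strict_trans1) simp
  qed simp
  show ?thesis
  proof (rule that[OF C(1) int])
    fix u p assume *: "in_Lp 2 u" "in_Lp 2 p" "has_weak_grad u p"
    show "(LINT x|lborel. cmod (u x) ^ 4) \<le> C * ((LINT x|lborel. (cmod (u x))\<^sup>2) + (LINT x|lborel. (norm (p x))\<^sup>2))\<^sup>2"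
      using main[OF *] C(1) by (simp add: nn_integral_eq_integral[OF int[OF *]] ennreal_le_iff)
  qed
qed

subsection \<open>Operations on weak gradients\<close>

lemma in_Lp_2_add:
  fixes f g :: "R3 \<Rightarrow> 'b :: {banach, second_countable_topology}"
  assumes f: "in_Lp 2 f" and g: "in_Lp 2 g"
  shows "in_Lp 2 (\<lambda>x. f x + g x)"
proof -
  have [measurable]: "f \<in> borel_measurable borel" "g \<in> borel_measurable borel"
    using f g by (auto intro: in_Lp_measurable)
  have "(norm (f x + g x))\<^sup>2 \<le> 2 * (norm (f x))\<^sup>2 + 2 * (norm (g x))\<^sup>2" for x
  proof -
    have "(norm (f x + g x))\<^sup>2 \<le> (norm (f x) + norm (g x))\<^sup>2"
      by (intro power_mono norm_triangle_ineq) simp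
    also have "\<dots> \<le> 2 * (norm (f x))\<^sup>2 + 2 * (norm (g x))\<^sup>2"
      using sum_squares_bound[of "norm (f x)" "norm (g x)"] by (simp add: power2_sum)
    finally show ?thesis .
  qed
  then have le: "AE x in lborel. norm ((norm (f x + g x))\<^sup>2) \<le> norm (2 * (norm (f x))\<^sup>2 + 2 * (norm (g x))\<^sup>2)"
    by (intro AE_I2) (simp add: abs_of_nonneg)
  have "integrable lborel (\<lambda>x. 2 * (norm (f x))\<^sup>2 + 2 * (norm (g x))\<^sup>2)"
    using f g by (simp add: in_Lp_2_iff)
  then have "integrable lborel (\<lambda>x. (norm (f x + g x))\<^sup>2)"
    by (rule Bochner_Integration.integrable_bound[OF _ _ le]) measurable
  then show ?thesis
    by (simp add: in_Lp_2_iff)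
qed

lemma in_Lp_2_scaleR:
  fixes f :: "R3 \<Rightarrow> 'b :: {banach, second_countable_topology}"
  assumes "in_Lp 2 f"
  shows "in_Lp 2 (\<lambda>x. a *\<^sub>R f x)"
proof -
  have [measurable]: "f \<in> borel_measurable borel" using assms by (rule in_Lp_measurable)
  show ?thesis
    using assms by (simp add: in_Lp_2_iff power_mult_distrib)
qed

lemma in_Lp_2_affine:
  fixes f :: "R3 \<Rightarrow> 'b :: {banach, second_countable_topology}"
  assumes "in_Lp 2 f" "t \<noteq> 0"
  shows "in_Lp 2 (\<lambda>x. f (t *\<^sub>R x))"
proof -
  have [measurable]: "f \<in> borel_measurable borel" using assms(1) by (rule in_Lp_measurable)
  show ?thesis
    using assms integrable_lborel_affine_iff[of "\<lambda>x. (norm (f x))\<^sup>2" t 0] by (auto simp: in_Lp_2_iff)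
qed

lemma in_Lp_2_test_integrable:
  fixes f :: "R3 \<Rightarrow> complex"
  assumes "in_Lp 2 f" "test_function \<phi>"
  shows "integrable lborel (\<lambda>x. f x * of_real (\<phi> x))"
  using assms(1) test_function_measurable[OF assms(2)] test_function_integrable_square[OF assms(2)]
  unfolding in_Lp_2_iff by (intro integrable_mult_of_squares) simp_all

lemma in_Lp_2_component:
  fixes p :: "R3 \<Rightarrow> 'b :: {banach, second_countable_topology} ^ 3"
  shows "in_Lp 2 p \<Longrightarrow> in_Lp 2 (\<lambda>x. p x $ j)"
  unfolding in_Lp_2_iff[of "\<lambda>x. p x $ j"]
  by (intro conjI in_Lp_2_nth borel_measurable_nth in_Lp_measurable)

lemma has_weak_grad_add:
  assumes "in_Lp 2 u" "in_Lp 2 v" "in_Lp 2 p" "in_Lp 2 q" "has_weak_grad u p" "has_weak_grad v q"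
  shows "has_weak_grad (\<lambda>x. u x + v x) (\<lambda>x. p x + q x)"
  unfolding has_weak_grad_def
proof (intro allI impI)
  fix \<phi> j assume \<phi>: "test_function \<phi>"
  note i1 = in_Lp_2_test_integrable[OF assms(1) test_function_pderiv[OF \<phi>], of j]
    in_Lp_2_test_integrable[OF assms(2) test_function_pderiv[OF \<phi>], of j]
  note i2 = in_Lp_2_test_integrable[OF in_Lp_2_component[OF assms(3)] \<phi>, of j]
    in_Lp_2_test_integrable[OF in_Lp_2_component[OF assms(4)] \<phi>, of j]
  show "(LINT x|lborel. (u x + v x) * of_real (pderiv_at j \<phi> x)) = - (LINT x|lborel. (p x + q x) $ j * of_real (\<phi> x))"
    using has_weak_gradD[OF assms(5) \<phi>, of j] has_weak_gradD[OF assms(6) \<phi>, of j]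
    unfolding vector_add_component distrib_right
      Bochner_Integration.integral_add[OF i1] Bochner_Integration.integral_add[OF i2] by simp
qed

lemma has_weak_grad_scaleR:
  assumes "has_weak_grad u p"
  shows "has_weak_grad (\<lambda>x. a *\<^sub>R u x) (\<lambda>x. a *\<^sub>R p x)"
  unfolding has_weak_grad_def
proof (intro allI impI)
  fix \<phi> j assume \<phi>: "test_function \<phi>"
  show "(LINT x|lborel. (a *\<^sub>R u x) * of_real (pderiv_at j \<phi> x)) = - (LINT x|lborel. (a *\<^sub>R p x) $ j * of_real (\<phi> x))"
    using has_weak_gradD[OF assms \<phi>, of j] by simp
qed

lemma has_weak_grad_dilation:
  assumes u: "in_Lp 2 u" and p: "in_Lp 2 p" and grad: "has_weak_grad u p" and t: "t > 0"
  shows "has_weak_grad (\<lambda>x. u (t *\<^sub>R x)) (\<lambda>x. t *\<^sub>R p (t *\<^sub>R x))"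
  unfolding has_weak_grad_def
proof (intro allI impI)
  fix \<phi> j assume \<phi>: "test_function \<phi>"
  have [measurable]: "u \<in> borel_measurable borel" "p \<in> borel_measurable borel"
    using u p by (auto intro: in_Lp_measurable)
  define \<psi> where "\<psi> x = \<phi> ((1 / t) *\<^sub>R x + 0)" for x
  have \<psi>: "test_function \<psi>"
    unfolding \<psi>_def using t by (intro test_function_affine \<phi>) simp
  have d: "pderiv_at j \<psi> x = 1 / t * pderiv_at j \<phi> ((1 / t) *\<^sub>R x)" for x
    using Ck_pderiv_affine[OF test_function_Ck[OF \<phi>], of j "1 / t" 0 x] by (simp add: \<psi>_def[abs_def])
  note [measurable] = test_function_measurable[OF \<psi>] test_function_measurable[OF test_function_pderiv[OF \<psi>]]
  have "(LINT x|lborel. u (t *\<^sub>R x) * of_real (pderiv_at j \<phi> x))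
    = (LINT x|lborel. t *\<^sub>R (\<lambda>y. u y * of_real (pderiv_at j \<psi> y)) (t *\<^sub>R x + 0))"
    using t by (simp add: d scaleR_conv_of_real[where 'a = complex])
  also have "\<dots> = t *\<^sub>R ((1 / \<bar>t\<bar> ^ 3) *\<^sub>R (LINT y|lborel. u y * of_real (pderiv_at j \<psi> y)))"
    using t by (subst integral_scaleR_right, subst integral_lborel_affine) auto
  also have "(LINT y|lborel. u y * of_real (pderiv_at j \<psi> y)) = - (LINT y|lborel. p y $ j * of_real (\<psi> y))"
    by (rule has_weak_gradD[OF grad \<psi>])
  also have "t *\<^sub>R ((1 / \<bar>t\<bar> ^ 3) *\<^sub>R - (LINT y|lborel. p y $ j * of_real (\<psi> y)))
    = - (LINT x|lborel. t *\<^sub>R (\<lambda>y. p y $ j * of_real (\<psi> y)) (t *\<^sub>R x + 0))"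
    using t by (subst integral_scaleR_right, subst integral_lborel_affine) auto
  also have "\<dots> = - (LINT x|lborel. (t *\<^sub>R p (t *\<^sub>R x)) $ j * of_real (\<phi> x))"
    using t by (simp add: \<psi>_def)
  finally show "(LINT x|lborel. u (t *\<^sub>R x) * of_real (pderiv_at j \<phi> x)) = - (LINT x|lborel. (t *\<^sub>R p (t *\<^sub>R x)) $ j * of_real (\<phi> x))" .
qed

subsection \<open>The energy space in terms of weak gradients\<close>

lemma norm_vec_power2: "(norm v)\<^sup>2 = (\<Sum>j\<in>UNIV. (norm (v $ j))\<^sup>2)"
  by (simp add: norm_vec_def L2_set_def sum_nonneg)

lemma borel_measurable_vec_lambda:
  fixes f :: "'a \<Rightarrow> 'n::finite \<Rightarrow> 'b :: euclidean_space"
  assumes [measurable]: "\<And>j. (\<lambda>x. f x j) \<in> borel_measurable M"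
  shows "(\<lambda>x. \<chi> j. f x j) \<in> borel_measurable M"
  by (subst borel_measurable_euclidean_space) (auto simp: Basis_vec_def inner_axis)

lemma AE_eq_if_test_integrals_eq:
  fixes f g :: "R3 \<Rightarrow> complex"
  assumes f: "in_Lp 2 f" and g: "in_Lp 2 g"
    and eq: "\<And>\<phi>. test_function \<phi> \<Longrightarrow> (LINT x|lborel. f x * of_real (\<phi> x)) = (LINT x|lborel. g x * of_real (\<phi> x))"
  shows "AE x in lborel. f x = g x"
proof -
  have [measurable]: "f \<in> borel_measurable borel" "g \<in> borel_measurable borel"
    using f g by (auto intro: in_Lp_measurable)
  have d: "in_Lp 2 (\<lambda>x. f x + (- 1) *\<^sub>R g x)"
    by (rule in_Lp_2_add[OF f in_Lp_2_scaleR[OF g]])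
  have "AE x in lborel. f x - g x = 0"
  proof (rule fundamental_lemma)
    fix a b :: R3
    have ind: "(\<lambda>x. (indicator (box a b) x :: real)\<^sup>2) = indicator (box a b)"
      by (auto simp: fun_eq_iff split: split_indicator)
    have "integrable lborel (\<lambda>x. (f x + (- 1) *\<^sub>R g x) * of_real (indicator (box a b) x))"
    proof (rule integrable_mult_of_squares)
      show "integrable lborel (\<lambda>x. (norm (f x + (- 1) *\<^sub>R g x))\<^sup>2)"
        using d unfolding in_Lp_2_iff by (rule conjunct2)
      show "integrable lborel (\<lambda>x. (indicator (box a b) x :: real)\<^sup>2)"
        unfolding ind using emeasure_lborel_box_finite[of a b] by simp
    qed measurable
    then show "integrable lborel (\<lambda>x. indicator (box a b) x *\<^sub>R (f x - g x))"
      by (simp add: scaleR_conv_of_real mult.commute)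
  next
    fix \<phi> assume \<phi>: "test_function \<phi>"
    show "(LINT x|lborel. (f x - g x) * of_real (\<phi> x)) = 0"
      unfolding left_diff_distrib
        Bochner_Integration.integral_diff[OF in_Lp_2_test_integrable[OF f \<phi>] in_Lp_2_test_integrable[OF g \<phi>]]
      by (simp add: eq[OF \<phi>])
  qed measurable
  then show ?thesis by simp
qed

lemma has_mag_gradD:
  "has_mag_grad A u g \<Longrightarrow> test_function \<phi> \<Longrightarrow>
     - \<i> * (LINT x|lborel. u x * of_real (pderiv_at j \<phi> x))
       + (LINT x|lborel. of_real (A x $ j) * u x * of_real (\<phi> x))
     = (LINT x|lborel. g x $ j * of_real (\<phi> x))"
  unfolding has_mag_grad_def by blast

text \<open>The components agree by the fundamental lemma. As \<open>mag_grad\<close> is a choice,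
  this is what allows any explicit magnetic gradient to replace it under integrals.\<close>

lemma has_mag_grad_unique:
  assumes "in_Lp 2 g" "in_Lp 2 g'" "has_mag_grad A u g" "has_mag_grad A u g'"
  shows "AE x in lborel. g x = g' x"
proof -
  have "AE x in lborel. g x $ j = g' x $ j" for j
    using has_mag_gradD[OF assms(3), of _ j] has_mag_gradD[OF assms(4), of _ j]
    by (intro AE_eq_if_test_integrals_eq in_Lp_2_component assms(1,2)) simp
  then have "AE x in lborel. \<forall>j\<in>UNIV. g x $ j = g' x $ j"
    by (intro AE_finite_allI) auto
  then show ?thesis
    by eventually_elim (simp add: vec_eq_iff)
qed

lemma AE_nonzero: "AE x in lborel. (x :: R3) \<noteq> 0"
  by (rule AE_lborel_singleton)

lemma norm_mag_mult: "(norm (\<chi> j. (of_real (a $ j) * z :: complex)))\<^sup>2 = (norm (a :: R3))\<^sup>2 * (cmod z)\<^sup>2"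
  by (simp add: norm_vec_power2 norm_mult power_mult_distrib sum_distrib_right)

lemma norm_ii_mult: "norm (\<chi> j. \<i> * (v :: complex ^ 3) $ j) = norm v"
  by (simp add: norm_vec_def norm_mult)

text \<open>The pointwise conditions concern \<open>x \<noteq> 0\<close>; the origin being a null
  set, the integral estimates use them through \<open>AE_nonzero\<close>. For an admissible pair the
  strict positivity of \<open>V\<close> is extracted from the Pohozaev condition.\<close>

locale magnetic_pair =
  fixes A :: "R3 \<Rightarrow> R3" and V :: "R3 \<Rightarrow> real" and \<alpha> :: real
  assumes A_measurable [measurable]: "A \<in> borel_measurable borel"
    and V_measurable [measurable]: "V \<in> borel_measurable borel"
    and \<alpha>_pos: "\<alpha> > 0"
    and V_ge: "x \<noteq> 0 \<Longrightarrow> \<alpha> * (norm (A x))\<^sup>2 \<le> V x"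
    and V_pos: "x \<noteq> 0 \<Longrightarrow> V x > 0"
begin

definition mg :: "(R3 \<Rightarrow> complex) \<Rightarrow> (R3 \<Rightarrow> complex ^ 3) \<Rightarrow> R3 \<Rightarrow> complex ^ 3" where
  "mg u p x = (\<chi> j. \<i> * p x $ j + of_real (A x $ j) * u x)"

text \<open>The energy space with the plain weak gradient as an explicit witness, so that sums,
  multiples and dilations carry their gradients along instead of passing through the choice in
  \<open>mag_grad\<close>.\<close>

definition Sigma_pair :: "(R3 \<Rightarrow> complex) \<Rightarrow> (R3 \<Rightarrow> complex ^ 3) \<Rightarrow> bool" where
  "Sigma_pair u p \<longleftrightarrow> in_Lp 2 u \<and> in_Lp 2 p \<and> has_weak_grad u p \<and> integrable lborel (\<lambda>x. V x * (cmod (u x))\<^sup>2)"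

lemma Sigma_pairD:
  assumes "Sigma_pair u p"
  shows "in_Lp 2 u" "in_Lp 2 p" "has_weak_grad u p" "integrable lborel (\<lambda>x. V x * (cmod (u x))\<^sup>2)"
    "u \<in> borel_measurable borel" "p \<in> borel_measurable borel"
    "integrable lborel (\<lambda>x. (cmod (u x))\<^sup>2)" "integrable lborel (\<lambda>x. (norm (p x))\<^sup>2)"
  using assms by (simp_all add: Sigma_pair_def in_Lp_2_iff)

lemma mg_measurable:
  assumes [measurable]: "u \<in> borel_measurable borel" "p \<in> borel_measurable borel"
  shows "mg u p \<in> borel_measurable borel"
  unfolding mg_def[abs_def] by (intro borel_measurable_vec_lambda) measurable

text \<open>\<open>V \<ge> \<alpha> |A|^2\<close> dominates \<open>|A u|^2\<close> by
  \<open>V |u|^2 / \<alpha>\<close>. This makes the descriptions of the energy space by magnetic and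
  by plain gradients equivalent.\<close>

lemma A_mult_L2:
  assumes [measurable]: "u \<in> borel_measurable borel" and "integrable lborel (\<lambda>x. V x * (cmod (u x))\<^sup>2)"
  shows "in_Lp 2 (\<lambda>x. \<chi> j. of_real (A x $ j) * u x)"
proof -
  have le: "AE x in lborel. norm ((norm (A x))\<^sup>2 * (cmod (u x))\<^sup>2) \<le> norm (1 / \<alpha> * (V x * (cmod (u x))\<^sup>2))"
    using AE_nonzero
  proof eventually_elim
    case (elim x)
    have "(norm (A x))\<^sup>2 \<le> V x / \<alpha>"
      using V_ge[OF elim] \<alpha>_pos by (simp add: pos_le_divide_eq mult.commute)
    from mult_right_mono[OF this, of "(cmod (u x))\<^sup>2"]
    show ?case
      using V_pos[OF elim] \<alpha>_pos by simp
  qed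
  have "integrable lborel (\<lambda>x. (norm (A x))\<^sup>2 * (cmod (u x))\<^sup>2)"
    by (rule Bochner_Integration.integrable_bound[OF integrable_mult_right[OF assms(2)] _ le]) measurable
  moreover have "(\<lambda>x. \<chi> j. of_real (A x $ j) * u x) \<in> borel_measurable borel"
    by (intro borel_measurable_vec_lambda) measurable
  ultimately show ?thesis
    by (simp add: in_Lp_2_iff norm_mag_mult)
qed

lemma mg_L2:
  assumes "Sigma_pair u p"
  shows "in_Lp 2 (mg u p)"
proof -
  note [measurable] = Sigma_pairD(5,6)[OF assms]
  have "(\<lambda>x. \<chi> j. \<i> * p x $ j) \<in> borel_measurable borel"
    by (intro borel_measurable_vec_lambda) measurable
  then have "in_Lp 2 (\<lambda>x. \<chi> j. \<i> * p x $ j)"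
    using Sigma_pairD(8)[OF assms] by (simp add: in_Lp_2_iff norm_ii_mult)
  from in_Lp_2_add[OF this A_mult_L2[OF Sigma_pairD(5,4)[OF assms]]]
  show ?thesis
    by (simp add: mg_def[abs_def] plus_vec_def)
qed

lemma mg_has_mag_grad:
  assumes "Sigma_pair u p"
  shows "has_mag_grad A u (mg u p)"
  unfolding has_mag_grad_def
proof (intro allI impI)
  fix \<phi> j assume \<phi>: "test_function \<phi>"
  have i1: "integrable lborel (\<lambda>x. of_real (A x $ j) * u x * of_real (\<phi> x))"
    using in_Lp_2_test_integrable[OF in_Lp_2_component[OF A_mult_L2[OF Sigma_pairD(5,4)[OF assms]], of j] \<phi>] by simp
  have i2: "integrable lborel (\<lambda>x. \<i> * (p x $ j * of_real (\<phi> x)))"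
    by (intro integrable_mult_right in_Lp_2_test_integrable in_Lp_2_component Sigma_pairD(2)[OF assms] \<phi>)
  have "(LINT x|lborel. mg u p x $ j * of_real (\<phi> x))
    = (LINT x|lborel. \<i> * (p x $ j * of_real (\<phi> x)) + of_real (A x $ j) * u x * of_real (\<phi> x))"
    by (simp add: mg_def distrib_right mult.assoc)
  also have "\<dots> = \<i> * (LINT x|lborel. p x $ j * of_real (\<phi> x)) + (LINT x|lborel. of_real (A x $ j) * u x * of_real (\<phi> x))"
    by (simp only: Bochner_Integration.integral_add[OF i2 i1] integral_mult_right_zero)
  finally show "- \<i> * (LINT x|lborel. u x * of_real (pderiv_at j \<phi> x))
       + (LINT x|lborel. of_real (A x $ j) * u x * of_real (\<phi> x))
     = (LINT x|lborel. mg u p x $ j * of_real (\<phi> x))"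
    by (simp add: has_weak_gradD[OF Sigma_pairD(3)[OF assms] \<phi>])
qed

lemma Sigma_pair_imp_Sigma_space:
  assumes "Sigma_pair u p"
  shows "u \<in> Sigma_space A V"
  using Sigma_pairD(1,4)[OF assms] mg_L2[OF assms] mg_has_mag_grad[OF assms]
  unfolding Sigma_space_def H1A_def by blast

lemma mag_grad_props:
  assumes "u \<in> Sigma_space A V"
  shows "in_Lp 2 (mag_grad A u)" "has_mag_grad A u (mag_grad A u)"
proof -
  have "\<exists>g. in_Lp 2 g \<and> has_mag_grad A u g"
    using assms unfolding Sigma_space_def H1A_def by blast
  from someI_ex[OF this] show "in_Lp 2 (mag_grad A u)" "has_mag_grad A u (mag_grad A u)"
    unfolding mag_grad_def by (rule conjunct1, rule conjunct2)
qed

lemma mag_grad_AE_eq: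
  assumes "Sigma_pair u p"
  shows "AE x in lborel. mag_grad A u x = mg u p x"
  using mag_grad_props[OF Sigma_pair_imp_Sigma_space[OF assms]] mg_L2[OF assms] mg_has_mag_grad[OF assms]
  by (intro has_mag_grad_unique)

text \<open>Since \<open>A u\<close> is in L2, the magnetic gradient can be solved for the plain
  one: \<open>p\<close> is \<open>- \<i>\<close> times the difference of \<open>mag_grad A u\<close>
  and \<open>A u\<close>.\<close>

lemma Sigma_space_imp_Sigma_pair:
  assumes "u \<in> Sigma_space A V"
  obtains p where "Sigma_pair u p"
proof -
  let ?g = "mag_grad A u"
  have u: "in_Lp 2 u" and Vu: "integrable lborel (\<lambda>x. V x * (cmod (u x))\<^sup>2)"
    using assms unfolding Sigma_space_def H1A_def by blast+
  note [measurable] = in_Lp_measurable[OF u] in_Lp_measurable[OF mag_grad_props(1)[OF assms]]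
  have Au: "in_Lp 2 (\<lambda>x. \<chi> j. of_real (A x $ j) * u x)"
    by (rule A_mult_L2[OF in_Lp_measurable[OF u] Vu])
  define d where "d x = ?g x + (- 1) *\<^sub>R (\<chi> j. of_real (A x $ j) * u x)" for x
  have d: "in_Lp 2 d"
    unfolding d_def[abs_def] by (rule in_Lp_2_add[OF mag_grad_props(1)[OF assms] in_Lp_2_scaleR[OF Au]])
  note [measurable] = in_Lp_measurable[OF d]
  define p where "p x = - (\<chi> j. \<i> * d x $ j)" for x
  have "p \<in> borel_measurable borel"
    unfolding p_def[abs_def] by (intro borel_measurable_uminus borel_measurable_vec_lambda) measurable
  then have p: "in_Lp 2 p"
    using d by (simp add: in_Lp_2_iff p_def norm_ii_mult)
  have "has_weak_grad u p"
    unfolding has_weak_grad_def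
  proof (intro allI impI)
    fix \<phi> j assume \<phi>: "test_function \<phi>"
    have i1: "integrable lborel (\<lambda>x. ?g x $ j * of_real (\<phi> x))"
      by (intro in_Lp_2_test_integrable in_Lp_2_component mag_grad_props(1) assms \<phi>)
    have i2: "integrable lborel (\<lambda>x. of_real (A x $ j) * u x * of_real (\<phi> x))"
      using in_Lp_2_test_integrable[OF in_Lp_2_component[OF Au, of j] \<phi>] by simp
    have "(LINT x|lborel. p x $ j * of_real (\<phi> x))
      = (LINT x|lborel. - \<i> * (?g x $ j * of_real (\<phi> x) - of_real (A x $ j) * u x * of_real (\<phi> x)))"
      by (simp add: p_def d_def algebra_simps)
    also have "\<dots> = - \<i> * ((LINT x|lborel. ?g x $ j * of_real (\<phi> x)) - (LINT x|lborel. of_real (A x $ j) * u x * of_real (\<phi> x)))"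
      by (simp only: integral_mult_right_zero Bochner_Integration.integral_diff[OF i1 i2])
    also have "\<dots> = - (LINT x|lborel. u x * of_real (pderiv_at j \<phi> x))"
      unfolding has_mag_gradD[OF mag_grad_props(2)[OF assms] \<phi>, of j, symmetric] by (simp add: algebra_simps)
    finally show "(LINT x|lborel. u x * of_real (pderiv_at j \<phi> x)) = - (LINT x|lborel. p x $ j * of_real (\<phi> x))"
      by simp
  qed
  with u p Vu have "Sigma_pair u p"
    unfolding Sigma_pair_def by blast
  then show ?thesis by (rule that)
qed

lemma Sigma_sq_eq:
  assumes "Sigma_pair u p"
  shows "Sigma_sq A V u = (LINT x|lborel. (norm (mg u p x))\<^sup>2 + V x * (cmod (u x))\<^sup>2)"
  unfolding Sigma_sq_def
proof (rule integral_cong_AE)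
  have g: "in_Lp 2 (mag_grad A u)"
    by (rule mag_grad_props(1)[OF Sigma_pair_imp_Sigma_space[OF assms]])
  note [measurable] = Sigma_pairD(5)[OF assms] in_Lp_measurable[OF g] in_Lp_measurable[OF mg_L2[OF assms]]
  show "(\<lambda>x. (norm (mag_grad A u x))\<^sup>2 + V x * (cmod (u x))\<^sup>2) \<in> borel_measurable lborel"
    "(\<lambda>x. (norm (mg u p x))\<^sup>2 + V x * (cmod (u x))\<^sup>2) \<in> borel_measurable lborel"
    by measurable
  show "AE x in lborel. (norm (mag_grad A u x))\<^sup>2 + V x * (cmod (u x))\<^sup>2 = (norm (mg u p x))\<^sup>2 + V x * (cmod (u x))\<^sup>2"
    using mag_grad_AE_eq[OF assms] by eventually_elim simp
qed

lemma Sigma_pair_scaleR: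
  assumes "Sigma_pair u p"
  shows "Sigma_pair (\<lambda>x. a *\<^sub>R u x) (\<lambda>x. a *\<^sub>R p x)"
proof -
  have "integrable lborel (\<lambda>x. a\<^sup>2 * (V x * (cmod (u x))\<^sup>2))"
    by (intro integrable_mult_right Sigma_pairD(4)[OF assms])
  then have "integrable lborel (\<lambda>x. V x * (cmod (a *\<^sub>R u x))\<^sup>2)"
    by (simp add: power_mult_distrib mult.left_commute)
  then show ?thesis
    unfolding Sigma_pair_def
    by (intro conjI in_Lp_2_scaleR has_weak_grad_scaleR Sigma_pairD[OF assms])
qed

lemma Sigma_pair_add:
  assumes u: "Sigma_pair u p" and v: "Sigma_pair v q"
  shows "Sigma_pair (\<lambda>x. u x + v x) (\<lambda>x. p x + q x)"
proof -
  note [measurable] = Sigma_pairD(5)[OF u] Sigma_pairD(5)[OF v]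
  have le: "AE x in lborel. norm (V x * (cmod (u x + v x))\<^sup>2) \<le> norm (2 * (V x * (cmod (u x))\<^sup>2) + 2 * (V x * (cmod (v x))\<^sup>2))"
    using AE_nonzero
  proof eventually_elim
    case (elim x)
    have "(cmod (u x + v x))\<^sup>2 \<le> (cmod (u x) + cmod (v x))\<^sup>2"
      by (intro power_mono norm_triangle_ineq) simp
    also have "\<dots> \<le> 2 * (cmod (u x))\<^sup>2 + 2 * (cmod (v x))\<^sup>2"
      using sum_squares_bound[of "cmod (u x)" "cmod (v x)"] by (simp add: power2_sum)
    finally have "V x * (cmod (u x + v x))\<^sup>2 \<le> V x * (2 * (cmod (u x))\<^sup>2 + 2 * (cmod (v x))\<^sup>2)"
      using V_pos[OF elim] by (intro mult_left_mono) simp_all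
    then show ?case
      using V_pos[OF elim] by (simp add: distrib_left abs_of_nonneg)
  qed
  have "integrable lborel (\<lambda>x. 2 * (V x * (cmod (u x))\<^sup>2) + 2 * (V x * (cmod (v x))\<^sup>2))"
    by (intro Bochner_Integration.integrable_add integrable_mult_right Sigma_pairD(4)[OF u] Sigma_pairD(4)[OF v])
  then have "integrable lborel (\<lambda>x. V x * (cmod (u x + v x))\<^sup>2)"
    by (rule Bochner_Integration.integrable_bound[OF _ _ le]) measurable
  then show ?thesis
    unfolding Sigma_pair_def
    by (intro conjI in_Lp_2_add has_weak_grad_add Sigma_pairD[OF u] Sigma_pairD[OF v])
qed

lemma mg_add: "mg (\<lambda>x. u x + v x) (\<lambda>x. p x + q x) x = mg u p x + mg v q x"
  by (simp add: mg_def vec_eq_iff algebra_simps)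

lemma mg_scaleR: "mg (\<lambda>x. a *\<^sub>R u x) (\<lambda>x. a *\<^sub>R p x) x = a *\<^sub>R mg u p x"
  by (simp add: mg_def vec_eq_iff scaleR_add_right)

end

subsection \<open>Radial derivatives of the potentials\<close>

lemma has_derivative_inner_grad:
  fixes f :: "R3 \<Rightarrow> real"
  assumes "f differentiable (at x)"
  shows "(f has_derivative (\<lambda>v. v \<bullet> grad f x)) (at x)"
proof -
  let ?D = "frechet_derivative f (at x)"
  have d: "(f has_derivative ?D) (at x)"
    using assms frechet_derivative_works by blast
  then interpret linear ?D by (rule has_derivative_linear)
  have eq: "?D v = v \<bullet> grad f x" for v
  proof -
    have "?D v = ?D (\<Sum>j\<in>UNIV. v $ j *\<^sub>R axis j 1)"
      by (simp add: basis_expansion flip: scalar_mult_eq_scaleR)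
    then show ?thesis
      by (simp add: sum scale grad_def pderiv_at_def inner_vec_def)
  qed
  show ?thesis
    using d unfolding eq[abs_def] .
qed

text \<open>Expressing the derivative by the radial field at the point \<open>s x\<close> itself,
  divided by \<open>s\<close>, makes condition (a) applicable at every point of the ray.\<close>

lemma has_real_derivative_along_ray:
  fixes f :: "R3 \<Rightarrow> real"
  assumes "f differentiable (at (s *\<^sub>R x))" "s \<noteq> 0"
  shows "((\<lambda>s. f (s *\<^sub>R x)) has_real_derivative ((s *\<^sub>R x) \<bullet> grad f (s *\<^sub>R x)) / s) (at s)"
proof -
  have "((\<lambda>s. s *\<^sub>R x) has_derivative (\<lambda>h. h *\<^sub>R x)) (at s)"
    by (auto intro!: derivative_eq_intros)
  from has_derivative_compose[OF this has_derivative_inner_grad[OF assms(1)]]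
  have d: "((\<lambda>s. f (s *\<^sub>R x)) has_derivative (\<lambda>h. (h *\<^sub>R x) \<bullet> grad f (s *\<^sub>R x))) (at s)" .
  have "(\<lambda>h. (h *\<^sub>R x) \<bullet> grad f (s *\<^sub>R x)) = (*) (((s *\<^sub>R x) \<bullet> grad f (s *\<^sub>R x)) / s)"
    by (rule ext) (use assms(2) in simp)
  with d show ?thesis
    unfolding has_field_derivative_def by (simp only:)
qed

text \<open>The dilated energy reads the potentials at \<open>y / t\<close>, and the minus sign is
  the derivative of \<open>1 / t\<close> at 1. A sequence of values
  \<open>t = 1 + 1 / (n + 1)\<close> is taken because dominated convergence and limits of measurable
  functions are used in sequential form.\<close>

lemma inverse_ray_tendsto:
  assumes d: "((\<lambda>s. f s) has_real_derivative D) (at (1::real))"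
  shows "(\<lambda>n. (f (1 / (1 + 1 / real (Suc n))) - f 1) / (1 / real (Suc n))) \<longlonglongrightarrow> - D"
proof -
  have "((\<lambda>t. 1 / t) has_real_derivative - 1) (at (1::real))"
    by (auto intro!: derivative_eq_intros)
  then have "((\<lambda>t. f (1 / t)) has_real_derivative D * - 1) (at 1)"
    using d by (intro DERIV_chain2[where f = f and g = "\<lambda>t. 1 / t"]) auto
  then have "((\<lambda>h. (f (1 / (1 + h)) - f 1) / h) \<longlongrightarrow> - D) (at 0)"
    by (simp add: DERIV_def)
  moreover have "filterlim (\<lambda>n. 1 / real (Suc n)) (at 0) sequentially"
    by (rule filterlim_atI[OF LIMSEQ_Suc[OF lim_1_over_n]]) simp
  ultimately show ?thesis
    by (rule filterlim_compose)
qed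

locale pohozaev_pair = magnetic_pair +
  fixes M \<epsilon>\<^sub>0 \<alpha>\<^sub>0 :: real
  assumes V_at_infinity: "filterlim V at_top at_infinity"
    and A_differentiable: "x \<noteq> 0 \<Longrightarrow> A differentiable (at x)"
    and V_differentiable: "x \<noteq> 0 \<Longrightarrow> V differentiable (at x)"
    and M_bound: "x \<noteq> 0 \<Longrightarrow> \<bar>x \<bullet> grad V x\<bar>
        + (\<Sum>j\<in>UNIV. (norm x)\<^sup>2 * (norm (grad (\<lambda>y. A y $ j) x))\<^sup>2) \<le> M * V x"
    and \<epsilon>\<^sub>0: "0 < \<epsilon>\<^sub>0" "\<epsilon>\<^sub>0 < 1/3"
    and \<alpha>\<^sub>0: "0 < \<alpha>\<^sub>0"
    and Ttilde_ge: "x \<noteq> 0 \<Longrightarrow> \<alpha>\<^sub>0 * V x \<le> Ttilde A V \<epsilon>\<^sub>0 x"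
begin

definition dV :: "R3 \<Rightarrow> real" where "dV x = x \<bullet> grad V x"

definition dA :: "R3 \<Rightarrow> R3" where "dA x = (\<chi> j. x \<bullet> grad (\<lambda>y. A y $ j) x)"

lemma M_nonneg: "M \<ge> 0"
proof -
  have "axis 1 1 \<noteq> (0 :: R3)" by (simp add: axis_eq_0_iff)
  note x = V_pos[OF this] M_bound[OF this]
  have "0 \<le> M * V (axis 1 1)"
    using x(2) by (rule order_trans[rotated]) (intro add_nonneg_nonneg sum_nonneg, simp_all)
  then show ?thesis
    using x(1) by (simp add: zero_le_mult_iff)
qed

lemma dV_le: "x \<noteq> 0 \<Longrightarrow> \<bar>dV x\<bar> \<le> M * V x"
proof -
  assume "x \<noteq> 0"
  have "0 \<le> (\<Sum>j\<in>UNIV. (norm x)\<^sup>2 * (norm (grad (\<lambda>y. A y $ j) x))\<^sup>2)"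
    by (intro sum_nonneg) simp
  then show ?thesis
    using M_bound[OF \<open>x \<noteq> 0\<close>] unfolding dV_def by linarith
qed

lemma dA_le:
  assumes "x \<noteq> 0"
  shows "(dA x $ j)\<^sup>2 \<le> M * V x"
proof -
  have "\<bar>x \<bullet> grad (\<lambda>y. A y $ j) x\<bar> \<le> norm x * norm (grad (\<lambda>y. A y $ j) x)"
    by (rule Cauchy_Schwarz_ineq2)
  then have "(dA x $ j)\<^sup>2 \<le> (norm x * norm (grad (\<lambda>y. A y $ j) x))\<^sup>2"
    using power_mono[of "\<bar>x \<bullet> grad (\<lambda>y. A y $ j) x\<bar>" _ 2] by (simp add: dA_def)
  also have "\<dots> \<le> (\<Sum>j\<in>UNIV. (norm x)\<^sup>2 * (norm (grad (\<lambda>y. A y $ j) x))\<^sup>2)"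
    using member_le_sum[of j UNIV "\<lambda>j. (norm x)\<^sup>2 * (norm (grad (\<lambda>y. A y $ j) x))\<^sup>2"]
    by (simp add: power_mult_distrib)
  also have "\<dots> \<le> M * V x"
    using M_bound[OF assms] by simp
  finally show ?thesis .
qed

lemma V_ray:
  assumes "x \<noteq> 0" "s > 0"
  shows "((\<lambda>s. V (s *\<^sub>R x)) has_real_derivative dV (s *\<^sub>R x) / s) (at s)"
proof -
  have "V differentiable (at (s *\<^sub>R x))"
    using assms by (intro V_differentiable) simp
  from has_real_derivative_along_ray[OF this] show ?thesis
    using assms by (simp add: dV_def)
qed

lemma A_ray:
  assumes "x \<noteq> 0" "s > 0"
  shows "((\<lambda>s. A (s *\<^sub>R x) $ j) has_real_derivative dA (s *\<^sub>R x) $ j / s) (at s)"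
proof -
  have "(\<lambda>y. A y $ j) differentiable (at (s *\<^sub>R x))"
    using A_differentiable[of "s *\<^sub>R x"] assms bounded_linear.has_derivative[OF bounded_linear_vec_nth, of A _ _ j]
    unfolding differentiable_def by force
  from has_real_derivative_along_ray[OF this] show ?thesis
    using assms by (simp add: dA_def)
qed

text \<open>One constant for three estimates: \<open>exp M\<close> bounds \<open>V\<close> along
  rays, \<open>2 M exp M\<close> its increments, and \<open>12 M exp M\<close>, from three
  components and \<open>1 / z^2 \<le> 4\<close>, the squared increments of \<open>A\<close>.\<close>

definition K :: real where "K = 12 * (M + 1) * exp M"

lemma K_ge: "exp M \<le> K" "2 * M * exp M \<le> K" "12 * M * exp M \<le> K" "K > 0"
proof -
  have "1 * exp M \<le> 12 * (M + 1) * exp M" "2 * M * exp M \<le> 12 * (M + 1) * exp M" "12 * M * exp M \<le> 12 * (M + 1) * exp M"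
    using M_nonneg by (intro mult_right_mono; simp)+
  then show "exp M \<le> K" "2 * M * exp M \<le> K" "12 * M * exp M \<le> K"
    by (simp_all add: K_def)
  show "K > 0" using M_nonneg by (simp add: K_def)
qed

text \<open>Gronwall's argument: on [1/2, 1] the logarithmic derivative of
  \<open>s \<mapsto> V (s x)\<close> is at least \<open>- M / s \<ge> - 2 M\<close>, so
  multiplication by \<open>exp (2 M s)\<close> gives a nondecreasing function.\<close>

lemma V_ray_le_exp:
  assumes x: "x \<noteq> 0" and s: "1/2 \<le> s" "s \<le> 1"
  shows "V (s *\<^sub>R x) \<le> exp M * V x"
proof -
  have "V (s *\<^sub>R x) * exp (2 * M * s) \<le> V (1 *\<^sub>R x) * exp (2 * M * 1)"
  proof (rule DERIV_nonneg_imp_nondecreasing[OF s(2)])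
    fix z assume z: "s \<le> z" "z \<le> 1"
    then have z0: "z > 0" using s by simp
    have d: "((\<lambda>s. V (s *\<^sub>R x) * exp (2 * M * s)) has_real_derivative
        dV (z *\<^sub>R x) / z * exp (2 * M * z) + (exp (2 * M * z) * (2 * M)) * V (z *\<^sub>R x)) (at z)"
      by (intro DERIV_mult V_ray x z0) (auto intro!: derivative_eq_intros)
    have zx: "z *\<^sub>R x \<noteq> 0" using x z0 by simp
    have "- (M * V (z *\<^sub>R x)) \<le> dV (z *\<^sub>R x)"
      using dV_le[OF zx] by simp
    moreover have "M * V (z *\<^sub>R x) \<le> z * (2 * M * V (z *\<^sub>R x))"
      using mult_right_mono[of "1/2" z "2 * M * V (z *\<^sub>R x)"] M_nonneg V_pos[OF zx] z s by simp
    ultimately have "- (2 * M * V (z *\<^sub>R x)) \<le> dV (z *\<^sub>R x) / z"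
      using z0 by (simp add: pos_le_divide_eq mult.commute)
    then have "0 \<le> (dV (z *\<^sub>R x) / z + 2 * M * V (z *\<^sub>R x)) * exp (2 * M * z)"
      by (intro mult_nonneg_nonneg) simp_all
    then show "\<exists>y. ((\<lambda>s. V (s *\<^sub>R x) * exp (2 * M * s)) has_real_derivative y) (at z) \<and> 0 \<le> y"
      using d by (intro exI conjI) (auto simp: algebra_simps)
  qed
  then have "V (s *\<^sub>R x) \<le> V x * (exp (2 * M) / exp (2 * M * s))"
    by (simp add: pos_le_divide_eq)
  also have "exp (2 * M) / exp (2 * M * s) = exp (M * (2 - 2 * s))"
    by (simp add: exp_diff[symmetric] algebra_simps)
  also have "V x * exp (M * (2 - 2 * s)) \<le> V x * exp M"
    using s M_nonneg V_pos[OF x] mult_left_mono[of "2 - 2 * s" 1 M] by (intro mult_left_mono) auto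
  finally show ?thesis by (simp add: mult.commute)
qed

lemma V_ray_le:
  assumes "x \<noteq> 0" "1/2 \<le> s" "s \<le> 1"
  shows "V (s *\<^sub>R x) \<le> K * V x"
proof (rule order_trans[OF V_ray_le_exp[OF assms]])
  show "exp M * V x \<le> K * V x"
    using K_ge(1) V_pos[OF assms(1)] by (intro mult_right_mono) simp_all
qed

lemma V_ray_diff_le:
  assumes x: "x \<noteq> 0" and s: "1/2 \<le> s" "s < 1"
  shows "\<bar>V (s *\<^sub>R x) - V x\<bar> \<le> (1 - s) * (K * V x)"
proof -
  obtain z where z: "s < z" "z < 1" "V (1 *\<^sub>R x) - V (s *\<^sub>R x) = (1 - s) * (dV (z *\<^sub>R x) / z)"
    using MVT2[OF s(2), of "\<lambda>s. V (s *\<^sub>R x)" "\<lambda>z. dV (z *\<^sub>R x) / z"] V_ray[OF x] s by force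
  have z0: "z > 0" and zx: "z *\<^sub>R x \<noteq> 0" using z s x by auto
  have "\<bar>dV (z *\<^sub>R x) / z\<bar> \<le> M * V (z *\<^sub>R x) / (1/2)"
    unfolding abs_divide using dV_le[OF zx] z s M_nonneg V_pos[OF zx] by (intro frac_le) auto
  also have "\<dots> \<le> 2 * M * (exp M * V x)"
    using V_ray_le_exp[OF x, of z] z s M_nonneg by (simp add: mult_left_mono)
  also have "\<dots> \<le> K * V x"
    using mult_right_mono[OF K_ge(2), of "V x"] V_pos[OF x] by (simp add: mult.assoc)
  finally have "\<bar>dV (z *\<^sub>R x) / z\<bar> \<le> K * V x" .
  then have "\<bar>V (1 *\<^sub>R x) - V (s *\<^sub>R x)\<bar> \<le> (1 - s) * (K * V x)"
    unfolding z(3) abs_mult[of "1 - s"] using s by (intro mult_mono) simp_all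
  then show ?thesis by (simp add: abs_minus_commute)
qed

text \<open>The mean value theorem is applied to each component, with its own intermediate point.
  Condition (a) bounds the squared radial derivatives by \<open>M V\<close>, so the estimate is
  quadratic, as \<open>A\<close> is in the energy.\<close>

lemma A_ray_diff_le:
  assumes x: "x \<noteq> 0" and s: "1/2 \<le> s" "s < 1"
  shows "(norm (A (s *\<^sub>R x) - A x))\<^sup>2 \<le> (1 - s)\<^sup>2 * (K * V x)"
proof -
  have comp: "(A (s *\<^sub>R x) $ j - A x $ j)\<^sup>2 \<le> (1 - s)\<^sup>2 * (4 * M * exp M * V x)" for j
  proof -
    obtain z where z: "s < z" "z < 1" "A (1 *\<^sub>R x) $ j - A (s *\<^sub>R x) $ j = (1 - s) * (dA (z *\<^sub>R x) $ j / z)"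
      using MVT2[OF s(2), of "\<lambda>s. A (s *\<^sub>R x) $ j" "\<lambda>z. dA (z *\<^sub>R x) $ j / z"] A_ray[OF x] s by force
    have z0: "z > 0" and zx: "z *\<^sub>R x \<noteq> 0" using z s x by auto
    have "(1/2)\<^sup>2 \<le> z\<^sup>2" using z s by (intro power_mono) auto
    then have "(dA (z *\<^sub>R x) $ j / z)\<^sup>2 \<le> M * V (z *\<^sub>R x) / (1/2)\<^sup>2"
      unfolding power_divide using dA_le[OF zx, of j] M_nonneg V_pos[OF zx]
      by (intro frac_le) auto
    also have "\<dots> = 4 * M * V (z *\<^sub>R x)" by (simp add: power2_eq_square)
    also have "\<dots> \<le> 4 * M * (exp M * V x)"
      using V_ray_le_exp[OF x, of z] z s M_nonneg by (intro mult_left_mono) auto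
    finally have "(dA (z *\<^sub>R x) $ j / z)\<^sup>2 \<le> 4 * M * (exp M * V x)" .
    then have "(A (1 *\<^sub>R x) $ j - A (s *\<^sub>R x) $ j)\<^sup>2 \<le> (1 - s)\<^sup>2 * (4 * M * (exp M * V x))"
      unfolding z(3) power_mult_distrib by (intro mult_left_mono) auto
    then show ?thesis by (simp add: power2_commute mult.assoc)
  qed
  have "(norm (A (s *\<^sub>R x) - A x))\<^sup>2 = (\<Sum>j\<in>UNIV. (A (s *\<^sub>R x) $ j - A x $ j)\<^sup>2)"
    by (simp add: norm_vec_power2)
  also have "\<dots> \<le> (\<Sum>j\<in>(UNIV :: 3 set). (1 - s)\<^sup>2 * (4 * M * exp M * V x))"
    by (intro sum_mono comp)
  also have "\<dots> = (1 - s)\<^sup>2 * (12 * M * exp M * V x)"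
    by simp
  also have "\<dots> \<le> (1 - s)\<^sup>2 * (K * V x)"
    using V_pos[OF x] K_ge(3) by (intro mult_left_mono mult_right_mono) auto
  finally show ?thesis .
qed

lemma V_inverse_ray_tendsto:
  assumes "x \<noteq> 0"
  shows "(\<lambda>n. (V ((1 / (1 + 1 / real (Suc n))) *\<^sub>R x) - V x) / (1 / real (Suc n))) \<longlonglongrightarrow> - dV x"
  using inverse_ray_tendsto[where f = "\<lambda>s. V (s *\<^sub>R x)", OF V_ray[OF assms zero_less_one]]
  unfolding scaleR_one div_by_1 .

lemma A_inverse_ray_tendsto:
  assumes "x \<noteq> 0"
  shows "(\<lambda>n. (A ((1 / (1 + 1 / real (Suc n))) *\<^sub>R x) $ j - A x $ j) / (1 / real (Suc n))) \<longlonglongrightarrow> - dA x $ j"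
  using inverse_ray_tendsto[where f = "\<lambda>s. A (s *\<^sub>R x) $ j", OF A_ray[OF assms zero_less_one]]
  unfolding scaleR_one div_by_1 .

end

subsection \<open>Dilations\<close>

lemma
  fixes F :: "R3 \<Rightarrow> real"
  assumes [measurable]: "F \<in> borel_measurable borel" and t: "t > 0"
  shows integral_dilation: "(LINT x|lborel. t ^ 3 * F (t *\<^sub>R x)) = (LINT x|lborel. F x)"
    and integrable_dilation_iff: "integrable lborel (\<lambda>x. t ^ 3 * F (t *\<^sub>R x)) \<longleftrightarrow> integrable lborel F"
  using integral_lborel_affine[of F t 0] integrable_lborel_affine_iff[of F t 0] t by auto

lemma integral_Cauchy_Schwarz:
  fixes f g :: "'a \<Rightarrow> real"
  assumes [measurable]: "f \<in> borel_measurable M" "g \<in> borel_measurable M"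
    and f: "integrable M (\<lambda>x. (f x)\<^sup>2)" and g: "integrable M (\<lambda>x. (g x)\<^sup>2)"
  shows "(LINT x|M. \<bar>f x * g x\<bar>) \<le> sqrt (LINT x|M. (f x)\<^sup>2) * sqrt (LINT x|M. (g x)\<^sup>2)"
proof -
  have "integrable M (\<lambda>x. complex_of_real (f x) * of_real (g x))"
    using f g by (intro integrable_mult_of_squares) simp_all
  then have "integrable M (\<lambda>x. norm (complex_of_real (f x) * of_real (g x)))"
    by (rule integrable_norm)
  then have fg: "integrable M (\<lambda>x. \<bar>f x * g x\<bar>)"
    by (simp add: norm_mult abs_mult)
  have "(\<integral>\<^sup>+x. ennreal \<bar>f x\<bar> * ennreal \<bar>g x\<bar> \<partial>M)\<^sup>2 \<le> (\<integral>\<^sup>+x. (ennreal \<bar>f x\<bar>)\<^sup>2 \<partial>M) * (\<integral>\<^sup>+x. (ennreal \<bar>g x\<bar>)\<^sup>2 \<partial>M)"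
    by (rule Cauchy_Schwarz_nn_integral) measurable
  moreover have "(\<integral>\<^sup>+x. ennreal \<bar>f x\<bar> * ennreal \<bar>g x\<bar> \<partial>M) = ennreal (LINT x|M. \<bar>f x * g x\<bar>)"
    using fg by (subst nn_integral_eq_integral[symmetric]) (simp_all add: abs_mult ennreal_mult')
  moreover have "(\<integral>\<^sup>+x. (ennreal \<bar>f x\<bar>)\<^sup>2 \<partial>M) = ennreal (LINT x|M. (f x)\<^sup>2)"
    using f by (subst nn_integral_eq_integral[symmetric]) (simp_all add: ennreal_power)
  moreover have "(\<integral>\<^sup>+x. (ennreal \<bar>g x\<bar>)\<^sup>2 \<partial>M) = ennreal (LINT x|M. (g x)\<^sup>2)"
    using g by (subst nn_integral_eq_integral[symmetric]) (simp_all add: ennreal_power)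
  ultimately have "ennreal ((LINT x|M. \<bar>f x * g x\<bar>)\<^sup>2) \<le> ennreal ((LINT x|M. (f x)\<^sup>2) * (LINT x|M. (g x)\<^sup>2))"
    by (simp add: ennreal_power ennreal_mult')
  then have "(LINT x|M. \<bar>f x * g x\<bar>)\<^sup>2 \<le> (LINT x|M. (f x)\<^sup>2) * (LINT x|M. (g x)\<^sup>2)"
    by (subst (asm) ennreal_le_iff) (intro mult_nonneg_nonneg integral_nonneg_AE AE_I2, simp_all)
  then show ?thesis
    by (simp add: real_le_rsqrt flip: real_sqrt_mult)
qed

text \<open>The amplitude \<open>t powr (3/2)\<close> is written as a square root whose square is
  the Jacobian \<open>t ^ 3\<close>.\<close>

definition dilate :: "real \<Rightarrow> (R3 \<Rightarrow> 'b :: real_normed_vector) \<Rightarrow> R3 \<Rightarrow> 'b" where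
  "dilate t f x = sqrt (t ^ 3) *\<^sub>R f (t *\<^sub>R x)"

lemma norm_dilate_power2: "t \<ge> 0 \<Longrightarrow> (norm (dilate t f x))\<^sup>2 = t ^ 3 * (norm (f (t *\<^sub>R x)))\<^sup>2"
  by (simp add: dilate_def power_mult_distrib)

lemma norm_dilate_power4: "t \<ge> 0 \<Longrightarrow> norm (dilate t f x) ^ 4 = t ^ 3 * (t ^ 3 * norm (f (t *\<^sub>R x)) ^ 4)"
proof -
  assume "t \<ge> 0"
  have "norm (dilate t f x) ^ 4 = ((norm (dilate t f x))\<^sup>2)\<^sup>2"
    by (simp flip: power_mult)
  also have "\<dots> = t ^ 3 * (t ^ 3 * norm (f (t *\<^sub>R x)) ^ 4)"
    unfolding norm_dilate_power2[OF \<open>t \<ge> 0\<close>] by (simp add: power2_eq_square power4_eq_xxxx mult_ac)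
  finally show ?thesis .
qed

lemma dilate_measurable:
  fixes f :: "R3 \<Rightarrow> 'b :: {real_normed_vector, second_countable_topology}"
  assumes [measurable]: "f \<in> borel_measurable borel"
  shows "dilate t f \<in> borel_measurable borel"
  unfolding dilate_def[abs_def] by measurable

lemma sqrt_cube_bounds:
  assumes "1 \<le> t" "t \<le> 2"
  shows "1 \<le> sqrt (t ^ 3)" "sqrt (t ^ 3) - 1 \<le> 3 * (t - 1)" "sqrt (t ^ 3) \<le> 3" "t ^ 3 \<le> 8"
proof -
  show "1 \<le> sqrt (t ^ 3)" using assms by simp
  \<comment> \<open>\<open>t ^ 3 \<le> t ^ 4\<close> replaces the root by \<open>t^2\<close>, and
    \<open>t^2 - 1 = (t - 1) (t + 1)\<close>.\<close>
  have "t ^ 3 \<le> t ^ 4" using assms by (intro power_increasing) auto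
  then have "t ^ 3 \<le> (t\<^sup>2)\<^sup>2" by (simp flip: power_mult)
  then have "sqrt (t ^ 3) \<le> sqrt ((t\<^sup>2)\<^sup>2)" by (rule real_sqrt_le_mono)
  then have "sqrt (t ^ 3) \<le> t\<^sup>2" unfolding real_sqrt_abs by simp
  moreover have "t\<^sup>2 - 1 \<le> 3 * (t - 1)"
    using mult_nonneg_nonneg[of "t - 1" "2 - t"] assms by (simp add: power2_eq_square algebra_simps)
  ultimately show "sqrt (t ^ 3) - 1 \<le> 3 * (t - 1)" by simp
  show "t ^ 3 \<le> 8" using power_mono[of t 2 3] assms by simp
  then have "sqrt (t ^ 3) \<le> sqrt (3\<^sup>2)" by (intro real_sqrt_le_mono) simp
  then show "sqrt (t ^ 3) \<le> 3" by simp
qed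

lemma nn_integral_linear_combination:
  "f \<in> borel_measurable M \<Longrightarrow> g \<in> borel_measurable M \<Longrightarrow>
    (\<integral>\<^sup>+x. a * f x + b * g x \<partial>M) = a * (\<integral>\<^sup>+x. f x \<partial>M) + b * (\<integral>\<^sup>+x. g x \<partial>M)"
  by (simp add: nn_integral_add nn_integral_cmult)

text \<open>The difference splits into \<open>sqrt (t ^ 3) (u (t x) - u x)\<close> and
  \<open>(sqrt (t ^ 3) - 1) u x\<close>. On the ball the dilation displaces points by at most
  \<open>(t - 1) R\<close>, so the weak gradient makes the first part O(t - 1) in L2; the scalar in
  the second is at most \<open>3 (t - 1)\<close>.\<close>

lemma dilation_local_estimate:
  assumes u: "in_Lp 2 u" and p: "in_Lp 2 p" and grad: "has_weak_grad u p" and R: "R \<ge> 0"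
  obtains C where "C \<ge> 0" "\<And>t. 1 \<le> t \<Longrightarrow> t \<le> 2 \<Longrightarrow>
    (LINT x|lborel. indicator (cball 0 R) x * (cmod (dilate t u x + (- 1) *\<^sub>R u x))\<^sup>2) \<le> C * (t - 1)\<^sup>2"
proof -
  have u_meas [measurable]: "u \<in> borel_measurable borel" using u by (rule in_Lp_measurable)
  have iu: "integrable lborel (\<lambda>x. (cmod (u x))\<^sup>2)" and ip: "integrable lborel (\<lambda>x. (norm (p x))\<^sup>2)"
    using u p by (auto simp: in_Lp_2_iff)
  have [measurable]: "cball (0 :: R3) R \<in> sets borel" by simp
  define P where "P = (LINT x|lborel. (norm (p x))\<^sup>2)"
  define U where "U = (LINT x|lborel. (cmod (u x))\<^sup>2)"
  have PU: "P \<ge> 0" "U \<ge> 0" unfolding P_def U_def by (intro integral_nonneg_AE; simp)+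
  show ?thesis
  proof (rule that)
    \<comment> \<open>16 is twice the bound 8 for \<open>t ^ 3\<close>, and 18 is twice the square
      of 3; the factor 2 comes from squaring a sum.\<close>
    show "0 \<le> 16 * R\<^sup>2 * P + 18 * U" using PU by simp
    fix t :: real assume t: "1 \<le> t" "t \<le> 2"
    note [measurable] = dilate_measurable[OF u_meas, of t]
    have disp: "(\<integral>\<^sup>+x. indicator (cball 0 R) x * ennreal ((norm (u (x + ((t - 1) *\<^sub>R x + 0)) - u x))\<^sup>2) \<partial>lborel)
      \<le> ennreal (((t - 1) * R)\<^sup>2) * (\<integral>\<^sup>+x. ennreal ((norm (p x))\<^sup>2) \<partial>lborel)"
      using t by (intro weak_grad_displacement[OF u p grad]) (auto intro: mult_left_mono)
    have pt: "ennreal (indicator (cball 0 R) x * (cmod (dilate t u x + (- 1) *\<^sub>R u x))\<^sup>2)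
      \<le> ennreal 16 * (indicator (cball 0 R) x * ennreal ((norm (u (x + ((t - 1) *\<^sub>R x + 0)) - u x))\<^sup>2))
        + ennreal (18 * (t - 1)\<^sup>2) * ennreal ((cmod (u x))\<^sup>2)" for x
    proof (cases "x \<in> cball 0 R")
      case True
      have "dilate t u x + (- 1) *\<^sub>R u x = sqrt (t ^ 3) *\<^sub>R (u (t *\<^sub>R x) - u x) + (sqrt (t ^ 3) - 1) *\<^sub>R u x"
        by (simp add: dilate_def algebra_simps)
      then have "(cmod (dilate t u x + (- 1) *\<^sub>R u x))\<^sup>2
        \<le> (norm (sqrt (t ^ 3) *\<^sub>R (u (t *\<^sub>R x) - u x)) + norm ((sqrt (t ^ 3) - 1) *\<^sub>R u x))\<^sup>2"
        by (simp only:) (intro power_mono norm_triangle_ineq norm_ge_zero)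
      also have "\<dots> \<le> 2 * (norm (sqrt (t ^ 3) *\<^sub>R (u (t *\<^sub>R x) - u x)))\<^sup>2 + 2 * (norm ((sqrt (t ^ 3) - 1) *\<^sub>R u x))\<^sup>2"
        using sum_squares_bound[of "norm (sqrt (t ^ 3) *\<^sub>R (u (t *\<^sub>R x) - u x))" "norm ((sqrt (t ^ 3) - 1) *\<^sub>R u x)"]
        unfolding power2_sum by linarith
      also have "\<dots> = 2 * (t ^ 3 * (cmod (u (t *\<^sub>R x) - u x))\<^sup>2) + 2 * ((sqrt (t ^ 3) - 1)\<^sup>2 * (cmod (u x))\<^sup>2)"
        using t by (simp add: power_mult_distrib)
      also have "\<dots> \<le> 2 * (8 * (cmod (u (t *\<^sub>R x) - u x))\<^sup>2) + 2 * ((3 * (t - 1))\<^sup>2 * (cmod (u x))\<^sup>2)"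
        using sqrt_cube_bounds[OF t] by (intro add_mono mult_left_mono mult_right_mono power_mono) auto
      also have "\<dots> = 16 * (cmod (u (t *\<^sub>R x) - u x))\<^sup>2 + 18 * (t - 1)\<^sup>2 * (cmod (u x))\<^sup>2"
        unfolding power_mult_distrib by simp
      finally have "ennreal ((cmod (dilate t u x + (- 1) *\<^sub>R u x))\<^sup>2)
        \<le> ennreal (16 * (cmod (u (t *\<^sub>R x) - u x))\<^sup>2 + 18 * (t - 1)\<^sup>2 * (cmod (u x))\<^sup>2)"
        by (rule ennreal_leI)
      also have "\<dots> = ennreal 16 * ennreal ((cmod (u (t *\<^sub>R x) - u x))\<^sup>2) + ennreal (18 * (t - 1)\<^sup>2) * ennreal ((cmod (u x))\<^sup>2)"
        by (subst ennreal_plus) (simp_all add: ennreal_mult')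
      also have "t *\<^sub>R x = x + ((t - 1) *\<^sub>R x + 0)" by (simp add: algebra_simps)
      finally show ?thesis using True by simp
    qed simp
    have "(\<integral>\<^sup>+x. ennreal (indicator (cball 0 R) x * (cmod (dilate t u x + (- 1) *\<^sub>R u x))\<^sup>2) \<partial>lborel)
      \<le> (\<integral>\<^sup>+x. ennreal 16 * (indicator (cball 0 R) x * ennreal ((norm (u (x + ((t - 1) *\<^sub>R x + 0)) - u x))\<^sup>2))
        + ennreal (18 * (t - 1)\<^sup>2) * ennreal ((cmod (u x))\<^sup>2) \<partial>lborel)"
      by (intro nn_integral_mono pt)
    also have "\<dots> = ennreal 16 * (\<integral>\<^sup>+x. indicator (cball 0 R) x * ennreal ((norm (u (x + ((t - 1) *\<^sub>R x + 0)) - u x))\<^sup>2) \<partial>lborel)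
        + ennreal (18 * (t - 1)\<^sup>2) * (\<integral>\<^sup>+x. ennreal ((cmod (u x))\<^sup>2) \<partial>lborel)"
      by (rule nn_integral_linear_combination) measurable
    also have "\<dots> \<le> ennreal 16 * (ennreal (((t - 1) * R)\<^sup>2) * (\<integral>\<^sup>+x. ennreal ((norm (p x))\<^sup>2) \<partial>lborel))
        + ennreal (18 * (t - 1)\<^sup>2) * (\<integral>\<^sup>+x. ennreal ((cmod (u x))\<^sup>2) \<partial>lborel)"
      by (intro add_mono mult_left_mono disp order_refl) simp
    also have "\<dots> = ennreal 16 * (ennreal (((t - 1) * R)\<^sup>2) * ennreal P) + ennreal (18 * (t - 1)\<^sup>2) * ennreal U"
      unfolding P_def U_def using iu ip by (simp add: nn_integral_eq_integral)
    also have "\<dots> = ennreal ((16 * R\<^sup>2 * P + 18 * U) * (t - 1)\<^sup>2)"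
    proof -
      have "(16 * R\<^sup>2 * P + 18 * U) * (t - 1)\<^sup>2 = 16 * (((t - 1) * R)\<^sup>2 * P) + 18 * (t - 1)\<^sup>2 * U"
        unfolding power_mult_distrib distrib_right by simp
      then show ?thesis
        using PU by (simp only:) (subst ennreal_plus; simp add: ennreal_mult' ennreal_mult)
    qed
    finally have le: "(\<integral>\<^sup>+x. ennreal (indicator (cball 0 R) x * (cmod (dilate t u x + (- 1) *\<^sub>R u x))\<^sup>2) \<partial>lborel)
      \<le> ennreal ((16 * R\<^sup>2 * P + 18 * U) * (t - 1)\<^sup>2)" .
    have "(LINT x|lborel. indicator (cball 0 R) x * (cmod (dilate t u x + (- 1) *\<^sub>R u x))\<^sup>2)
      = enn2real (\<integral>\<^sup>+x. ennreal (indicator (cball 0 R) x * (cmod (dilate t u x + (- 1) *\<^sub>R u x))\<^sup>2) \<partial>lborel)"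
      by (rule integral_eq_nn_integral) simp_all
    also have "\<dots> \<le> (16 * R\<^sup>2 * P + 18 * U) * (t - 1)\<^sup>2"
      using PU by (intro enn2real_leI le) simp
    finally show "(LINT x|lborel. indicator (cball 0 R) x * (cmod (dilate t u x + (- 1) *\<^sub>R u x))\<^sup>2)
      \<le> (16 * R\<^sup>2 * P + 18 * U) * (t - 1)\<^sup>2" .
  qed
qed

text \<open>What is left after the linear term is of second order in \<open>w\<close>. It is
  weighted by \<open>|a|^2\<close> and \<open>|a + w|^2\<close>, later \<open>|u|^2\<close> and
  \<open>|u\<^sub>t|^2\<close>, because the large values of these two functions can be cut off
  uniformly in \<open>t\<close>; the term \<open>|w|^4\<close> is rewritten by
  \<open>|w| \<le> |a| + |a + w|\<close>.\<close>

lemma quartic_expansion_bound: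
  fixes a w :: "'a :: real_inner"
  shows "norm (a + w) ^ 4 - norm a ^ 4 - 4 * (norm a)\<^sup>2 * (a \<bullet> w)
    \<le> 16 * ((norm a)\<^sup>2 + (norm (a + w))\<^sup>2) * (norm w)\<^sup>2"
proof -
  define x y z where "x = norm a" "y = norm w" "z = a \<bullet> w"
  have nn: "x \<ge> 0" "y \<ge> 0" by (simp_all add: x_y_z_def)
  have z: "\<bar>z\<bar> \<le> x * y"
    unfolding x_y_z_def by (rule Cauchy_Schwarz_ineq2)
  have s: "(norm (a + w))\<^sup>2 = x\<^sup>2 + 2 * z + y\<^sup>2"
    unfolding x_y_z_def power2_norm_eq_inner by (simp add: inner_add inner_commute)
  have s4: "norm (a + w) ^ 4 = (x\<^sup>2 + 2 * z + y\<^sup>2)\<^sup>2"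
    unfolding s[symmetric] by (simp flip: power_mult)
  have z2: "z\<^sup>2 \<le> x\<^sup>2 * y\<^sup>2"
    using power_mono[OF z, of 2] by (simp add: power_mult_distrib)
  have zy: "4 * z * y\<^sup>2 \<le> 2 * (x\<^sup>2 * y\<^sup>2) + 2 * y ^ 4"
  proof -
    have "z \<le> x * y" using z by simp
    moreover have "2 * (x * y) \<le> x\<^sup>2 + y\<^sup>2" using sum_squares_bound[of x y] by simp
    ultimately have "4 * z \<le> 2 * x\<^sup>2 + 2 * y\<^sup>2" by simp
    from mult_right_mono[OF this, of "y\<^sup>2"] show ?thesis
      by (simp add: algebra_simps power2_eq_square power4_eq_xxxx)
  qed
  have "norm (a + w) ^ 4 - x ^ 4 - 4 * x\<^sup>2 * z = 4 * z\<^sup>2 + y ^ 4 + 2 * (x\<^sup>2 * y\<^sup>2) + 4 * z * y\<^sup>2"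
    unfolding s4 by (simp add: power2_eq_square power4_eq_xxxx algebra_simps)
  also have "\<dots> \<le> 8 * (x\<^sup>2 * y\<^sup>2) + 3 * y ^ 4"
    using z2 zy by linarith
  also have "\<dots> \<le> 16 * (x\<^sup>2 + (norm (a + w))\<^sup>2) * y\<^sup>2"
  proof -
    have "y\<^sup>2 \<le> 2 * x\<^sup>2 + 2 * (norm (a + w))\<^sup>2"
    proof -
      have "y \<le> x + norm (a + w)"
        using norm_triangle_ineq4[of "a + w" a] by (simp add: x_y_z_def)
      then have "y\<^sup>2 \<le> (x + norm (a + w))\<^sup>2" using nn by (intro power_mono) auto
      then show ?thesis
        using sum_squares_bound[of x "norm (a + w)"] by (simp add: power2_sum)
    qed
    from mult_right_mono[OF this, of "y\<^sup>2"]
    have "y ^ 4 \<le> 2 * (x\<^sup>2 * y\<^sup>2) + 2 * ((norm (a + w))\<^sup>2 * y\<^sup>2)"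
      by (simp add: algebra_simps power2_eq_square power4_eq_xxxx)
    moreover have "0 \<le> x\<^sup>2 * y\<^sup>2" "0 \<le> (norm (a + w))\<^sup>2 * y\<^sup>2" by simp_all
    moreover have "16 * (x\<^sup>2 + (norm (a + w))\<^sup>2) * y\<^sup>2 = 16 * (x\<^sup>2 * y\<^sup>2) + 16 * ((norm (a + w))\<^sup>2 * y\<^sup>2)"
      by (simp add: distrib_left distrib_right)
    ultimately show ?thesis
      by linarith
  qed
  finally show ?thesis by (simp add: x_y_z_def)
qed

lemma integrable_inner_L2:
  fixes f g :: "R3 \<Rightarrow> 'b :: euclidean_space"
  assumes "in_Lp 2 f" "in_Lp 2 g"
  shows "integrable lborel (\<lambda>x. f x \<bullet> g x)"
proof -
  note [measurable] = in_Lp_measurable[OF assms(1)] in_Lp_measurable[OF assms(2)]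
  have "\<bar>f x \<bullet> g x\<bar> \<le> (norm (f x))\<^sup>2 + (norm (g x))\<^sup>2" for x
    using Cauchy_Schwarz_ineq2[of "f x" "g x"] sum_squares_bound[of "norm (f x)" "norm (g x)"]
      mult_nonneg_nonneg[OF norm_ge_zero[of "f x"] norm_ge_zero[of "g x"]]
    by linarith
  then have le: "AE x in lborel. norm (f x \<bullet> g x) \<le> norm ((norm (f x))\<^sup>2 + (norm (g x))\<^sup>2)"
    by (intro AE_I2) simp
  have "integrable lborel (\<lambda>x. (norm (f x))\<^sup>2 + (norm (g x))\<^sup>2)"
    using assms by (simp add: in_Lp_2_iff)
  then show ?thesis
    by (rule Bochner_Integration.integrable_bound[OF _ _ le]) measurable
qed

lemma cubic_term_bound:
  fixes a b :: real
  assumes "a \<ge> 0" "b \<ge> 0"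
  shows "a ^ 3 * b \<le> a ^ 4 + b ^ 4"
proof (cases "b \<le> a")
  case True
  then have "a ^ 3 * b \<le> a ^ 3 * a" using assms by (intro mult_left_mono) auto
  also have "\<dots> = a ^ 4" by (simp add: power3_eq_cube power4_eq_xxxx)
  finally show ?thesis using assms by (simp add: add_increasing2)
next
  case False
  then have "a ^ 3 * b \<le> b ^ 3 * b" using assms by (intro mult_right_mono power_mono) auto
  also have "\<dots> = b ^ 4" by (simp add: power3_eq_cube power4_eq_xxxx)
  finally show ?thesis using assms by (simp add: add_increasing)
qed

lemma inner_mag_mult: "(\<chi> j. (of_real (a $ j) * z :: complex)) \<bullet> (\<chi> j. of_real (b $ j) * z) = ((a :: R3) \<bullet> b) * (cmod z)\<^sup>2"
proof -
  have "(of_real (a $ j) * z) \<bullet> (of_real (b $ j) * z) = a $ j * b $ j * (cmod z)\<^sup>2" for j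
    unfolding scaleR_conv_of_real[symmetric] by (simp add: power2_norm_eq_inner)
  then show ?thesis
    by (simp add: inner_vec_def sum_distrib_right)
qed

subsection \<open>Energy of dilated functions\<close>

context pohozaev_pair
begin

definition En :: "(R3 \<Rightarrow> complex) \<Rightarrow> (R3 \<Rightarrow> complex ^ 3) \<Rightarrow> real" where
  "En u p = 1/2 * (LINT x|lborel. (norm (mg u p x))\<^sup>2 + V x * (cmod (u x))\<^sup>2) - 1/4 * (LINT x|lborel. cmod (u x) ^ 4)"

definition dilate_grad :: "real \<Rightarrow> (R3 \<Rightarrow> complex ^ 3) \<Rightarrow> R3 \<Rightarrow> complex ^ 3" where
  "dilate_grad t p x = sqrt (t ^ 3) *\<^sub>R (t *\<^sub>R p (t *\<^sub>R x))"

text \<open>The magnetic gradient of a dilated function in the coordinates \<open>y = t x\<close>,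
  up to the amplitude: \<open>t\<close> has moved to a factor of \<open>p\<close> and into the
  argument of \<open>A\<close>.\<close>

definition mg_scaled :: "real \<Rightarrow> (R3 \<Rightarrow> complex) \<Rightarrow> (R3 \<Rightarrow> complex ^ 3) \<Rightarrow> R3 \<Rightarrow> complex ^ 3" where
  "mg_scaled t u p y = (\<chi> j. \<i> * (t *\<^sub>R p y $ j) + of_real (A ((1 / t) *\<^sub>R y) $ j) * u y)"

text \<open>The range \<open>1 \<le> t \<le> 2\<close> keeps \<open>1 / t\<close> in [1/2, 1], where
  \<open>V\<close> at \<open>y / t\<close> is controlled by \<open>V y\<close>.\<close>

lemma V_scaled_integrable:
  assumes [measurable]: "u \<in> borel_measurable borel" and Vu: "integrable lborel (\<lambda>x. V x * (cmod (u x))\<^sup>2)"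
    and t: "1 \<le> t" "t \<le> 2"
  shows "integrable lborel (\<lambda>y. V ((1 / t) *\<^sub>R y) * (cmod (u y))\<^sup>2)"
proof -
  have "AE y in lborel. norm (V ((1 / t) *\<^sub>R y) * (cmod (u y))\<^sup>2) \<le> norm (K * (V y * (cmod (u y))\<^sup>2))"
    using AE_nonzero
  proof eventually_elim
    case (elim y)
    have s: "1/2 \<le> 1 / t" "1 / t \<le> 1" "1 / t > 0" using t by (simp_all add: divide_simps)
    have "V ((1 / t) *\<^sub>R y) > 0" using elim s by (intro V_pos) simp
    then show ?case
      using mult_right_mono[OF V_ray_le[OF elim s(1,2)], of "(cmod (u y))\<^sup>2"] K_ge(4) V_pos[OF elim]
      by (simp add: abs_mult mult.assoc)
  qed
  then show ?thesis
    by (rule Bochner_Integration.integrable_bound[OF integrable_mult_right[OF Vu], rotated]) measurable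
qed

lemma Sigma_pair_dilate:
  assumes up: "Sigma_pair u p" and t: "1 \<le> t" "t \<le> 2"
  shows "Sigma_pair (dilate t u) (dilate_grad t p)"
proof -
  note [measurable] = Sigma_pairD(5)[OF up]
  have t0: "t > 0" "t \<noteq> 0" using t by auto
  have "(\<lambda>x. V x * (cmod (dilate t u x))\<^sup>2) = (\<lambda>x. t ^ 3 * (\<lambda>y. V ((1 / t) *\<^sub>R y) * (cmod (u y))\<^sup>2) (t *\<^sub>R x))"
    using t0 by (simp add: norm_dilate_power2 fun_eq_iff)
  moreover have "integrable lborel (\<lambda>x. t ^ 3 * (\<lambda>y. V ((1 / t) *\<^sub>R y) * (cmod (u y))\<^sup>2) (t *\<^sub>R x))"
    using V_scaled_integrable[OF Sigma_pairD(5,4)[OF up] t] t0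
    by (subst integrable_dilation_iff) simp_all
  ultimately have "integrable lborel (\<lambda>x. V x * (cmod (dilate t u x))\<^sup>2)"
    by (simp only:)
  then show ?thesis
    unfolding Sigma_pair_def dilate_def[abs_def] dilate_grad_def[abs_def]
    by (intro conjI in_Lp_2_scaleR has_weak_grad_scaleR has_weak_grad_dilation in_Lp_2_affine
        Sigma_pairD[OF up] t0)
qed

lemma mg_dilate:
  assumes "t > 0"
  shows "mg (dilate t u) (dilate_grad t p) x = sqrt (t ^ 3) *\<^sub>R mg_scaled t u p (t *\<^sub>R x)"
  using assms by (simp add: mg_def mg_scaled_def dilate_def dilate_grad_def vec_eq_iff scaleR_add_right)

lemma mg_scaled_measurable:
  assumes [measurable]: "u \<in> borel_measurable borel" "p \<in> borel_measurable borel"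
  shows "mg_scaled t u p \<in> borel_measurable borel"
  unfolding mg_scaled_def[abs_def] by (intro borel_measurable_vec_lambda) measurable

lemma integral_dilate_power2:
  assumes "u \<in> borel_measurable borel" "t > 0"
  shows "(LINT x|lborel. (cmod (dilate t u x))\<^sup>2) = (LINT x|lborel. (cmod (u x))\<^sup>2)"
  using integral_dilation[of "\<lambda>x. (cmod (u x))\<^sup>2" t] assms by (simp add: norm_dilate_power2)

lemma integral_dilate_power4:
  assumes "u \<in> borel_measurable borel" "t > 0"
  shows "(LINT x|lborel. cmod (dilate t u x) ^ 4) = t ^ 3 * (LINT x|lborel. cmod (u x) ^ 4)"
  using integral_dilation[of "\<lambda>x. t ^ 3 * cmod (u x) ^ 4" t] assms by (simp add: norm_dilate_power4)

lemma mg_scaled_integrable: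
  assumes up: "Sigma_pair u p" and t: "1 \<le> t" "t \<le> 2"
  shows "integrable lborel (\<lambda>y. (norm (mg_scaled t u p y))\<^sup>2)"
proof -
  note [measurable] = mg_scaled_measurable[OF Sigma_pairD(5,6)[OF up]]
  have t0: "t > 0" using t by simp
  have "integrable lborel (\<lambda>x. (norm (mg (dilate t u) (dilate_grad t p) x))\<^sup>2)"
    using mg_L2[OF Sigma_pair_dilate[OF up t]] unfolding in_Lp_2_iff by (rule conjunct2)
  then have "integrable lborel (\<lambda>x. t ^ 3 * (\<lambda>y. (norm (mg_scaled t u p y))\<^sup>2) (t *\<^sub>R x))"
    using t0 by (simp add: mg_dilate power_mult_distrib)
  then show ?thesis
    using t0 by (subst (asm) integrable_dilation_iff) simp_all
qed

text \<open>In the coordinates \<open>y = t x\<close> the dependence on \<open>t\<close> sits in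
  explicit factors and in the potentials, which are differentiable along rays, while
  \<open>u\<close> and \<open>p\<close> are evaluated at a point independent of
  \<open>t\<close>.\<close>

lemma En_dilate:
  assumes up: "Sigma_pair u p" and t: "1 \<le> t" "t \<le> 2"
  shows "En (dilate t u) (dilate_grad t p)
    = 1/2 * (LINT y|lborel. (norm (mg_scaled t u p y))\<^sup>2 + V ((1 / t) *\<^sub>R y) * (cmod (u y))\<^sup>2)
      - 1/4 * (t ^ 3 * (LINT x|lborel. cmod (u x) ^ 4))"
proof -
  note [measurable] = Sigma_pairD(5)[OF up] mg_scaled_measurable[OF Sigma_pairD(5,6)[OF up]]
  have t0: "t > 0" using t by simp
  have "(norm (mg (dilate t u) (dilate_grad t p) x))\<^sup>2 + V x * (cmod (dilate t u x))\<^sup>2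
    = t ^ 3 * (\<lambda>y. (norm (mg_scaled t u p y))\<^sup>2 + V ((1 / t) *\<^sub>R y) * (cmod (u y))\<^sup>2) (t *\<^sub>R x)" for x
    using t0 by (simp add: mg_dilate norm_dilate_power2 power_mult_distrib distrib_left)
  then have "(LINT x|lborel. (norm (mg (dilate t u) (dilate_grad t p) x))\<^sup>2 + V x * (cmod (dilate t u x))\<^sup>2)
    = (LINT x|lborel. t ^ 3 * (\<lambda>y. (norm (mg_scaled t u p y))\<^sup>2 + V ((1 / t) *\<^sub>R y) * (cmod (u y))\<^sup>2) (t *\<^sub>R x))"
    by (simp only:)
  also have "\<dots> = (LINT y|lborel. (norm (mg_scaled t u p y))\<^sup>2 + V ((1 / t) *\<^sub>R y) * (cmod (u y))\<^sup>2)"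
    by (rule integral_dilation[OF _ t0]) measurable
  finally show ?thesis
    unfolding En_def integral_dilate_power4[OF Sigma_pairD(5)[OF up] t0] by (simp only:)
qed

section \<open>Weak solutions and the second variation of the energy\<close>

definition weak_solution :: "real \<Rightarrow> (R3 \<Rightarrow> complex) \<Rightarrow> (R3 \<Rightarrow> complex ^ 3) \<Rightarrow> bool" where
  "weak_solution \<mu> u p \<longleftrightarrow> (\<forall>v q. Sigma_pair v q \<longrightarrow>
     (LINT x|lborel. mg u p x \<bullet> mg v q x + (V x - \<mu>) * (u x \<bullet> v x) - (cmod (u x))\<^sup>2 * (u x \<bullet> v x)) = 0)"

lemma Sigma_pair_L4:
  assumes "Sigma_pair u p"
  shows "integrable lborel (\<lambda>x. cmod (u x) ^ 4)"
proof -
  obtain C where "\<And>u p. in_Lp 2 u \<Longrightarrow> in_Lp 2 p \<Longrightarrow> has_weak_grad u p \<Longrightarrow> integrable lborel (\<lambda>x. cmod (u x) ^ 4)"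
    using sobolev_L4 by metis
  from this[OF Sigma_pairD(1-3)[OF assms]] show ?thesis .
qed

lemma weak_form_integrable:
  assumes u: "Sigma_pair u p" and v: "Sigma_pair v q"
  shows "integrable lborel (\<lambda>x. mg u p x \<bullet> mg v q x)"
    "integrable lborel (\<lambda>x. (V x - \<mu>) * (u x \<bullet> v x))"
    "integrable lborel (\<lambda>x. (cmod (u x))\<^sup>2 * (u x \<bullet> v x))"
proof -
  note [measurable] = Sigma_pairD(5)[OF u] Sigma_pairD(5)[OF v]
  show "integrable lborel (\<lambda>x. mg u p x \<bullet> mg v q x)"
    by (rule integrable_inner_L2[OF mg_L2[OF u] mg_L2[OF v]])
  have uv: "\<bar>u x \<bullet> v x\<bar> \<le> cmod (u x) * cmod (v x)" for x
    by (rule Cauchy_Schwarz_ineq2)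
  have "AE x in lborel. norm (V x * (u x \<bullet> v x)) \<le> norm (V x * (cmod (u x))\<^sup>2 + V x * (cmod (v x))\<^sup>2)"
    using AE_nonzero
  proof eventually_elim
    case (elim x)
    have "\<bar>u x \<bullet> v x\<bar> \<le> (cmod (u x))\<^sup>2 + (cmod (v x))\<^sup>2"
      using uv[of x] sum_squares_bound[of "cmod (u x)" "cmod (v x)"] mult_nonneg_nonneg[OF norm_ge_zero[of "u x"] norm_ge_zero[of "v x"]]
      by linarith
    from mult_left_mono[OF this, of "V x"] show ?case
      using V_pos[OF elim] by (simp add: abs_mult distrib_left)
  qed
  then have "integrable lborel (\<lambda>x. V x * (u x \<bullet> v x))"
    by (rule Bochner_Integration.integrable_bound[OF Bochner_Integration.integrable_add[OF Sigma_pairD(4)[OF u] Sigma_pairD(4)[OF v]], rotated]) measurable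
  moreover have "integrable lborel (\<lambda>x. \<mu> * (u x \<bullet> v x))"
    by (intro integrable_mult_right integrable_inner_L2 Sigma_pairD[OF u] Sigma_pairD[OF v])
  ultimately show "integrable lborel (\<lambda>x. (V x - \<mu>) * (u x \<bullet> v x))"
    unfolding left_diff_distrib by (rule Bochner_Integration.integrable_diff)
  have "AE x in lborel. norm ((cmod (u x))\<^sup>2 * (u x \<bullet> v x)) \<le> norm (cmod (u x) ^ 4 + cmod (v x) ^ 4)"
  proof (rule AE_I2)
    fix x
    have "(cmod (u x))\<^sup>2 * \<bar>u x \<bullet> v x\<bar> \<le> (cmod (u x))\<^sup>2 * (cmod (u x) * cmod (v x))"
      by (rule mult_left_mono[OF uv]) simp
    also have "\<dots> = cmod (u x) ^ 3 * cmod (v x)"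
      by (simp add: power2_eq_square power3_eq_cube)
    also have "\<dots> \<le> cmod (u x) ^ 4 + cmod (v x) ^ 4"
      by (rule cubic_term_bound) simp_all
    finally show "norm ((cmod (u x))\<^sup>2 * (u x \<bullet> v x)) \<le> norm (cmod (u x) ^ 4 + cmod (v x) ^ 4)"
      by (simp add: abs_mult)
  qed
  then show "integrable lborel (\<lambda>x. (cmod (u x))\<^sup>2 * (u x \<bullet> v x))"
    by (rule Bochner_Integration.integrable_bound[OF Bochner_Integration.integrable_add[OF Sigma_pair_L4[OF u] Sigma_pair_L4[OF v]], rotated]) measurable
qed

lemma integrable_product_of_squares:
  assumes u: "Sigma_pair u p" and v: "Sigma_pair v q"
  shows "integrable lborel (\<lambda>x. (cmod (u x))\<^sup>2 * (cmod (v x))\<^sup>2)"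
proof -
  note [measurable] = Sigma_pairD(5)[OF u] Sigma_pairD(5)[OF v]
  have "AE x in lborel. norm ((cmod (u x))\<^sup>2 * (cmod (v x))\<^sup>2) \<le> norm (cmod (u x) ^ 4 + cmod (v x) ^ 4)"
  proof (rule AE_I2)
    fix x
    have "2 * ((cmod (u x))\<^sup>2 * (cmod (v x))\<^sup>2) \<le> cmod (u x) ^ 4 + cmod (v x) ^ 4"
      using sum_squares_bound[of "(cmod (u x))\<^sup>2" "(cmod (v x))\<^sup>2"] by (simp flip: power_mult)
    moreover have "0 \<le> (cmod (u x))\<^sup>2 * (cmod (v x))\<^sup>2" by simp
    ultimately have "(cmod (u x))\<^sup>2 * (cmod (v x))\<^sup>2 \<le> cmod (u x) ^ 4 + cmod (v x) ^ 4"
      by linarith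
    then show "norm ((cmod (u x))\<^sup>2 * (cmod (v x))\<^sup>2) \<le> norm (cmod (u x) ^ 4 + cmod (v x) ^ 4)"
      by simp
  qed
  then show ?thesis
    by (rule Bochner_Integration.integrable_bound[OF Bochner_Integration.integrable_add[OF Sigma_pair_L4[OF u] Sigma_pair_L4[OF v]], rotated]) measurable
qed

lemma mg_V_integrable:
  assumes u: "Sigma_pair u p"
  shows "integrable lborel (\<lambda>x. (norm (mg u p x))\<^sup>2 + V x * (cmod (u x))\<^sup>2)"
  using mg_L2[OF u] Sigma_pairD(4)[OF u] by (simp add: in_Lp_2_iff)

text \<open>The equation turns the part linear in \<open>w\<close> into a multiple of
  \<open>u . w\<close>, and equal masses give
  \<open>2 \<integral> u . w = - \<integral> |w|^2\<close>, so the multiplier contributes in second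
  order only. The quartic remainder is \<open>quartic_expansion_bound\<close>.\<close>

lemma energy_second_variation:
  assumes u: "Sigma_pair u p" and w: "Sigma_pair w q" and sol: "weak_solution \<mu> u p"
    and mass: "(LINT x|lborel. (cmod (u x + w x))\<^sup>2) = (LINT x|lborel. (cmod (u x))\<^sup>2)"
  shows "En (\<lambda>x. u x + w x) (\<lambda>x. p x + q x) - En u p
    \<ge> 1/2 * (LINT x|lborel. (norm (mg w q x))\<^sup>2 + V x * (cmod (w x))\<^sup>2) - \<bar>\<mu>\<bar> / 2 * (LINT x|lborel. (cmod (w x))\<^sup>2)
      - 4 * (LINT x|lborel. ((cmod (u x))\<^sup>2 + (cmod (u x + w x))\<^sup>2) * (cmod (w x))\<^sup>2)"
proof -
  note uw = Sigma_pair_add[OF u w]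
  note iw = weak_form_integrable[OF u w]
  let ?S = "\<lambda>v r x. (norm (mg v r x))\<^sup>2 + V x * (cmod (v x))\<^sup>2"
  let ?W = "\<lambda>x. mg u p x \<bullet> mg w q x + (V x - \<mu>) * (u x \<bullet> w x) - (cmod (u x))\<^sup>2 * (u x \<bullet> w x)"
  let ?v = "\<lambda>x. u x + w x" and ?r = "\<lambda>x. p x + q x"
  let ?L = "\<lambda>x. 1/2 * ?S w q x - \<bar>\<mu>\<bar> / 2 * (cmod (w x))\<^sup>2 - 4 * (((cmod (u x))\<^sup>2 + (cmod (?v x))\<^sup>2) * (cmod (w x))\<^sup>2)"
  \<comment> \<open>The weak form and the mass difference integrate to 0; subtracting their
    densities makes the comparison with \<open>?L\<close> hold pointwise.\<close>
  let ?R = "\<lambda>x. (1/2 * ?S ?v ?r x - 1/4 * cmod (?v x) ^ 4) - (1/2 * ?S u p x - 1/4 * cmod (u x) ^ 4) - ?W x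
    - \<mu> / 2 * ((cmod (?v x))\<^sup>2 - (cmod (u x))\<^sup>2)"
  have iL: "integrable lborel (\<lambda>x. ((cmod (u x))\<^sup>2 + (cmod (?v x))\<^sup>2) * (cmod (w x))\<^sup>2)"
    unfolding distrib_right
    by (intro Bochner_Integration.integrable_add integrable_product_of_squares[OF u w] integrable_product_of_squares[OF uw w])
  have iW: "integrable lborel ?W"
    using iw by (intro Bochner_Integration.integrable_diff Bochner_Integration.integrable_add)
  have W0: "(LINT x|lborel. ?W x) = 0"
    using sol w unfolding weak_solution_def by blast
  note ints = mg_V_integrable[OF u] mg_V_integrable[OF w] mg_V_integrable[OF uw] Sigma_pair_L4[OF u] Sigma_pair_L4[OF uw]
    Sigma_pairD(7)[OF u] Sigma_pairD(7)[OF w] Sigma_pairD(7)[OF uw] iL iW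
  have le: "?L x \<le> ?R x" for x
  proof -
    have m: "(norm (mg ?v ?r x))\<^sup>2 = (norm (mg u p x))\<^sup>2 + 2 * (mg u p x \<bullet> mg w q x) + (norm (mg w q x))\<^sup>2"
      unfolding mg_add power2_norm_eq_inner by (simp add: inner_add inner_commute)
    have c: "(cmod (?v x))\<^sup>2 = (cmod (u x))\<^sup>2 + 2 * (u x \<bullet> w x) + (cmod (w x))\<^sup>2"
      unfolding power2_norm_eq_inner by (simp add: inner_add inner_commute)
    have arith: "S - m - 4 * Z \<le> R" if "R = S - m' - 1/4 * Q" "m' \<le> m" "Q \<le> 16 * Z" for R S Q Z m m' :: real
      using that by simp
    have "?R x = 1/2 * ?S w q x - \<mu> / 2 * (cmod (w x))\<^sup>2
        - 1/4 * (cmod (?v x) ^ 4 - cmod (u x) ^ 4 - 4 * (cmod (u x))\<^sup>2 * (u x \<bullet> w x))"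
      unfolding m c by (simp add: field_simps)
    moreover have "\<mu> / 2 * (cmod (w x))\<^sup>2 \<le> \<bar>\<mu>\<bar> / 2 * (cmod (w x))\<^sup>2"
      by (intro mult_right_mono) auto
    ultimately show ?thesis
      using quartic_expansion_bound[of "u x" "w x", unfolded mult.assoc[of 16]] by (rule arith)
  qed
  have "(LINT x|lborel. ?L x) \<le> (LINT x|lborel. ?R x)"
    by (intro integral_mono le Bochner_Integration.integrable_diff Bochner_Integration.integrable_add integrable_mult_right ints)
  also have "(LINT x|lborel. ?R x) = En ?v ?r - En u p"
    using ints W0 mass unfolding En_def by simp
  also have "(LINT x|lborel. ?L x) = 1/2 * (LINT x|lborel. ?S w q x) - \<bar>\<mu>\<bar> / 2 * (LINT x|lborel. (cmod (w x))\<^sup>2)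
      - 4 * (LINT x|lborel. ((cmod (u x))\<^sup>2 + (cmod (?v x))\<^sup>2) * (cmod (w x))\<^sup>2)"
    using ints by simp
  finally show ?thesis .
qed


text \<open>Where \<open>|f| \<le> k\<close> the weight is bounded; where it is larger,
  Cauchy-Schwarz puts the quartic tail of \<open>f\<close> in front of the L4 norm of
  \<open>w\<close>. A high level makes that coefficient small, at the price of \<open>k^2\<close> on
  the L2 norm.\<close>

lemma truncated_product_bound:
  assumes f: "Sigma_pair f p" and w: "Sigma_pair w q" and k: "k \<ge> 0"
    and T: "(LINT x|lborel. indicator {x. k < cmod (f x)} x * cmod (f x) ^ 4) \<le> T"
  shows "(LINT x|lborel. (cmod (f x))\<^sup>2 * (cmod (w x))\<^sup>2)
    \<le> k\<^sup>2 * (LINT x|lborel. (cmod (w x))\<^sup>2) + sqrt T * sqrt (LINT x|lborel. cmod (w x) ^ 4)"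
proof -
  note [measurable] = Sigma_pairD(5)[OF f] Sigma_pairD(5)[OF w]
  define F where "F x = indicator {x. k < cmod (f x)} x * (cmod (f x))\<^sup>2" for x
  have [measurable]: "F \<in> borel_measurable borel" unfolding F_def by measurable
  have F2: "(F x)\<^sup>2 = indicator {x. k < cmod (f x)} x * cmod (f x) ^ 4" for x
    by (simp add: F_def split: split_indicator flip: power_mult)
  have iF2: "integrable lborel (\<lambda>x. (F x)\<^sup>2)"
    by (rule Bochner_Integration.integrable_bound[OF Sigma_pair_L4[OF f]])
       (simp_all add: F2 split: split_indicator)
  have iw: "integrable lborel (\<lambda>x. ((cmod (w x))\<^sup>2)\<^sup>2)"
    using Sigma_pair_L4[OF w] by (simp flip: power_mult)
  have pt: "(cmod (f x))\<^sup>2 * (cmod (w x))\<^sup>2 \<le> k\<^sup>2 * (cmod (w x))\<^sup>2 + \<bar>F x * (cmod (w x))\<^sup>2\<bar>" for x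
  proof (cases "k < cmod (f x)")
    case True
    then show ?thesis by (simp add: F_def)
  next
    case False
    then have "(cmod (f x))\<^sup>2 \<le> k\<^sup>2" by (intro power_mono) auto
    then have "(cmod (f x))\<^sup>2 * (cmod (w x))\<^sup>2 \<le> k\<^sup>2 * (cmod (w x))\<^sup>2" by (intro mult_right_mono) auto
    then show ?thesis by (simp add: add_increasing2)
  qed
  have iFw: "integrable lborel (\<lambda>x. \<bar>F x * (cmod (w x))\<^sup>2\<bar>)"
    by (rule Bochner_Integration.integrable_bound[OF integrable_product_of_squares[OF f w]])
       (simp_all add: F_def split: split_indicator)
  have "(LINT x|lborel. (cmod (f x))\<^sup>2 * (cmod (w x))\<^sup>2)
    \<le> (LINT x|lborel. k\<^sup>2 * (cmod (w x))\<^sup>2 + \<bar>F x * (cmod (w x))\<^sup>2\<bar>)"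
    by (intro integral_mono pt Bochner_Integration.integrable_add integrable_mult_right iFw
        integrable_product_of_squares[OF f w] Sigma_pairD(7)[OF w])
  also have "\<dots> = k\<^sup>2 * (LINT x|lborel. (cmod (w x))\<^sup>2) + (LINT x|lborel. \<bar>F x * (cmod (w x))\<^sup>2\<bar>)"
    using iFw Sigma_pairD(7)[OF w] by (subst Bochner_Integration.integral_add) simp_all
  also have "(LINT x|lborel. \<bar>F x * (cmod (w x))\<^sup>2\<bar>) \<le> sqrt (LINT x|lborel. (F x)\<^sup>2) * sqrt (LINT x|lborel. ((cmod (w x))\<^sup>2)\<^sup>2)"
    by (rule integral_Cauchy_Schwarz[OF _ _ iF2 iw]) measurable
  also have "\<dots> \<le> sqrt T * sqrt (LINT x|lborel. cmod (w x) ^ 4)"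
  proof (intro mult_mono)
    show "sqrt (LINT x|lborel. (F x)\<^sup>2) \<le> sqrt T"
      using T unfolding F2 by (rule real_sqrt_le_mono)
    show "sqrt (LINT x|lborel. ((cmod (w x))\<^sup>2)\<^sup>2) \<le> sqrt (LINT x|lborel. cmod (w x) ^ 4)"
      by (simp flip: power_mult)
    have "0 \<le> (LINT x|lborel. (F x)\<^sup>2)" by (intro integral_nonneg_AE) simp
    then have "0 \<le> T" using T unfolding F2 by linarith
    then show "0 \<le> sqrt T" by simp
    show "0 \<le> sqrt (LINT x|lborel. ((cmod (w x))\<^sup>2)\<^sup>2)" by (intro real_sqrt_ge_zero integral_nonneg_AE) simp
  qed
  finally show ?thesis by simp
qed

text \<open>\<open>\<i> q\<close> is \<open>mg w q\<close> minus \<open>A w\<close>, and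
  \<open>|A|^2 \<le> V / \<alpha>\<close>. With this the Sobolev bound can be expressed by the
  energy norm.\<close>

lemma weak_grad_L2_bound:
  assumes w: "Sigma_pair w q"
  shows "(LINT x|lborel. (norm (q x))\<^sup>2) \<le> (2 + 2 / \<alpha>) * (LINT x|lborel. (norm (mg w q x))\<^sup>2 + V x * (cmod (w x))\<^sup>2)"
proof -
  have "(LINT x|lborel. (norm (q x))\<^sup>2) \<le> (LINT x|lborel. (2 + 2 / \<alpha>) * ((norm (mg w q x))\<^sup>2 + V x * (cmod (w x))\<^sup>2))"
  proof (rule integral_mono_AE)
    show "AE x in lborel. (norm (q x))\<^sup>2 \<le> (2 + 2 / \<alpha>) * ((norm (mg w q x))\<^sup>2 + V x * (cmod (w x))\<^sup>2)"
      using AE_nonzero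
    proof eventually_elim
      case (elim x)
      let ?a = "\<chi> j. of_real (A x $ j) * w x"
      have "(\<chi> j. \<i> * q x $ j) = mg w q x - ?a"
        by (simp add: mg_def vec_eq_iff)
      then have "norm (q x) = norm (mg w q x - ?a)"
        using norm_ii_mult[of "q x"] by simp
      also have "\<dots> \<le> norm (mg w q x) + norm ?a" by (rule norm_triangle_ineq4)
      finally have "(norm (q x))\<^sup>2 \<le> (norm (mg w q x) + norm ?a)\<^sup>2" by (rule power_mono) simp
      also have "\<dots> \<le> 2 * (norm (mg w q x))\<^sup>2 + 2 * (norm ?a)\<^sup>2"
        using sum_squares_bound[of "norm (mg w q x)" "norm ?a"] unfolding power2_sum by linarith
      also have "(norm ?a)\<^sup>2 = (norm (A x))\<^sup>2 * (cmod (w x))\<^sup>2" by (rule norm_mag_mult)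
      also have "(norm (A x))\<^sup>2 * (cmod (w x))\<^sup>2 \<le> V x / \<alpha> * (cmod (w x))\<^sup>2"
        using V_ge[OF elim] \<alpha>_pos by (intro mult_right_mono) (simp_all add: pos_le_divide_eq mult.commute)
      finally have 1: "(norm (q x))\<^sup>2 \<le> 2 * (norm (mg w q x))\<^sup>2 + 2 / \<alpha> * (V x * (cmod (w x))\<^sup>2)" by simp
      have 2: "0 \<le> 2 / \<alpha> * (norm (mg w q x))\<^sup>2" "0 \<le> 2 * (V x * (cmod (w x))\<^sup>2)"
        using \<alpha>_pos V_pos[OF elim] by simp_all
      have "(2 + 2 / \<alpha>) * ((norm (mg w q x))\<^sup>2 + V x * (cmod (w x))\<^sup>2)
        = 2 * (norm (mg w q x))\<^sup>2 + 2 / \<alpha> * (V x * (cmod (w x))\<^sup>2) + (2 / \<alpha> * (norm (mg w q x))\<^sup>2 + 2 * (V x * (cmod (w x))\<^sup>2))"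
        unfolding distrib_left distrib_right by (simp only: add_ac)
      with 1 2 show ?case by linarith
    qed
  qed (intro integrable_mult_right mg_V_integrable w Sigma_pairD(8)[OF w])+
  then show ?thesis by (simp only: integral_mult_right_zero)
qed

text \<open>Dominated convergence. The factor 3 bounds \<open>sqrt (t ^ 3)\<close> for
  \<open>t \<le> 2\<close>, so that one level serves \<open>u\<close> and all its dilations.\<close>

lemma level_tail_tendsto_0:
  assumes u: "Sigma_pair u p"
  shows "(\<lambda>n. LINT x|lborel. indicator {x. real n < 3 * cmod (u x)} x * cmod (u x) ^ 4) \<longlonglongrightarrow> 0"
proof -
  note [measurable] = Sigma_pairD(5)[OF u]
  have "(\<lambda>n. LINT x|lborel. indicator {x. real n < 3 * cmod (u x)} x * cmod (u x) ^ 4) \<longlonglongrightarrow> (LINT x|(lborel :: R3 measure). 0 :: real)"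
  proof (rule integral_dominated_convergence[OF _ _ Sigma_pair_L4[OF u]])
    show "AE x in lborel. (\<lambda>n. indicator {x. real n < 3 * cmod (u x)} x * cmod (u x) ^ 4) \<longlonglongrightarrow> 0"
    proof (rule AE_I2)
      fix x
      obtain N :: nat where N: "3 * cmod (u x) \<le> real N" using real_arch_simple by blast
      show "(\<lambda>n. indicator {x. real n < 3 * cmod (u x)} x * cmod (u x) ^ 4) \<longlonglongrightarrow> 0"
      proof (rule tendsto_eventually, rule eventually_sequentiallyI)
        fix n assume "N \<le> n"
        then have "3 * cmod (u x) \<le> real n" using N by (meson of_nat_le_iff order_trans)
        then show "indicator {x. real n < 3 * cmod (u x)} x * cmod (u x) ^ 4 = 0" by simp
      qed
    qed
    show "AE x in lborel. norm (indicator {x. real n < 3 * cmod (u x)} x * cmod (u x) ^ 4) \<le> cmod (u x) ^ 4" for n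
      by (intro AE_I2) (simp split: split_indicator)
  qed measurable
  then show ?thesis by simp
qed

text \<open>Testing the equation with \<open>w = u\<^sub>t - u\<close> shows that the energy difference is, up to the
  \<open>L\<^sup>2\<close> norm of \<open>w\<close>, bounded below by a multiple of \<open>\<parallel>w\<parallel>\<^sup>2\<close> in the energy space: the quartic
  remainder is absorbed after truncating \<open>u\<close>. As \<open>V\<close> tends to infinity only the part of \<open>w\<close> in a ball
  survives, and there \<open>w = O(t - 1)\<close> because \<open>u\<close> has a weak gradient. Neither further regularity
  nor decay of \<open>u\<close> is needed.\<close>

lemma energy_dilation_lower_bound:
  assumes u: "Sigma_pair u p" and sol: "weak_solution \<mu> u p"
  obtains C where "\<And>t. 1 < t \<Longrightarrow> t \<le> 2 \<Longrightarrow> En (dilate t u) (dilate_grad t p) - En u p \<ge> - (C * (t - 1)\<^sup>2)"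
proof -
  note [measurable] = Sigma_pairD(5)[OF u]
  obtain C\<^sub>S where CS: "C\<^sub>S > 0"
    "\<And>u p. in_Lp 2 u \<Longrightarrow> in_Lp 2 p \<Longrightarrow> has_weak_grad u p \<Longrightarrow>
       (LINT x|lborel. cmod (u x) ^ 4) \<le> C\<^sub>S * ((LINT x|lborel. (cmod (u x))\<^sup>2) + (LINT x|lborel. (norm (p x))\<^sup>2))\<^sup>2"
    using sobolev_L4 by metis
  define D where "D = 2 + 2 / \<alpha>"
  have D: "D \<ge> 2" using \<alpha>_pos by (simp add: D_def)
  define \<tau> where "\<tau> k = (LINT x|lborel. indicator {x. k < 3 * cmod (u x)} x * cmod (u x) ^ 4)" for k
  have \<tau>_nonneg: "\<tau> k \<ge> 0" for k unfolding \<tau>_def by (intro integral_nonneg_AE) simp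
  \<comment> \<open>The truncation level is fixed before \<open>t\<close>. With 1/16, four times the
    quartic remainder uses up 1/4 of the 1/2 in front of the energy norm.\<close>
  have "(\<lambda>n. 6 * (sqrt (\<tau> (real n)) * sqrt C\<^sub>S) * D) \<longlonglongrightarrow> 6 * (sqrt 0 * sqrt C\<^sub>S) * D"
    unfolding \<tau>_def by (intro tendsto_intros level_tail_tendsto_0[OF u])
  then have "eventually (\<lambda>n. 6 * (sqrt (\<tau> (real n)) * sqrt C\<^sub>S) * D < 1/16) sequentially"
    by (rule order_tendstoD) simp
  then have "\<exists>n. 6 * (sqrt (\<tau> (real n)) * sqrt C\<^sub>S) * D < 1/16"
    by (rule eventually_happens'[OF sequentially_bot])
  then obtain n where n: "6 * (sqrt (\<tau> (real n)) * sqrt C\<^sub>S) * D < 1/16"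
    by (rule exE)
  define k where "k = real n"
  define \<eta> where "\<eta> = 6 * (sqrt (\<tau> k) * sqrt C\<^sub>S)"
  have \<eta>0: "\<eta> \<ge> 0" using \<tau>_nonneg CS(1) by (simp add: \<eta>_def)
  have \<eta>D: "\<eta> * D \<le> 1/16" using n by (simp add: \<eta>_def k_def)
  have \<eta>1: "\<eta> \<le> 1" using mult_left_mono[OF D \<eta>0] \<eta>D by simp
  have k0: "k \<ge> 0" by (simp add: k_def)
  \<comment> \<open>All coefficients of the squared L2 norm of \<open>w\<close>: the multiplier,
    \<open>4 * 2 k^2\<close> from the bounded parts, and \<open>4 \<eta> \<le> 4\<close> from the
    tails.\<close>
  define L where "L = \<bar>\<mu>\<bar> / 2 + 8 * k\<^sup>2 + 4"
  have L0: "L \<ge> 0" by (simp add: L_def)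
  have "eventually (\<lambda>x. 4 * L \<le> V x) at_infinity"
    using V_at_infinity by (simp add: filterlim_at_top)
  then obtain b where b: "\<And>x. b \<le> norm x \<Longrightarrow> 4 * L \<le> V x"
    unfolding eventually_at_infinity by blast
  define R where "R = max b 0"
  have R: "R \<ge> 0" by (simp add: R_def)
  obtain C\<^sub>1 where C1: "\<And>t. 1 \<le> t \<Longrightarrow> t \<le> 2 \<Longrightarrow>
    (LINT x|lborel. indicator (cball 0 R) x * (cmod (dilate t u x + (- 1) *\<^sub>R u x))\<^sup>2) \<le> C\<^sub>1 * (t - 1)\<^sup>2"
    using dilation_local_estimate[OF Sigma_pairD(1-3)[OF u] R] by blast
  show ?thesis
  proof (rule that)
    fix t :: real assume t: "1 < t" "t \<le> 2"
    then have t1: "1 \<le> t" and t0: "t > 0" by auto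
    define w where "w x = dilate t u x + (- 1) *\<^sub>R u x" for x
    define q where "q x = dilate_grad t p x + (- 1) *\<^sub>R p x" for x
    note v = Sigma_pair_dilate[OF u t1 t(2)]
    have w: "Sigma_pair w q"
      unfolding w_def[abs_def] q_def[abs_def] by (rule Sigma_pair_add[OF v Sigma_pair_scaleR[OF u]])
    have uw: "(\<lambda>x. u x + w x) = dilate t u" "(\<lambda>x. p x + q x) = dilate_grad t p"
      by (simp_all add: w_def q_def fun_eq_iff)
    then have uwx: "u x + w x = dilate t u x" for x by (simp add: w_def)
    note [measurable] = Sigma_pairD(5)[OF w] Sigma_pairD(5)[OF v]
    define S where "S = (LINT x|lborel. (norm (mg w q x))\<^sup>2 + V x * (cmod (w x))\<^sup>2)"
    define W where "W = (LINT x|lborel. (cmod (w x))\<^sup>2)"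
    have W0: "W \<ge> 0" unfolding W_def by (intro integral_nonneg_AE) simp
    have S0: "S \<ge> 0"
      unfolding S_def
    proof (rule integral_nonneg_AE)
      show "AE x in lborel. 0 \<le> (norm (mg w q x))\<^sup>2 + V x * (cmod (w x))\<^sup>2"
        using AE_nonzero by eventually_elim (simp add: V_pos less_imp_le)
    qed
    \<comment> \<open>The squared H1 norm of \<open>w\<close> is at most \<open>W + D S\<close>, so
      the root of its quartic integral is linear in \<open>W\<close> and \<open>S\<close> and can be
      absorbed.\<close>
    have W4: "(LINT x|lborel. cmod (w x) ^ 4) \<le> C\<^sub>S * (W + D * S)\<^sup>2"
    proof (rule order_trans[OF CS(2)[OF Sigma_pairD(1-3)[OF w]]])
      have "0 \<le> (LINT x|lborel. (norm (q x))\<^sup>2)" by (intro integral_nonneg_AE) simp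
      then show "C\<^sub>S * ((LINT x|lborel. (cmod (w x))\<^sup>2) + (LINT x|lborel. (norm (q x))\<^sup>2))\<^sup>2 \<le> C\<^sub>S * (W + D * S)\<^sup>2"
        using weak_grad_L2_bound[OF w] W0 CS(1) unfolding W_def S_def D_def
        by (intro mult_left_mono power_mono add_mono) auto
    qed
    have sqrtW4: "sqrt (LINT x|lborel. cmod (w x) ^ 4) \<le> sqrt C\<^sub>S * (W + D * S)"
      using real_sqrt_le_mono[OF W4] W0 S0 D by (simp add: real_sqrt_mult)
    \<comment> \<open>9 is the perfect square above the factor 8 in the tail of the dilated
      function; its root 3, once for each of the two products, makes the 6 in
      \<open>\<eta>\<close>.\<close>
    have prod: "(LINT x|lborel. (cmod (f x))\<^sup>2 * (cmod (w x))\<^sup>2) \<le> k\<^sup>2 * W + \<eta> / 2 * (W + D * S)"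
      if f: "Sigma_pair f r" and T: "(LINT x|lborel. indicator {x. k < cmod (f x)} x * cmod (f x) ^ 4) \<le> 9 * \<tau> k" for f r
    proof -
      have "(LINT x|lborel. (cmod (f x))\<^sup>2 * (cmod (w x))\<^sup>2) \<le> k\<^sup>2 * W + sqrt (9 * \<tau> k) * sqrt (LINT x|lborel. cmod (w x) ^ 4)"
        unfolding W_def by (rule truncated_product_bound[OF f w k0 T])
      also have "sqrt (9 * \<tau> k) = 3 * sqrt (\<tau> k)"
        by (simp add: real_sqrt_mult)
      also have "3 * sqrt (\<tau> k) * sqrt (LINT x|lborel. cmod (w x) ^ 4) \<le> 3 * sqrt (\<tau> k) * (sqrt C\<^sub>S * (W + D * S))"
        using \<tau>_nonneg by (intro mult_left_mono sqrtW4) simp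
      also have "\<dots> = \<eta> / 2 * (W + D * S)" by (simp add: \<eta>_def)
      finally show ?thesis by simp
    qed
    have tail_int: "integrable lborel (\<lambda>x. indicator {x. k < s * cmod (u x)} x * cmod (u x) ^ 4)" for s
      by (rule Bochner_Integration.integrable_bound[OF Sigma_pair_L4[OF u]]) (simp_all split: split_indicator)
    have tail_mono: "(LINT x|lborel. indicator {x. k < s * cmod (u x)} x * cmod (u x) ^ 4) \<le> \<tau> k" if "s \<le> 3" for s
      unfolding \<tau>_def
    proof (rule integral_mono[OF tail_int tail_int])
      fix x
      have "s * cmod (u x) \<le> 3 * cmod (u x)" using that by (intro mult_right_mono) auto
      then show "indicator {x. k < s * cmod (u x)} x * cmod (u x) ^ 4 \<le> indicator {x. k < 3 * cmod (u x)} x * cmod (u x) ^ 4"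
        by (auto split: split_indicator)
    qed
    have Tu: "(LINT x|lborel. indicator {x. k < cmod (u x)} x * cmod (u x) ^ 4) \<le> 9 * \<tau> k"
      using tail_mono[of 1] \<tau>_nonneg[of k] by simp
    \<comment> \<open>Undoing the dilation lowers the cutoff by the factor
      \<open>sqrt (t ^ 3) \<le> 3\<close>, which \<open>\<tau>\<close> anticipates, and leaves
      \<open>t ^ 3 \<le> 8\<close> in front.\<close>
    have Tv: "(LINT x|lborel. indicator {x. k < cmod (dilate t u x)} x * cmod (dilate t u x) ^ 4) \<le> 9 * \<tau> k"
    proof -
      let ?F = "\<lambda>y. t ^ 3 * (indicator {x. k < sqrt (t ^ 3) * cmod (u x)} y * cmod (u y) ^ 4)"
      have "indicator {x. k < cmod (dilate t u x)} x * cmod (dilate t u x) ^ 4 = t ^ 3 * ?F (t *\<^sub>R x)" for x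
        unfolding norm_dilate_power4[OF less_imp_le[OF t0]] using t0 by (simp add: dilate_def split: split_indicator)
      then have "(LINT x|lborel. indicator {x. k < cmod (dilate t u x)} x * cmod (dilate t u x) ^ 4) = (LINT x|lborel. t ^ 3 * ?F (t *\<^sub>R x))"
        by (simp only:)
      also have "\<dots> = (LINT y|lborel. ?F y)"
        by (rule integral_dilation[OF _ t0]) measurable
      also have "\<dots> = t ^ 3 * (LINT y|lborel. indicator {x. k < sqrt (t ^ 3) * cmod (u x)} y * cmod (u y) ^ 4)"
        by (rule integral_mult_right_zero)
      also have "\<dots> \<le> 8 * \<tau> k"
        using sqrt_cube_bounds[OF t1 t(2)] t0 by (intro mult_mono tail_mono integral_nonneg_AE AE_I2) simp_all
      also have "\<dots> \<le> 9 * \<tau> k" using \<tau>_nonneg[of k] by simp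
      finally show ?thesis .
    qed
    have split: "(LINT x|lborel. ((cmod (u x))\<^sup>2 + (cmod (u x + w x))\<^sup>2) * (cmod (w x))\<^sup>2)
      = (LINT x|lborel. (cmod (u x))\<^sup>2 * (cmod (w x))\<^sup>2) + (LINT x|lborel. (cmod (dilate t u x))\<^sup>2 * (cmod (w x))\<^sup>2)"
      unfolding distrib_right uwx
      by (rule Bochner_Integration.integral_add[OF integrable_product_of_squares[OF u w] integrable_product_of_squares[OF v w]])
    have "En (dilate t u) (dilate_grad t p) - En u p
      \<ge> 1/2 * S - \<bar>\<mu>\<bar> / 2 * W - 4 * (LINT x|lborel. ((cmod (u x))\<^sup>2 + (cmod (u x + w x))\<^sup>2) * (cmod (w x))\<^sup>2)"
      using energy_second_variation[OF u w sol] integral_dilate_power2[OF Sigma_pairD(5)[OF u] t0]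
      unfolding S_def W_def uw uwx by simp
    moreover have "(LINT x|lborel. ((cmod (u x))\<^sup>2 + (cmod (u x + w x))\<^sup>2) * (cmod (w x))\<^sup>2) \<le> 2 * (k\<^sup>2 * W) + \<eta> * W + (\<eta> * D) * S"
    proof -
      have "\<eta> / 2 * (W + D * S) + \<eta> / 2 * (W + D * S) = \<eta> * W + (\<eta> * D) * S"
        by (simp add: field_simps)
      then show ?thesis
        unfolding split using prod[OF u Tu] prod[OF v Tv] by linarith
    qed
    moreover have "(\<eta> * D) * S \<le> 1/16 * S" by (rule mult_right_mono[OF \<eta>D S0])
    moreover have "\<eta> * W \<le> 1 * W" by (rule mult_right_mono[OF \<eta>1 W0])
    ultimately have "En (dilate t u) (dilate_grad t p) - En u p \<ge> 1/4 * S - (\<bar>\<mu>\<bar> / 2 * W + 8 * (k\<^sup>2 * W) + 4 * W)"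
      by linarith
    also have "1/4 * S - (\<bar>\<mu>\<bar> / 2 * W + 8 * (k\<^sup>2 * W) + 4 * W) = 1/4 * S - L * W"
      by (simp add: L_def distrib_right mult.assoc)
    \<comment> \<open>Outside the ball \<open>V \<ge> 4 L\<close>, so a quarter of the energy
      density covers \<open>L |w|^2\<close>; inside, the local dilation estimate pays for
      it.\<close>
    also have "1/4 * S - L * W \<ge> - (L * C\<^sub>1 * (t - 1)\<^sup>2)"
    proof -
      have [measurable]: "cball (0 :: R3) R \<in> sets borel" by simp
      have ball_int: "integrable lborel (\<lambda>x. indicator (cball 0 R) x * (cmod (w x))\<^sup>2)"
        by (rule Bochner_Integration.integrable_bound[OF Sigma_pairD(7)[OF w]]) (simp_all split: split_indicator)
      have "(LINT x|lborel. - L * (indicator (cball 0 R) x * (cmod (w x))\<^sup>2))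
        \<le> (LINT x|lborel. 1/4 * ((norm (mg w q x))\<^sup>2 + V x * (cmod (w x))\<^sup>2) - L * (cmod (w x))\<^sup>2)"
      proof (rule integral_mono_AE)
        show "AE x in lborel. - L * (indicator (cball 0 R) x * (cmod (w x))\<^sup>2)
          \<le> 1/4 * ((norm (mg w q x))\<^sup>2 + V x * (cmod (w x))\<^sup>2) - L * (cmod (w x))\<^sup>2"
          using AE_nonzero
        proof eventually_elim
          case (elim x)
          have m: "0 \<le> (norm (mg w q x))\<^sup>2" by simp
          show ?case
          proof (cases "x \<in> cball 0 R")
            case True
            have "0 \<le> V x * (cmod (w x))\<^sup>2" using V_pos[OF elim] by simp
            with m True show ?thesis by simp
          next
            case False
            then have "4 * L * (cmod (w x))\<^sup>2 \<le> V x * (cmod (w x))\<^sup>2"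
              by (intro mult_right_mono b) (auto simp: R_def)
            then have "4 * (L * (cmod (w x))\<^sup>2) \<le> (norm (mg w q x))\<^sup>2 + V x * (cmod (w x))\<^sup>2"
              using m by linarith
            then show ?thesis using False by simp
          qed
        qed
      qed (intro Bochner_Integration.integrable_diff integrable_mult_right ball_int mg_V_integrable w Sigma_pairD(7)[OF w])+
      also have "\<dots> = 1/4 * S - L * W"
        unfolding S_def W_def using mg_V_integrable[OF w] Sigma_pairD(7)[OF w]
        by (subst Bochner_Integration.integral_diff) simp_all
      finally have "- L * (LINT x|lborel. indicator (cball 0 R) x * (cmod (w x))\<^sup>2) \<le> 1/4 * S - L * W"
        by (simp only: integral_mult_right_zero)
      moreover have "L * (LINT x|lborel. indicator (cball 0 R) x * (cmod (w x))\<^sup>2) \<le> L * (C\<^sub>1 * (t - 1)\<^sup>2)"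
        using C1[OF t1 t(2)] L0 unfolding w_def by (rule mult_left_mono)
      ultimately show ?thesis by (simp add: mult.assoc)
    qed
    finally show "En (dilate t u) (dilate_grad t p) - En u p \<ge> - (L * C\<^sub>1 * (t - 1)\<^sup>2)" .
  qed
qed


section \<open>Derivative of the dilated energy at \<open>t = 1\<close> and the Pohozaev
  inequality\<close>

definition dmg :: "(R3 \<Rightarrow> R3) \<Rightarrow> (R3 \<Rightarrow> complex) \<Rightarrow> (R3 \<Rightarrow> complex ^ 3) \<Rightarrow> R3 \<Rightarrow> complex ^ 3" where
  "dmg b u p y = (\<chi> j. \<i> * p y $ j + of_real (b y $ j) * u y)"

text \<open>\<open>grad\<close> goes through a chosen derivative, so measurability is read off from
  a pointwise limit of difference quotients. At the origin the indicator makes them 0, which is also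
  the value of \<open>dV\<close> there.\<close>

lemma dV_measurable: "dV \<in> borel_measurable borel"
proof (rule borel_measurable_LIMSEQ_real)
  fix x
  show "(\<lambda>n. - (indicator (- {0}) x * ((V ((1 / (1 + 1 / real (Suc n))) *\<^sub>R x) - V x) / (1 / real (Suc n))))) \<longlonglongrightarrow> dV x"
  proof (cases "x = 0")
    case True
    then show ?thesis by (simp add: dV_def)
  next
    case False
    from tendsto_minus[OF V_inverse_ray_tendsto[OF this]] show ?thesis
      using False by simp
  qed
qed measurable

lemma dA_measurable: "dA \<in> borel_measurable borel"
proof -
  have "(\<lambda>x. dA x $ j) \<in> borel_measurable borel" for j
  proof (rule borel_measurable_LIMSEQ_real)
    fix x
    show "(\<lambda>n. - (indicator (- {0}) x * ((A ((1 / (1 + 1 / real (Suc n))) *\<^sub>R x) $ j - A x $ j) / (1 / real (Suc n))))) \<longlonglongrightarrow> dA x $ j"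
    proof (cases "x = 0")
      case True
      then show ?thesis by (simp add: dA_def)
    next
      case False
      from tendsto_minus[OF A_inverse_ray_tendsto[OF this]] show ?thesis
        using False by simp
    qed
  qed measurable
  then have "(\<lambda>x. \<chi> j. dA x $ j) \<in> borel_measurable borel"
    by (intro borel_measurable_vec_lambda)
  then show ?thesis by simp
qed

lemma dmg_norm_le:
  "(norm (dmg b u p y))\<^sup>2 \<le> 2 * (norm (p y))\<^sup>2 + 2 * ((norm (b y))\<^sup>2 * (cmod (u y))\<^sup>2)"
proof -
  let ?g = "\<chi> j. \<i> * p y $ j" and ?a = "\<chi> j. of_real (b y $ j) * u y"
  have "dmg b u p y = ?g + ?a" by (simp add: dmg_def vec_eq_iff)
  then have "(norm (dmg b u p y))\<^sup>2 \<le> (norm ?g + norm ?a)\<^sup>2"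
    by (simp only:) (intro power_mono norm_triangle_ineq norm_ge_zero)
  also have "\<dots> \<le> 2 * (norm ?g)\<^sup>2 + 2 * (norm ?a)\<^sup>2"
    using sum_squares_bound[of "norm ?g" "norm ?a"] unfolding power2_sum by linarith
  finally show ?thesis
    unfolding norm_mag_mult norm_ii_mult .
qed

text \<open>The right-hand side is the derivative of \<open>t \<mapsto> En (dilate t u) (dilate_grad t p)\<close> at \<open>t = 1\<close>; the
  Pohozaev identity says that it vanishes.\<close>

lemma pohozaev_inequality:
  assumes u: "Sigma_pair u p" and sol: "weak_solution \<mu> u p"
  shows "0 \<le> 1/2 * (LINT y|lborel. 2 * (mg u p y \<bullet> dmg (\<lambda>y. - dA y) u p y) - dV y * (cmod (u y))\<^sup>2)
    - 3/4 * (LINT y|lborel. cmod (u y) ^ 4)"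
    and "integrable lborel (\<lambda>y. 2 * (mg u p y \<bullet> dmg (\<lambda>y. - dA y) u p y) - dV y * (cmod (u y))\<^sup>2)"
proof -
  note [measurable] = Sigma_pairD(5,6)[OF u] mg_scaled_measurable[OF Sigma_pairD(5,6)[OF u]]
    mg_measurable[OF Sigma_pairD(5,6)[OF u]] dV_measurable dA_measurable
  define h where "h n = 1 / real (Suc n)" for n
  define t where "t n = 1 + h n" for n
  have h: "h n > 0" "h n \<le> 1" for n by (simp_all add: h_def)
  have t: "1 < t n" "t n \<le> 2" "1 \<le> t n" "t n > 0" for n using h[of n] by (simp_all add: t_def)
  have h_lim: "h \<longlonglongrightarrow> 0"
    unfolding h_def by (rule LIMSEQ_Suc[OF lim_1_over_n])
  \<comment> \<open>\<open>b n\<close> is the difference quotient of \<open>A\<close> in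
    \<open>t\<close>. Hence the scaled magnetic gradient is exactly \<open>mg u p\<close> plus
    \<open>h n\<close> times \<open>B n\<close>, and in the limit \<open>b n\<close> becomes
    \<open>- dA\<close>.\<close>
  define b where "b n y = (1 / h n) *\<^sub>R (A ((1 / t n) *\<^sub>R y) - A y)" for n y
  define B where "B n = dmg (b n) u p" for n
  define f where "f n y = 2 * (mg u p y \<bullet> B n y) + h n * (norm (B n y))\<^sup>2
      + (V ((1 / t n) *\<^sub>R y) - V y) / h n * (cmod (u y))\<^sup>2" for n y
  define f\<^sub>0 where "f\<^sub>0 y = 2 * (mg u p y \<bullet> dmg (\<lambda>y. - dA y) u p y) - dV y * (cmod (u y))\<^sup>2" for y
  have dmg_measurable: "dmg c u p \<in> borel_measurable borel" if [measurable]: "c \<in> borel_measurable borel" for c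
    unfolding dmg_def[abs_def] by (intro borel_measurable_vec_lambda) measurable
  have [measurable]: "B n \<in> borel_measurable borel" for n
    unfolding B_def b_def[abs_def] by (rule dmg_measurable) measurable
  have [measurable]: "dmg (\<lambda>y. - dA y) u p \<in> borel_measurable borel"
    by (rule dmg_measurable) measurable
  have f0_meas [measurable]: "f\<^sub>0 \<in> borel_measurable borel"
    unfolding f\<^sub>0_def[abs_def] by measurable
  have f_meas [measurable]: "f n \<in> borel_measurable borel" for n
    unfolding f_def[abs_def] by measurable
  have scaled: "mg_scaled (t n) u p y = mg u p y + h n *\<^sub>R B n y" for n y
    using h(1)[of n] by (simp add: mg_scaled_def mg_def B_def dmg_def b_def vec_eq_iff t_def
        scaleR_conv_of_real[where 'a = complex] field_simps)
  have b_le: "(norm (b n y))\<^sup>2 \<le> K * V y" if "y \<noteq> 0" for n y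
  proof -
    have s: "1/2 \<le> 1 / t n" "1 / t n < 1" using t[of n] by (simp_all add: divide_simps)
    have "1 - 1 / t n \<le> h n"
      using t[of n] h[of n] by (simp add: t_def field_simps)
    then have "(1 - 1 / t n)\<^sup>2 \<le> (h n)\<^sup>2" using s by (intro power_mono) auto
    then have "(norm (A ((1 / t n) *\<^sub>R y) - A y))\<^sup>2 \<le> (h n)\<^sup>2 * (K * V y)"
      using A_ray_diff_le[OF that s] K_ge(4) V_pos[OF that]
      by (elim order_trans) (intro mult_right_mono, simp_all)
    then show ?thesis
      using h(1)[of n] by (simp add: b_def power_mult_distrib power_divide pos_divide_le_eq mult.commute)
  qed
  have V_le: "\<bar>(V ((1 / t n) *\<^sub>R y) - V y) / h n\<bar> \<le> K * V y" if "y \<noteq> 0" for n y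
  proof -
    have s: "1/2 \<le> 1 / t n" "1 / t n < 1" using t[of n] by (simp_all add: divide_simps)
    have "1 - 1 / t n \<le> h n"
      using t[of n] h[of n] by (simp add: t_def field_simps)
    then have "\<bar>V ((1 / t n) *\<^sub>R y) - V y\<bar> \<le> h n * (K * V y)"
      using V_ray_diff_le[OF that s] K_ge(4) V_pos[OF that]
      by (elim order_trans) (intro mult_right_mono, simp_all)
    then show ?thesis
      using h(1)[of n] by (simp add: pos_divide_le_eq mult.commute)
  qed
  \<comment> \<open>The terms \<open>2 (mg . B)\<close> and \<open>h |B|^2\<close> cost
    \<open>|B|^2\<close> each, besides \<open>|mg|^2\<close>, and
    \<open>|B|^2 \<le> 2 |p|^2 + 2 K V |u|^2\<close>; this gives 4 twice, and the quotient of
    \<open>V\<close> raises the second to 5.\<close>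
  let ?D = "\<lambda>y. (norm (mg u p y))\<^sup>2 + 4 * (norm (p y))\<^sup>2 + 5 * (K * (V y * (cmod (u y))\<^sup>2))"
  have D_int: "integrable lborel ?D"
    using mg_L2[OF u] Sigma_pairD(4,8)[OF u]
    by (intro Bochner_Integration.integrable_add integrable_mult_right) (simp_all add: in_Lp_2_iff)
  have dom: "AE y in lborel. norm (f n y) \<le> ?D y" for n
    using AE_nonzero
  proof eventually_elim
    case (elim y)
    have "(norm (B n y))\<^sup>2 \<le> 2 * (norm (p y))\<^sup>2 + 2 * ((norm (b n y))\<^sup>2 * (cmod (u y))\<^sup>2)"
      unfolding B_def by (rule dmg_norm_le)
    moreover have "(norm (b n y))\<^sup>2 * (cmod (u y))\<^sup>2 \<le> (K * V y) * (cmod (u y))\<^sup>2"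
      by (rule mult_right_mono[OF b_le[OF elim]]) simp
    ultimately have B2: "(norm (B n y))\<^sup>2 \<le> 2 * (norm (p y))\<^sup>2 + 2 * (K * (V y * (cmod (u y))\<^sup>2))"
      by (simp add: mult.assoc)
    have 1: "\<bar>2 * (mg u p y \<bullet> B n y)\<bar> \<le> (norm (mg u p y))\<^sup>2 + (norm (B n y))\<^sup>2"
      using Cauchy_Schwarz_ineq2[of "mg u p y" "B n y"] sum_squares_bound[of "norm (mg u p y)" "norm (B n y)"]
      by simp
    have 2: "0 \<le> h n * (norm (B n y))\<^sup>2" "h n * (norm (B n y))\<^sup>2 \<le> 1 * (norm (B n y))\<^sup>2"
      using h[of n] by (simp, intro mult_right_mono) auto
    have 3: "\<bar>(V ((1 / t n) *\<^sub>R y) - V y) / h n * (cmod (u y))\<^sup>2\<bar> \<le> K * (V y * (cmod (u y))\<^sup>2)"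
      using mult_right_mono[OF V_le[OF elim], of "(cmod (u y))\<^sup>2" n] by (simp add: abs_mult mult.assoc)
    show ?case
      unfolding f_def real_norm_def using B2 1 2 3 by linarith
  qed
  have lim: "AE y in lborel. (\<lambda>n. f n y) \<longlonglongrightarrow> f\<^sub>0 y"
    using AE_nonzero
  proof eventually_elim
    case (elim y)
    have bl: "(\<lambda>n. b n y $ j) \<longlonglongrightarrow> - dA y $ j" for j
      using A_inverse_ray_tendsto[OF elim, of j] by (simp add: b_def t_def h_def mult.commute)
    have "(\<lambda>n. b n y) \<longlonglongrightarrow> - dA y"
      by (rule vec_tendstoI) (use bl in simp)
    then have Bl: "(\<lambda>n. B n y) \<longlonglongrightarrow> dmg (\<lambda>y. - dA y) u p y"
      unfolding B_def dmg_def by (intro tendsto_vec_lambda tendsto_intros)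
    have Vl: "(\<lambda>n. (V ((1 / t n) *\<^sub>R y) - V y) / h n) \<longlonglongrightarrow> - dV y"
      using V_inverse_ray_tendsto[OF elim] by (simp add: t_def h_def mult.commute)
    have "(\<lambda>n. f n y) \<longlonglongrightarrow> 2 * (mg u p y \<bullet> dmg (\<lambda>y. - dA y) u p y) + 0 * (norm (dmg (\<lambda>y. - dA y) u p y))\<^sup>2
        + - dV y * (cmod (u y))\<^sup>2"
      unfolding f_def by (intro tendsto_intros Bl h_lim Vl)
    then show ?case by (simp add: f\<^sub>0_def)
  qed
  have conv: "(\<lambda>n. LINT y|lborel. f n y) \<longlonglongrightarrow> (LINT y|lborel. f\<^sub>0 y)"
    by (rule integral_dominated_convergence[OF _ _ D_int lim dom]) measurable
  show f0_int: "integrable lborel (\<lambda>y. 2 * (mg u p y \<bullet> dmg (\<lambda>y. - dA y) u p y) - dV y * (cmod (u y))\<^sup>2)"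
    unfolding f\<^sub>0_def[symmetric]
    by (rule integrable_dominated_convergence[OF _ _ D_int lim dom]) measurable
  have f_int: "integrable lborel (f n)" for n
    by (rule Bochner_Integration.integrable_bound[OF D_int])
       (use dom[of n] in \<open>simp, eventually_elim, simp\<close>)
  obtain C where C: "\<And>t. 1 < t \<Longrightarrow> t \<le> 2 \<Longrightarrow> En (dilate t u) (dilate_grad t p) - En u p \<ge> - (C * (t - 1)\<^sup>2)"
    using energy_dilation_lower_bound[OF u sol] by blast
  define Q where "Q = (LINT y|lborel. cmod (u y) ^ 4)"
  \<comment> \<open>\<open>(t ^ 3 - 1) / h\<close> equals \<open>3 + 3 h + h^2\<close>; its limit 3
    is the source of the 3/4 in front of the quartic integral.\<close>
  have quot: "(En (dilate (t n) u) (dilate_grad (t n) p) - En u p) / h n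
    = 1/2 * (LINT y|lborel. f n y) - 1/4 * ((3 + 3 * h n + (h n)\<^sup>2) * Q)" for n
  proof -
    have i1: "integrable lborel (\<lambda>y. (norm (mg_scaled (t n) u p y))\<^sup>2 + V ((1 / t n) *\<^sub>R y) * (cmod (u y))\<^sup>2)"
      by (intro Bochner_Integration.integrable_add mg_scaled_integrable[OF u] V_scaled_integrable[OF Sigma_pairD(5,4)[OF u]] t)
    have "(norm (mg_scaled (t n) u p y))\<^sup>2 + V ((1 / t n) *\<^sub>R y) * (cmod (u y))\<^sup>2
      = ((norm (mg u p y))\<^sup>2 + V y * (cmod (u y))\<^sup>2) + h n * f n y" for y
    proof -
      have N: "(norm (mg_scaled (t n) u p y))\<^sup>2 = (norm (mg u p y))\<^sup>2 + h n * (2 * (mg u p y \<bullet> B n y) + h n * (norm (B n y))\<^sup>2)"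
        unfolding scaled power2_norm_eq_inner by (simp add: inner_add inner_commute algebra_simps)
      have "h n * ((V ((1 / t n) *\<^sub>R y) - V y) / h n * (cmod (u y))\<^sup>2) = (V ((1 / t n) *\<^sub>R y) - V y) * (cmod (u y))\<^sup>2"
        using h(1)[of n] by simp
      then show ?thesis
        using N unfolding f_def distrib_left left_diff_distrib by linarith
    qed
    then have "(LINT y|lborel. (norm (mg_scaled (t n) u p y))\<^sup>2 + V ((1 / t n) *\<^sub>R y) * (cmod (u y))\<^sup>2)
      = (LINT y|lborel. (norm (mg u p y))\<^sup>2 + V y * (cmod (u y))\<^sup>2) + h n * (LINT y|lborel. f n y)"
      using mg_V_integrable[OF u] f_int[of n] by simp
    moreover have "(t n) ^ 3 = 1 + h n * (3 + 3 * h n + (h n)\<^sup>2)"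
      by (simp add: t_def power3_eq_cube power2_eq_square algebra_simps)
    then have "(t n) ^ 3 * Q = Q + h n * ((3 + 3 * h n + (h n)\<^sup>2) * Q)"
      by (simp only: distrib_right[of 1] mult_1 mult.assoc)
    ultimately have "En (dilate (t n) u) (dilate_grad (t n) p) - En u p
      = h n * (1/2 * (LINT y|lborel. f n y) - 1/4 * ((3 + 3 * h n + (h n)\<^sup>2) * Q))"
      unfolding En_dilate[OF u t(3) t(2)] unfolding En_def Q_def[symmetric]
      by (simp only: distrib_left right_diff_distrib)
    then show ?thesis
      using h(1)[of n] by simp
  qed
  \<comment> \<open>Adding \<open>C h\<close> makes every term of the sequence nonnegative, and the
    correction vanishes in the limit.\<close>
  have "(\<lambda>n. 1/2 * (LINT y|lborel. f n y) - 1/4 * ((3 + 3 * h n + (h n)\<^sup>2) * Q) + C * h n)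
    \<longlonglongrightarrow> 1/2 * (LINT y|lborel. f\<^sub>0 y) - 1/4 * ((3 + 3 * 0 + 0\<^sup>2) * Q) + C * 0"
    by (intro tendsto_intros conv h_lim)
  moreover have "0 \<le> 1/2 * (LINT y|lborel. f n y) - 1/4 * ((3 + 3 * h n + (h n)\<^sup>2) * Q) + C * h n" for n
  proof -
    have "- (C * (h n)\<^sup>2) \<le> En (dilate (t n) u) (dilate_grad (t n) p) - En u p"
      using C[OF t(1)[of n] t(2)[of n]] by (simp add: t_def)
    then have "- (C * (h n)\<^sup>2) / h n \<le> (En (dilate (t n) u) (dilate_grad (t n) p) - En u p) / h n"
      using h(1)[of n] by (intro divide_right_mono) auto
    moreover have "- (C * (h n)\<^sup>2) / h n = - (C * h n)"
      using h(1)[of n] by (simp add: power2_eq_square)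
    ultimately show ?thesis unfolding quot by linarith
  qed
  ultimately have "0 \<le> 1/2 * (LINT y|lborel. f\<^sub>0 y) - 1/4 * ((3 + 3 * 0 + 0\<^sup>2) * Q) + C * 0"
    by (intro LIMSEQ_le_const) auto
  then show "0 \<le> 1/2 * (LINT y|lborel. 2 * (mg u p y \<bullet> dmg (\<lambda>y. - dA y) u p y) - dV y * (cmod (u y))\<^sup>2)
    - 3/4 * (LINT y|lborel. cmod (u y) ^ 4)"
    by (simp add: f\<^sub>0_def Q_def)
qed

text \<open>With \<open>g\<close>, \<open>a\<close>, \<open>d\<close> for \<open>\<i> p\<close>,
  \<open>A u\<close> and \<open>dA u\<close>, the right side is a quadratic form containing
  \<open>|g|^2 / 6\<close> and the cross terms \<open>2/3 g . a\<close> and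
  \<open>1/3 g . d\<close>. Young's inequality on both costs
  \<open>\<epsilon>\<^sub>0 / 3 + \<epsilon>\<^sub>0 / 6\<close> times \<open>|g|^2\<close>, which
  is below 1/6 since \<open>\<epsilon>\<^sub>0 < 1/3\<close>; what remains is \<open>Ttilde\<close>
  times \<open>|u|^2\<close>.\<close>

lemma Ttilde_density_bound:
  assumes "y \<noteq> 0"
  shows "\<alpha>\<^sub>0 * (V y * (cmod (u y))\<^sup>2) \<le> 1/2 * ((norm (mg u p y))\<^sup>2 + V y * (cmod (u y))\<^sup>2)
    - 1/6 * (2 * (mg u p y \<bullet> dmg (\<lambda>y. - dA y) u p y) - dV y * (cmod (u y))\<^sup>2)"
proof -
  define g a d where "g = (\<chi> j. \<i> * p y $ j)" "a = (\<chi> j. of_real (A y $ j) * u y)" "d = (\<chi> j. of_real (dA y $ j) * u y)"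
  define U where "U = (cmod (u y))\<^sup>2"
  have U: "U \<ge> 0" by (simp add: U_def)
  have mgy: "mg u p y = g + a" by (simp add: mg_def g_a_d_def vec_eq_iff)
  have dmgy: "dmg (\<lambda>y. - dA y) u p y = g - d" by (simp add: dmg_def g_a_d_def vec_eq_iff)
  have aa: "a \<bullet> a = (norm (A y))\<^sup>2 * U" "d \<bullet> d = (\<Sum>j\<in>UNIV. (dA y $ j)\<^sup>2) * U" "a \<bullet> d = (A y \<bullet> dA y) * U"
  proof -
    have "(\<Sum>j\<in>UNIV. (dA y $ j)\<^sup>2) = dA y \<bullet> dA y"
      by (simp add: inner_vec_def power2_eq_square)
    then show "a \<bullet> a = (norm (A y))\<^sup>2 * U" "d \<bullet> d = (\<Sum>j\<in>UNIV. (dA y $ j)\<^sup>2) * U" "a \<bullet> d = (A y \<bullet> dA y) * U"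
      by (simp_all only: g_a_d_def inner_mag_mult U_def power2_norm_eq_inner[of "A y"])
  qed
  have young: "- (2 * (x \<bullet> z)) \<le> \<epsilon>\<^sub>0 * (x \<bullet> x) + 1 / \<epsilon>\<^sub>0 * (z \<bullet> z)" for x z :: "complex ^ 3"
  proof -
    have "0 \<le> (1 / \<epsilon>\<^sub>0) * ((\<epsilon>\<^sub>0 *\<^sub>R x + z) \<bullet> (\<epsilon>\<^sub>0 *\<^sub>R x + z))"
      using \<epsilon>\<^sub>0 by (intro mult_nonneg_nonneg inner_ge_zero) simp
    also have "\<dots> = \<epsilon>\<^sub>0 * (x \<bullet> x) + 2 * (x \<bullet> z) + 1 / \<epsilon>\<^sub>0 * (z \<bullet> z)"
      using \<epsilon>\<^sub>0(1) by (simp add: inner_add inner_commute field_simps)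
    finally show ?thesis by linarith
  qed
  have gg: "0 \<le> (1/6 - \<epsilon>\<^sub>0 / 2) * (g \<bullet> g)"
    using \<epsilon>\<^sub>0 by (intro mult_nonneg_nonneg inner_ge_zero) simp
  have "\<alpha>\<^sub>0 * (V y * U) \<le> Ttilde A V \<epsilon>\<^sub>0 y * U"
    using mult_right_mono[OF Ttilde_ge[OF assms] U] by (simp add: mult.assoc)
  also have "Ttilde A V \<epsilon>\<^sub>0 y * U = 1/2 * (V y * U) + 1/6 * (dV y * U) + (1/2 - 1 / (3 * \<epsilon>\<^sub>0)) * (a \<bullet> a)
      - 1 / (6 * \<epsilon>\<^sub>0) * (d \<bullet> d) + 1/3 * (a \<bullet> d)"
    unfolding Ttilde_def aa dV_def[symmetric] by (simp add: dA_def inner_vec_def[of "A y"] algebra_simps)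
  also have "\<dots> \<le> 1/2 * ((g + a) \<bullet> (g + a) + V y * U) - 1/6 * (2 * ((g + a) \<bullet> (g - d)) - dV y * U)"
  proof -
    have "1/2 * ((g + a) \<bullet> (g + a) + V y * U) - 1/6 * (2 * ((g + a) \<bullet> (g - d)) - dV y * U)
      = 1/6 * (g \<bullet> g) + 2/3 * (g \<bullet> a) + 1/3 * (g \<bullet> d) + 1/2 * (a \<bullet> a) + 1/3 * (a \<bullet> d) + 1/2 * (V y * U) + 1/6 * (dV y * U)"
      by (simp add: inner_add inner_diff inner_commute[of a g] field_simps)
    moreover have "(1/6 - \<epsilon>\<^sub>0 / 2) * (g \<bullet> g) = 1/6 * (g \<bullet> g) - 1/3 * (\<epsilon>\<^sub>0 * (g \<bullet> g)) - 1/6 * (\<epsilon>\<^sub>0 * (g \<bullet> g))"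
      by (simp add: field_simps)
    moreover have "(1/2 - 1 / (3 * \<epsilon>\<^sub>0)) * (a \<bullet> a) = 1/2 * (a \<bullet> a) - 1/3 * (1 / \<epsilon>\<^sub>0 * (a \<bullet> a))"
      "1 / (6 * \<epsilon>\<^sub>0) * (d \<bullet> d) = 1/6 * (1 / \<epsilon>\<^sub>0 * (d \<bullet> d))"
      by (simp_all add: left_diff_distrib)
    ultimately show ?thesis
      using young[of g a] young[of g d] gg by linarith
  qed
  finally show ?thesis
    unfolding mgy dmgy U_def power2_norm_eq_inner[of "g + a"] .
qed

text \<open>One third of the Pohozaev inequality bounds a quarter of the quartic integral by 1/6 of
  the integral of \<open>?f\<close>; substituted into the energy, this leaves the density estimated
  in \<open>Ttilde_density_bound\<close>.\<close>

lemma weak_solution_energy_bound: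
  assumes u: "Sigma_pair u p" and sol: "weak_solution \<mu> u p"
  shows "\<alpha>\<^sub>0 * (LINT x|lborel. V x * (cmod (u x))\<^sup>2) \<le> En u p"
proof -
  let ?f = "\<lambda>y. 2 * (mg u p y \<bullet> dmg (\<lambda>y. - dA y) u p y) - dV y * (cmod (u y))\<^sup>2"
  note P = pohozaev_inequality[OF u sol]
  have "(LINT y|lborel. \<alpha>\<^sub>0 * (V y * (cmod (u y))\<^sup>2))
    \<le> (LINT y|lborel. 1/2 * ((norm (mg u p y))\<^sup>2 + V y * (cmod (u y))\<^sup>2) - 1/6 * ?f y)"
  proof (rule integral_mono_AE)
    show "AE y in lborel. \<alpha>\<^sub>0 * (V y * (cmod (u y))\<^sup>2)
      \<le> 1/2 * ((norm (mg u p y))\<^sup>2 + V y * (cmod (u y))\<^sup>2) - 1/6 * ?f y"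
      using AE_nonzero by eventually_elim (rule Ttilde_density_bound)
  qed (intro Bochner_Integration.integrable_diff integrable_mult_right P(2) mg_V_integrable[OF u] Sigma_pairD(4)[OF u])+
  also have "\<dots> = 1/2 * (LINT y|lborel. (norm (mg u p y))\<^sup>2 + V y * (cmod (u y))\<^sup>2) - 1/6 * (LINT y|lborel. ?f y)"
    by (simp only: Bochner_Integration.integral_diff[OF integrable_mult_right[OF mg_V_integrable[OF u]] integrable_mult_right[OF P(2)]]
        integral_mult_right_zero)
  also have "\<dots> \<le> En u p"
    using P(1) unfolding En_def by linarith
  finally show ?thesis by (simp only: integral_mult_right_zero)
qed

end

subsection \<open>Reduction to the energy bound\<close>

lemma Lp_norm_2_power2: "(Lp_norm 2 f)\<^sup>2 = (LINT x|lborel. (norm (f x))\<^sup>2)"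
proof -
  have "0 \<le> (LINT x|lborel. (norm (f x))\<^sup>2)" by (intro integral_nonneg_AE) simp
  then show ?thesis
    by (simp add: Lp_norm_def powr_numeral powr_half_sqrt)
qed

lemma Lp_norm_4_power4: "Lp_norm 4 f ^ 4 = (LINT x|lborel. norm (f x) ^ 4)"
proof -
  define I where "I = (LINT x|lborel. norm (f x) ^ 4)"
  have I: "0 \<le> I" unfolding I_def by (intro integral_nonneg_AE) simp
  have "Lp_norm 4 f = I powr (1/4)"
    by (simp add: Lp_norm_def I_def powr_numeral)
  moreover have "(I powr (1/4)) ^ 4 = I"
  proof (cases "I = 0")
    case False
    then have "(I powr (1/4)) ^ 4 = (I powr (1/4)) powr 4"
      using I by (simp add: powr_numeral)
    also have "\<dots> = I"
      using I False by (simp add: powr_powr)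
    finally show ?thesis .
  qed simp
  ultimately show ?thesis by (simp add: I_def)
qed

lemma Lp_norm_2_eq_1: "(LINT x|lborel. (norm (f x))\<^sup>2) = 1 \<Longrightarrow> Lp_norm 2 f = 1"
  by (simp add: Lp_norm_def powr_numeral)

lemma admissible_imp_pohozaev_pair:
  assumes adm: "admissible A V" and poh: "pohozaev_condition A V"
  obtains \<alpha> M \<epsilon>\<^sub>0 \<alpha>\<^sub>0 where "pohozaev_pair A V \<alpha> M \<epsilon>\<^sub>0 \<alpha>\<^sub>0"
proof -
  define N where "N x = \<bar>x \<bullet> grad V x\<bar> + (\<Sum>j\<in>UNIV. (norm x)\<^sup>2 * (norm (grad (\<lambda>y. A y $ j) x))\<^sup>2)" for x
  obtain \<alpha> where \<alpha>: "\<alpha> > 0" "\<And>x. x \<noteq> 0 \<Longrightarrow> V x \<ge> \<alpha> * (norm (A x))\<^sup>2"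
    using adm unfolding admissible_def by blast
  have meas: "A \<in> borel_measurable borel" "V \<in> borel_measurable borel"
    using adm unfolding admissible_def in_Lp_loc_def by simp_all
  have diff: "A differentiable (at x)" "V differentiable (at x)" if "x \<noteq> 0" for x
    using adm that unfolding admissible_def C1_on_def by simp_all
  have lim: "filterlim V at_top at_infinity"
    using adm unfolding admissible_def by blast
  have sup: "(SUP x \<in> - {0}. ereal (N x / V x)) < \<infinity>"
    using poh unfolding pohozaev_condition_def N_def by (rule conjunct1)
  obtain \<epsilon>\<^sub>0 \<alpha>\<^sub>0 where \<epsilon>: "0 < \<epsilon>\<^sub>0" "\<epsilon>\<^sub>0 < 1/3" "0 < \<alpha>\<^sub>0"
    and inf: "ereal \<alpha>\<^sub>0 \<le> (INF x \<in> - {0}. ereal (Ttilde A V \<epsilon>\<^sub>0 x / V x))"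
    using poh unfolding pohozaev_condition_def by blast
  obtain m :: nat where m: "(SUP x \<in> - {0}. ereal (N x / V x)) < ereal (real m)"
    using sup less_PInf_Ex_of_nat[of "SUP x \<in> - {0}. ereal (N x / V x)"] by auto
  have T: "\<alpha>\<^sub>0 \<le> Ttilde A V \<epsilon>\<^sub>0 x / V x" if "x \<noteq> 0" for x
  proof -
    have "ereal \<alpha>\<^sub>0 \<le> ereal (Ttilde A V \<epsilon>\<^sub>0 x / V x)"
      by (rule order_trans[OF inf INF_lower]) (use that in simp)
    then show ?thesis by simp
  qed
  \<comment> \<open>Division by zero yields 0, so a zero of \<open>V\<close> would contradict the
    lower bound \<open>\<alpha>\<^sub>0 > 0\<close> on the quotient; the sign then comes from
    admissibility.\<close>
  have V_pos: "V x > 0" if "x \<noteq> 0" for x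
  proof -
    have "V x \<noteq> 0" using T[OF that] \<epsilon>(3) by (cases "V x = 0") simp_all
    moreover have "0 \<le> \<alpha> * (norm (A x))\<^sup>2" using \<alpha>(1) by simp
    then have "V x \<ge> 0" using \<alpha>(2)[OF that] by linarith
    ultimately show ?thesis by simp
  qed
  have Nle: "N x \<le> real m * V x" if "x \<noteq> 0" for x
  proof -
    have "ereal (N x / V x) \<le> (SUP x \<in> - {0}. ereal (N x / V x))"
      by (rule SUP_upper) (use that in simp)
    also have "\<dots> \<le> ereal (real m)" using m by (rule less_imp_le)
    finally have "ereal (N x / V x) \<le> ereal (real m)" .
    then have "N x / V x \<le> real m" by simp
    then show ?thesis using V_pos[OF that] by (simp add: pos_divide_le_eq)
  qed
  have "pohozaev_pair A V \<alpha> (real m) \<epsilon>\<^sub>0 \<alpha>\<^sub>0"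
  proof
    show "A \<in> borel_measurable borel" "V \<in> borel_measurable borel" by (rule meas)+
    show "\<alpha> > 0" "0 < \<epsilon>\<^sub>0" "\<epsilon>\<^sub>0 < 1/3" "0 < \<alpha>\<^sub>0" by (rule \<alpha> \<epsilon>)+
    show "filterlim V at_top at_infinity" by (rule lim)
    fix x :: R3 assume x: "x \<noteq> 0"
    show "\<alpha> * (norm (A x))\<^sup>2 \<le> V x" by (rule \<alpha>(2)[OF x])
    show "V x > 0" by (rule V_pos[OF x])
    show "A differentiable (at x)" "V differentiable (at x)" by (rule diff[OF x])+
    show "\<bar>x \<bullet> grad V x\<bar> + (\<Sum>j\<in>UNIV. (norm x)\<^sup>2 * (norm (grad (\<lambda>y. A y $ j) x))\<^sup>2) \<le> real m * V x"
      using Nle[OF x] unfolding N_def .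
    show "\<alpha>\<^sub>0 * V x \<le> Ttilde A V \<epsilon>\<^sub>0 x"
      using T[OF x] V_pos[OF x] by (simp add: pos_le_divide_eq)
  qed
  then show ?thesis by (rule that)
qed

lemma Re_mult_cnj: "Re (a * cnj b) = a \<bullet> b"
  by (simp add: inner_complex_def)

lemma norm_sum_mult_cnj_le:
  fixes a b :: "complex ^ 3"
  shows "cmod (\<Sum>j\<in>UNIV. a $ j * cnj (b $ j)) \<le> norm a * norm b"
proof -
  have "cmod (\<Sum>j\<in>UNIV. a $ j * cnj (b $ j)) \<le> (\<Sum>j\<in>UNIV. \<bar>cmod (a $ j)\<bar> * \<bar>cmod (b $ j)\<bar>)"
    by (rule order_trans[OF norm_sum]) (simp add: norm_mult)
  also have "\<dots> \<le> norm a * norm b"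
    unfolding norm_vec_def by (rule L2_set_mult_ineq)
  finally show ?thesis .
qed

lemma two_product_le_sum_squares: "0 \<le> a \<Longrightarrow> 0 \<le> b \<Longrightarrow> a * b \<le> a\<^sup>2 + (b\<^sup>2 :: real)"
  using sum_squares_bound[of a b] mult_nonneg_nonneg[of a b] by linarith

section \<open>Positive energy of solutions and the eigenvalue bound\<close>

context pohozaev_pair
begin

lemma energy_eq_En: "Sigma_pair u p \<Longrightarrow> energy A V u = En u p"
  by (simp add: energy_def En_def Sigma_sq_eq)

lemma integral_V_pos:
  assumes u: "Sigma_pair u p" and pos: "(LINT x|lborel. (cmod (u x))\<^sup>2) > 0"
  shows "(LINT x|lborel. V x * (cmod (u x))\<^sup>2) > 0"
proof -
  have nn: "AE x in lborel. 0 \<le> V x * (cmod (u x))\<^sup>2"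
    using AE_nonzero by eventually_elim (simp add: V_pos less_imp_le)
  have "(LINT x|lborel. V x * (cmod (u x))\<^sup>2) \<noteq> 0"
  proof
    assume "(LINT x|lborel. V x * (cmod (u x))\<^sup>2) = 0"
    then have "AE x in lborel. V x * (cmod (u x))\<^sup>2 = 0"
      using integral_nonneg_eq_0_iff_AE[OF Sigma_pairD(4)[OF u] nn] by simp
    with AE_nonzero have "AE x in lborel. (cmod (u x))\<^sup>2 = 0"
    proof eventually_elim
      case (elim x)
      then show ?case using V_pos[of x] by simp
    qed
    then have "(LINT x|lborel. (cmod (u x))\<^sup>2) = 0"
      by (rule integral_eq_zero_AE)
    with pos show False by simp
  qed
  moreover have "(LINT x|lborel. V x * (cmod (u x))\<^sup>2) \<ge> 0"
    using nn by (rule integral_nonneg_AE)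
  ultimately show ?thesis by simp
qed

lemma Sigma_sq_pos:
  assumes u: "Sigma_pair u p" and pos: "(LINT x|lborel. (cmod (u x))\<^sup>2) > 0"
  shows "Sigma_sq A V u > 0"
proof -
  have "(LINT x|lborel. V x * (cmod (u x))\<^sup>2) \<le> Sigma_sq A V u"
    unfolding Sigma_sq_eq[OF u]
    by (intro integral_mono mg_V_integrable[OF u] Sigma_pairD(4)[OF u]) simp
  then show ?thesis using integral_V_pos[OF u pos] by linarith
qed

lemma Sigma_sq_scaleR:
  assumes u: "Sigma_pair u p"
  shows "Sigma_sq A V (\<lambda>x. a *\<^sub>R u x) = a\<^sup>2 * Sigma_sq A V u"
proof -
  have "(norm (a *\<^sub>R mg u p x))\<^sup>2 + V x * (cmod (a *\<^sub>R u x))\<^sup>2 = a\<^sup>2 * ((norm (mg u p x))\<^sup>2 + V x * (cmod (u x))\<^sup>2)" for x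
    by (simp add: power_mult_distrib distrib_left)
  then show ?thesis
    unfolding Sigma_sq_eq[OF Sigma_pair_scaleR[OF u]] Sigma_sq_eq[OF u] mg_scaleR
    by (simp only: integral_mult_right_zero)
qed

text \<open>The real part passes under the integral once the complex integrand is known to be
  integrable, which is the bulk of the argument. There \<open>Re (a * cnj b)\<close> is the real
  inner product, and \<open>mag_grad\<close> agrees with \<open>mg\<close> almost
  everywhere.\<close>

lemma is_solution_imp_weak_solution:
  assumes u: "Sigma_pair u p" and sol: "is_solution A V c u"
  obtains \<mu> where "weak_solution \<mu> u p"
proof -
  obtain \<mu> where \<mu>: "\<And>v. v \<in> Sigma_space A V \<Longrightarrow> Re (LINT x|lborel.
              (\<Sum>j\<in>UNIV. mag_grad A u x $ j * cnj (mag_grad A v x $ j))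
              + of_real (V x - \<mu>) * u x * cnj (v x)
              - of_real ((cmod (u x))\<^sup>2) * u x * cnj (v x)) = 0"
    using sol unfolding is_solution_def by blast
  have "weak_solution \<mu> u p"
    unfolding weak_solution_def
  proof (intro allI impI)
    fix v q assume v: "Sigma_pair v q"
    let ?a = "mag_grad A u" and ?b = "mag_grad A v"
    define F where "F x = (\<Sum>j\<in>UNIV. ?a x $ j * cnj (?b x $ j))
              + of_real (V x - \<mu>) * u x * cnj (v x) - of_real ((cmod (u x))\<^sup>2) * u x * cnj (v x)" for x
    have ab: "in_Lp 2 ?a" "in_Lp 2 ?b"
      by (rule mag_grad_props(1)[OF Sigma_pair_imp_Sigma_space[OF u]],
          rule mag_grad_props(1)[OF Sigma_pair_imp_Sigma_space[OF v]])
    note [measurable] = in_Lp_measurable[OF ab(1)] in_Lp_measurable[OF ab(2)] Sigma_pairD(5)[OF u] Sigma_pairD(5)[OF v]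
      in_Lp_measurable[OF mg_L2[OF u]] in_Lp_measurable[OF mg_L2[OF v]]
    have cnj_meas [measurable]: "(\<lambda>x. cnj (f x)) \<in> borel_measurable borel" if [measurable]: "f \<in> borel_measurable borel" for f :: "R3 \<Rightarrow> complex"
      by (rule measurable_compose[OF that borel_measurable_continuous_onI]) (intro continuous_intros)
    have F_meas [measurable]: "F \<in> borel_measurable borel"
      unfolding F_def[abs_def] by measurable
    \<comment> \<open>The bilinear terms are dominated by squares and the cubic one by fourth
      powers, which the Sobolev embedding makes integrable.\<close>
    let ?D = "\<lambda>x. ((norm (?a x))\<^sup>2 + (norm (?b x))\<^sup>2) + (V x * (cmod (u x))\<^sup>2 + V x * (cmod (v x))\<^sup>2)
      + \<bar>\<mu>\<bar> * ((cmod (u x))\<^sup>2 + (cmod (v x))\<^sup>2) + (cmod (u x) ^ 4 + cmod (v x) ^ 4)"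
    have D_int: "integrable lborel ?D"
      using ab Sigma_pairD(4,7)[OF u] Sigma_pairD(4,7)[OF v] Sigma_pair_L4[OF u] Sigma_pair_L4[OF v]
      by (intro Bochner_Integration.integrable_add integrable_mult_right) (simp_all add: in_Lp_2_iff)
    have "AE x in lborel. norm (F x) \<le> norm (?D x)"
      using AE_nonzero
    proof eventually_elim
      case (elim x)
      let ?z = "\<Sum>j\<in>UNIV. ?a x $ j * cnj (?b x $ j)"
      have "norm (F x) \<le> cmod (?z + of_real (V x - \<mu>) * u x * cnj (v x)) + cmod (of_real ((cmod (u x))\<^sup>2) * u x * cnj (v x))"
        unfolding F_def by (rule norm_triangle_ineq4)
      moreover have "cmod (?z + of_real (V x - \<mu>) * u x * cnj (v x)) \<le> cmod ?z + cmod (of_real (V x - \<mu>) * u x * cnj (v x))"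
        by (rule norm_triangle_ineq)
      moreover have "cmod ?z \<le> (norm (?a x))\<^sup>2 + (norm (?b x))\<^sup>2"
        by (rule order_trans[OF norm_sum_mult_cnj_le two_product_le_sum_squares]) simp_all
      moreover have "cmod (of_real (V x - \<mu>) * u x * cnj (v x)) \<le> (V x * (cmod (u x))\<^sup>2 + V x * (cmod (v x))\<^sup>2)
        + \<bar>\<mu>\<bar> * ((cmod (u x))\<^sup>2 + (cmod (v x))\<^sup>2)"
      proof -
        have "cmod (of_real (V x - \<mu>) * u x * cnj (v x)) = \<bar>V x - \<mu>\<bar> * (cmod (u x) * cmod (v x))"
          unfolding norm_mult norm_of_real complex_mod_cnj by (rule mult.assoc)
        also have "\<dots> \<le> (V x + \<bar>\<mu>\<bar>) * ((cmod (u x))\<^sup>2 + (cmod (v x))\<^sup>2)"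
          using V_pos[OF elim] by (intro mult_mono two_product_le_sum_squares) auto
        finally show ?thesis by (simp add: distrib_left distrib_right)
      qed
      moreover have "cmod (of_real ((cmod (u x))\<^sup>2) * u x * cnj (v x)) \<le> cmod (u x) ^ 4 + cmod (v x) ^ 4"
      proof -
        have "cmod (of_real ((cmod (u x))\<^sup>2) * u x * cnj (v x)) = cmod (u x) ^ 3 * cmod (v x)"
          unfolding norm_mult norm_of_real complex_mod_cnj by (simp add: power2_eq_square power3_eq_cube)
        also have "\<dots> \<le> cmod (u x) ^ 4 + cmod (v x) ^ 4"
          by (rule cubic_term_bound) simp_all
        finally show ?thesis .
      qed
      ultimately have "norm (F x) \<le> ?D x" by linarith
      then show ?case by (simp only: real_norm_def)
    qed
    then have F_int: "integrable lborel F"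
      by (rule Bochner_Integration.integrable_bound[OF D_int, rotated]) measurable
    have "(LINT x|lborel. mg u p x \<bullet> mg v q x + (V x - \<mu>) * (u x \<bullet> v x) - (cmod (u x))\<^sup>2 * (u x \<bullet> v x)) = (LINT x|lborel. Re (F x))"
    proof (rule integral_cong_AE)
      show "AE x in lborel. mg u p x \<bullet> mg v q x + (V x - \<mu>) * (u x \<bullet> v x) - (cmod (u x))\<^sup>2 * (u x \<bullet> v x) = Re (F x)"
        using mag_grad_AE_eq[OF u] mag_grad_AE_eq[OF v]
      proof eventually_elim
        case (elim x)
        have s: "Re (of_real s * u x * cnj (v x)) = s * (u x \<bullet> v x)" for s
          by (simp only: Re_mult_cnj scaleR_conv_of_real[symmetric] inner_scaleR_left)
        show ?case
          unfolding F_def minus_complex.simps plus_complex.simps s unfolding Re_sum Re_mult_cnj elim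
          by (simp add: inner_vec_def)
      qed
    qed measurable
    also have "\<dots> = Re (LINT x|lborel. F x)"
      by (rule integral_Re[OF F_int])
    also have "\<dots> = 0"
      unfolding F_def by (rule \<mu>[OF Sigma_pair_imp_Sigma_space[OF v]])
    finally show "(LINT x|lborel. mg u p x \<bullet> mg v q x + (V x - \<mu>) * (u x \<bullet> v x) - (cmod (u x))\<^sup>2 * (u x \<bullet> v x)) = 0" .
  qed
  then show ?thesis by (rule that)
qed

lemma solution_energy_pos:
  assumes sol: "is_solution A V c u" and c: "c > 0"
  shows "energy A V u > 0"
proof -
  have u_in: "u \<in> Sigma_space A V" and mass: "(LINT x|lborel. (cmod (u x))\<^sup>2) = c"
    using sol unfolding is_solution_def mass_sphere_def Lp_norm_2_power2 by blast+
  obtain p where u: "Sigma_pair u p"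
    using Sigma_space_imp_Sigma_pair[OF u_in] by blast
  obtain \<mu> where \<mu>: "weak_solution \<mu> u p"
    using is_solution_imp_weak_solution[OF u sol] by blast
  have "0 < \<alpha>\<^sub>0 * (LINT x|lborel. V x * (cmod (u x))\<^sup>2)"
    using \<alpha>\<^sub>0 integral_V_pos[OF u] mass c by simp
  also have "\<dots> \<le> energy A V u"
    unfolding energy_eq_En[OF u] by (rule weak_solution_energy_bound[OF u \<mu>])
  finally show ?thesis .
qed

lemma first_eigenvalue_eq:
  assumes "first_eigenfunction A V \<psi>"
  shows "first_eigenvalue A V = Sigma_sq A V \<psi>"
  unfolding first_eigenvalue_def
  by (rule cInf_eq_minimum) (use assms in \<open>auto simp: first_eigenfunction_def\<close>)

text \<open>Rescaling to mass 1 and minimality of \<open>\<psi>\<close>. With \<open>u\<close> in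
  the ball, it puts the competitor \<open>sqrt c \<psi>\<close>, whose squared energy norm is
  \<open>c\<close> times the eigenvalue, into the ball as well.\<close>

lemma eigenvalue_times_mass_le:
  assumes \<psi>: "first_eigenfunction A V \<psi>" and u: "u \<in> mass_sphere A V c" and c: "c > 0"
  shows "c * Sigma_sq A V \<psi> \<le> Sigma_sq A V u"
proof -
  have u_in: "u \<in> Sigma_space A V" and mass: "(LINT x|lborel. (cmod (u x))\<^sup>2) = c"
    using u unfolding mass_sphere_def Lp_norm_2_power2 by blast+
  obtain p where up: "Sigma_pair u p"
    using Sigma_space_imp_Sigma_pair[OF u_in] by blast
  let ?a = "1 / sqrt c"
  have a2: "?a\<^sup>2 = 1 / c" using c by (simp add: power_divide)
  have "(LINT x|lborel. (cmod (?a *\<^sub>R u x))\<^sup>2) = (LINT x|lborel. ?a\<^sup>2 * (cmod (u x))\<^sup>2)"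
    by (simp add: power_mult_distrib power_divide)
  also have "\<dots> = 1" unfolding integral_mult_right_zero mass a2 using c by simp
  finally have 1: "Lp_norm 2 (\<lambda>x. ?a *\<^sub>R u x) = 1"
    by (rule Lp_norm_2_eq_1)
  have "(\<lambda>x. ?a *\<^sub>R u x) \<in> Sigma_space A V"
    by (rule Sigma_pair_imp_Sigma_space[OF Sigma_pair_scaleR[OF up]])
  with 1 \<psi> have "Sigma_sq A V \<psi> \<le> Sigma_sq A V (\<lambda>x. ?a *\<^sub>R u x)"
    unfolding first_eigenfunction_def by blast
  then have "Sigma_sq A V \<psi> \<le> 1 / c * Sigma_sq A V u"
    unfolding Sigma_sq_scaleR[OF up] a2 .
  then show ?thesis using c by (simp add: field_simps)
qed

end

theorem proposition1p5:
  fixes A :: "real ^ 3 \<Rightarrow> real ^ 3" and V :: "real ^ 3 \<Rightarrow> real"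
    and \<psi> :: "real ^ 3 \<Rightarrow> complex" and c r :: real
  assumes "admissible A V"
    and "pohozaev_condition A V"
    and "first_eigenfunction A V \<psi>"
    and "c \<ge> 2 * (first_eigenvalue A V / (Lp_norm 4 \<psi>) ^ 4)"
    and "r > 0"
  shows "\<not> (\<exists>u \<in> mass_sphere A V c \<inter> Sigma_ball A V r.
           ereal (energy A V u) = local_min_energy A V r c \<and> is_solution A V c u)"
proof
  obtain \<alpha> M \<epsilon>\<^sub>0 \<alpha>\<^sub>0 where "pohozaev_pair A V \<alpha> M \<epsilon>\<^sub>0 \<alpha>\<^sub>0"
    using admissible_imp_pohozaev_pair[OF assms(1,2)] .
  then interpret pohozaev_pair A V \<alpha> M \<epsilon>\<^sub>0 \<alpha>\<^sub>0 .
  define \<Lambda> where "\<Lambda> = Sigma_sq A V \<psi>"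
  define Q where "Q = (LINT x|lborel. cmod (\<psi> x) ^ 4)"
  have \<psi>_in: "\<psi> \<in> Sigma_space A V" and \<psi>1: "Lp_norm 2 \<psi> = 1"
    using assms(3) unfolding first_eigenfunction_def by blast+
  have \<psi>_mass: "(LINT x|lborel. (cmod (\<psi> x))\<^sup>2) = 1"
    unfolding Lp_norm_2_power2[symmetric] \<psi>1 by simp
  obtain p where \<psi>: "Sigma_pair \<psi> p"
    using Sigma_space_imp_Sigma_pair[OF \<psi>_in] by blast
  have \<Lambda>: "\<Lambda> > 0"
    unfolding \<Lambda>_def using Sigma_sq_pos[OF \<psi>] \<psi>_mass by simp
  have Q: "Q > 0"
  proof -
    have "Q \<noteq> 0"
    proof
      assume "Q = 0"
      then have "AE x in lborel. cmod (\<psi> x) ^ 4 = 0"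
        unfolding Q_def using integral_nonneg_eq_0_iff_AE[OF Sigma_pair_L4[OF \<psi>]] by simp
      then have "AE x in lborel. (cmod (\<psi> x))\<^sup>2 = 0"
        by eventually_elim simp
      then have "(LINT x|lborel. (cmod (\<psi> x))\<^sup>2) = 0"
        by (rule integral_eq_zero_AE)
      with \<psi>_mass show False by simp
    qed
    moreover have "Q \<ge> 0" unfolding Q_def by (intro integral_nonneg_AE) simp
    ultimately show ?thesis by simp
  qed
  have c: "c \<ge> 2 * (\<Lambda> / Q)"
    using assms(4) unfolding first_eigenvalue_eq[OF assms(3)] Lp_norm_4_power4 \<Lambda>_def Q_def .
  \<comment> \<open>Positivity of \<open>c\<close> is inherited from the threshold; a function of
    mass 0 would have zero energy.\<close>
  have "0 < 2 * (\<Lambda> / Q)" using \<Lambda> Q by simp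
  with c have c_pos: "c > 0" by linarith
  have cQ: "2 * \<Lambda> \<le> c * Q" using c Q by (simp add: pos_divide_le_eq)

  assume "\<exists>u \<in> mass_sphere A V c \<inter> Sigma_ball A V r.
           ereal (energy A V u) = local_min_energy A V r c \<and> is_solution A V c u"
  then obtain u where u: "u \<in> mass_sphere A V c" "u \<in> Sigma_ball A V r"
    and min: "ereal (energy A V u) = local_min_energy A V r c" and sol: "is_solution A V c u"
    by blast
  have pos: "energy A V u > 0" by (rule solution_energy_pos[OF sol c_pos])

  define v where "v x = sqrt c *\<^sub>R \<psi> x" for x
  have v: "Sigma_pair v (\<lambda>x. sqrt c *\<^sub>R p x)"
    unfolding v_def[abs_def] by (rule Sigma_pair_scaleR[OF \<psi>])
  have v_Sigma: "Sigma_sq A V v = c * \<Lambda>"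
    unfolding v_def[abs_def] Sigma_sq_scaleR[OF \<psi>] \<Lambda>_def using c_pos by simp
  have "(LINT x|lborel. (cmod (v x))\<^sup>2) = c * (LINT x|lborel. (cmod (\<psi> x))\<^sup>2)"
    using c_pos by (simp add: v_def power_mult_distrib)
  then have "v \<in> mass_sphere A V c"
    using Sigma_pair_imp_Sigma_space[OF v] \<psi>_mass
    unfolding mass_sphere_def Lp_norm_2_power2 by simp
  moreover have "v \<in> Sigma_ball A V r"
    using Sigma_pair_imp_Sigma_space[OF v] eigenvalue_times_mass_le[OF assms(3) u(1) c_pos] u(2) v_Sigma
    unfolding Sigma_ball_def \<Lambda>_def by simp
  ultimately have "local_min_energy A V r c \<le> ereal (energy A V v)"
    unfolding local_min_energy_def by (intro INF_lower) simp
  moreover have "energy A V v \<le> 0"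
  proof -
    have "(sqrt c) ^ 4 = c\<^sup>2" using c_pos by (metis (no_types) less_imp_le mult_2_right numeral_Bit0 power_add power_even_eq real_sqrt_pow2)
    then have "(LINT x|lborel. cmod (v x) ^ 4) = c\<^sup>2 * Q"
      using c_pos by (simp add: v_def Q_def power_mult_distrib)
    \<comment> \<open>The quadratic part scales with \<open>c\<close> and the quartic part with
      \<open>c^2\<close>, so the energy is \<open>c / 4\<close> times
      \<open>2 \<Lambda> - c Q\<close>, which changes sign exactly at the threshold.\<close>
    then have "energy A V v = c / 2 * \<Lambda> - c / 4 * (c * Q)"
      unfolding energy_def v_Sigma by (simp add: power2_eq_square)
    also have "\<dots> \<le> c / 2 * \<Lambda> - c / 4 * (2 * \<Lambda>)"
      using c_pos by (intro diff_left_mono mult_left_mono cQ) simp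
    finally show ?thesis by simp
  qed
  ultimately have "ereal (energy A V u) \<le> ereal 0"
    unfolding min by (meson ereal_less_eq(3) order_trans)
  with pos show False by simp
qed

end
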